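(* Let $K$ be a commutative ring with identity and let $q\in K$ be invertible. The tower of affine Temperley-Lieb algebras $$TL\tilde D_3(q)\xrightarrow{P_3}TL\tilde D_4(q)\xrightarrow{P_4}\cdots\longrightarrow TL\tilde D_n(q)\xrightarrow{P_n}TL\tilde D_{n+1}(q)\longrightarrow\cdots$$ is a tower of faithful arrows; that is, $P_n$ is injective for every $n\ge3$.
   Context: For $x,y$ in a ring with identity put $V(x,y)=xyx+xy+yx+x+y+1$. For $n\ge 3$, $TL\tilde D_{n+1}(q)$ is the $K$-algebra with generators $T_{\sigma_{\bar 1}},T_{\sigma_1},\dots,T_{\sigma_n},T_{\sigma_{\bar n}}$ and relations: $T_{\sigma_i}T_{\sigma_j}=T_{\sigma_j}T_{\sigma_i}$ for $1\le i,j\le n$, $|i-j|\ge2$; $T_{\sigma_{\bar 1}}T_{\sigma_{\bar n}}=T_{\sigma_{\bar n}}T_{\sigma_{\bar 1}}$ and $T_{\sigma_{\bar 1}}T_{\sigma_i}=T_{\sigma_i}T_{\sigma_{\bar 1}}$ for $1\le i\le n$, $i\ne2$; $T_{\sigma_{\bar n}}T_{\sigma_i}=T_{\sigma_i}T_{\sigma_{\bar n}}$ for $1\le i\le n$, $i\ne n-1$; $T_{\sigma_i}T_{\sigma_{i+1}}T_{\sigma_i}=T_{\sigma_{i+1}}T_{\sigma_i}T_{\sigma_{i+1}}$ for $1\le i\le n-1$; $T_{\sigma_{\bar 1}}T_{\sigma_2}T_{\sigma_{\bar 1}}=T_{\sigma_2}T_{\sigma_{\bar 1}}T_{\sigma_2}$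 and $T_{\sigma_{\bar n}}T_{\sigma_{n-1}}T_{\sigma_{\bar n}}=T_{\sigma_{n-1}}T_{\sigma_{\bar n}}T_{\sigma_{n-1}}$; $T^2=(q-1)T+q$ for every generator $T$; $V(T_{\sigma_{\bar 1}},T_{\sigma_2})=V(T_{\sigma_{\bar n}},T_{\sigma_{n-1}})=0$ and $V(T_{\sigma_i},T_{\sigma_{i+1}})=0$ for $1\le i\le n-1$. Each generator is invertible since $q$ is. One sets $TL\tilde D_3(q)=K$. For $n\ge 4$, writing $h$ instead of $T$ for the generators $h_{\sigma_{\bar 1}},h_{\sigma_1},\dots,h_{\sigma_{n-1}},h_{\sigma_{\overline{n-1}}}$ of $TL\tilde D_n(q)$, $P_n:TL\tilde D_n(q)\to TL\tilde D_{n+1}(q)$ is the $K$-algebra morphism given by $h_\sigma\mapsto T_\sigma$ for $\sigma\in\{\sigma_{\bar 1},\sigma_1,\dots,\sigma_{n-1}\}$ and $h_{\sigma_{\overline{n-1}}}\mapsto T_{\sigma_n}T_{\sigma_{n-1}}T_{\sigma_{\bar n}}T_{\sigma_{n-1}}^{-1}T_{\sigma_n}^{-1}$ (this is well defined). $P_3:K\to TL\tilde D_4(q)$ is the unit morphism. *)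

theory Defs
  imports "HOL-Algebra.QuotRing" "HOL-Library.Poly_Mapping"
begin

section \<open>Associative algebras by generators and relations\<close>

text \<open>
  The free monoid on \<open>'g\<close>, written additively because \<open>Poly_Mapping\<close> builds the convolution
  product of \<open>'a \<Rightarrow>\<^sub>0 'k\<close> from an additive monoid \<open>'a\<close>. Thus \<open>'g word \<Rightarrow>\<^sub>0 'k\<close> is the free
  associative (noncommutative) unital algebra over \<open>'k\<close> on \<open>'g\<close>.

  The coefficient ring is a type of sort \<open>{comm_ring, monoid_mult}\<close>, a commutative ring with
  identity. The class \<open>comm_ring_1\<close> is not used since it excludes the zero ring.
\<close>

datatype 'g word = Word (letters: "'g list")

instantiation word :: (type) monoid_add
begin

definition zero_word :: "'a word" where
  "0 = Word []"

definition plus_word :: "'a word \<Rightarrow> 'a word \<Rightarrow> 'a word" where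
  "u + v = Word (letters u @ letters v)"

instance
  by standard (simp_all add: zero_word_def plus_word_def)

end

type_synonym ('g, 'k) falg = "'g word \<Rightarrow>\<^sub>0 'k"

definition fconst :: "'k \<Rightarrow> ('g, 'k::{comm_ring, monoid_mult}) falg" where
  "fconst c = Poly_Mapping.single 0 c"

definition fgen :: "'g \<Rightarrow> ('g, 'k::{comm_ring, monoid_mult}) falg" where
  "fgen g = Poly_Mapping.single (Word [g]) 1"

text \<open>The free algebra on the set \<open>S\<close> of generators.\<close>

definition free_algebra :: "'g set \<Rightarrow> ('g, 'k::{comm_ring, monoid_mult}) falg ring" where
  "free_algebra S =
    \<lparr>carrier = {f. \<forall>w \<in> Poly_Mapping.keys f. set (letters w) \<subseteq> S},
     monoid.mult = (*), one = fconst 1, zero = 0, add = (+)\<rparr>"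

text \<open>A pair \<open>(l, r)\<close> in \<open>R\<close> stands for the relation \<open>l = r\<close>.\<close>

definition relation_ideal ::
  "'g set \<Rightarrow> (('g, 'k::{comm_ring, monoid_mult}) falg \<times> ('g, 'k) falg) set \<Rightarrow> ('g, 'k) falg set"
  where "relation_ideal S R = Idl\<^bsub>free_algebra S\<^esub> {l - r | l r. (l, r) \<in> R}"

definition presented_algebra ::
  "'g set \<Rightarrow> (('g, 'k::{comm_ring, monoid_mult}) falg \<times> ('g, 'k) falg) set \<Rightarrow> ('g, 'k) falg set ring"
  where "presented_algebra S R = free_algebra S Quot relation_ideal S R"

text \<open>
  The value of a free algebra element in a \<open>K\<close>-algebra \<open>A\<close> with structure map \<open>\<iota>\<close> (from \<open>K\<close> to
  the centre of \<open>A\<close>) when each generator \<open>g\<close> is replaced by \<open>\<phi> g\<close>.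
\<close>

definition falg_eval ::
  "('a, 'm) ring_scheme \<Rightarrow> ('k \<Rightarrow> 'a) \<Rightarrow> ('g \<Rightarrow> 'a) \<Rightarrow> ('g, 'k::{comm_ring, monoid_mult}) falg \<Rightarrow> 'a"
  where "falg_eval A \<iota> \<phi> f =
    (\<Oplus>\<^bsub>A\<^esub>w \<in> Poly_Mapping.keys f.
      \<iota> (Poly_Mapping.lookup f w) \<otimes>\<^bsub>A\<^esub> foldr (\<lambda>g x. \<phi> g \<otimes>\<^bsub>A\<^esub> x) (letters w) \<one>\<^bsub>A\<^esub>)"


section \<open>The algebras $TL\tilde D_{n+1}(q)$\<close>

definition V :: "('a, 'm) ring_scheme \<Rightarrow> 'a \<Rightarrow> 'a \<Rightarrow> 'a" where
  "V R x y = x \<otimes>\<^bsub>R\<^esub> y \<otimes>\<^bsub>R\<^esub> x \<oplus>\<^bsub>R\<^esub> x \<otimes>\<^bsub>R\<^esub> y \<oplus>\<^bsub>R\<^esub> y \<otimes>\<^bsub>R\<^esub> x \<oplus>\<^bsub>R\<^esub> x \<oplus>\<^bsub>R\<^esub> y \<oplus>\<^bsub>R\<^esub> \<one>\<^bsub>R\<^esub>"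

text \<open>\<open>Sig i\<close> is $\sigma_i$ and \<open>Sigbar i\<close> is $\sigma_{\bar i}$.\<close>

datatype node = Sig nat | Sigbar nat

definition nodes :: "nat \<Rightarrow> node set" where
  "nodes n = Sig ` {1..n} \<union> {Sigbar 1, Sigbar n}"

definition comm_rel ::
  "'g \<Rightarrow> 'g \<Rightarrow> ('g, 'k::{comm_ring, monoid_mult}) falg \<times> ('g, 'k) falg" where
  "comm_rel a b = (fgen a * fgen b, fgen b * fgen a)"

definition braid_rel ::
  "'g \<Rightarrow> 'g \<Rightarrow> ('g, 'k::{comm_ring, monoid_mult}) falg \<times> ('g, 'k) falg" where
  "braid_rel a b = (fgen a * fgen b * fgen a, fgen b * fgen a * fgen b)"

definition quad_rel ::
  "'k \<Rightarrow> 'g \<Rightarrow> ('g, 'k::{comm_ring, monoid_mult}) falg \<times> ('g, 'k) falg" where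
  "quad_rel q a = (fgen a * fgen a, fconst (q - 1) * fgen a + fconst q)"

definition V_rel ::
  "'g \<Rightarrow> 'g \<Rightarrow> ('g, 'k::{comm_ring, monoid_mult}) falg \<times> ('g, 'k) falg" where
  "V_rel a b = (V (free_algebra UNIV) (fgen a) (fgen b), 0)"

text \<open>The relations of $TL\tilde D_{n+1}(q)$, for $n \ge 3$.\<close>

definition TLD_rels ::
  "nat \<Rightarrow> 'k::{comm_ring, monoid_mult} \<Rightarrow> ((node, 'k) falg \<times> (node, 'k) falg) set" where
  "TLD_rels n q =
     {comm_rel (Sig i) (Sig j) | i j.
        1 \<le> i \<and> i \<le> n \<and> 1 \<le> j \<and> j \<le> n \<and> \<bar>int i - int j\<bar> \<ge> 2} \<union>
     {comm_rel (Sigbar 1) (Sigbar n)} \<union>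
     {comm_rel (Sigbar 1) (Sig i) | i. 1 \<le> i \<and> i \<le> n \<and> i \<noteq> 2} \<union>
     {comm_rel (Sigbar n) (Sig i) | i. 1 \<le> i \<and> i \<le> n \<and> i \<noteq> n - 1} \<union>
     {braid_rel (Sig i) (Sig (i + 1)) | i. 1 \<le> i \<and> i \<le> n - 1} \<union>
     {braid_rel (Sigbar 1) (Sig 2), braid_rel (Sigbar n) (Sig (n - 1))} \<union>
     {quad_rel q a | a. a \<in> nodes n} \<union>
     {V_rel (Sigbar 1) (Sig 2), V_rel (Sigbar n) (Sig (n - 1))} \<union>
     {V_rel (Sig i) (Sig (i + 1)) | i. 1 \<le> i \<and> i \<le> n - 1}"

text \<open>
  \<open>TLD m q\<close> is $TL\tilde D_m(q)$; it is generated by the nodes of index up to \<open>m - 1\<close>, and is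
  meant for \<open>m \<ge> 4\<close> only. The remaining algebra $TL\tilde D_3(q)$ is the type \<open>'k\<close> itself.
\<close>

definition TLD :: "nat \<Rightarrow> 'k::{comm_ring, monoid_mult} \<Rightarrow> (node, 'k) falg set ring" where
  "TLD m q = presented_algebra (nodes (m - 1)) (TLD_rels (m - 1) q)"

definition TLD_class ::
  "nat \<Rightarrow> 'k::{comm_ring, monoid_mult} \<Rightarrow> (node, 'k) falg \<Rightarrow> (node, 'k) falg set" where
  "TLD_class m q f =
     relation_ideal (nodes (m - 1)) (TLD_rels (m - 1) q) +>\<^bsub>free_algebra (nodes (m - 1))\<^esub> f"

text \<open>The unit morphism $K \to TL\tilde D_m(q)$ and the generators $T_\sigma$.\<close>

definition TLD_unit ::
  "nat \<Rightarrow> 'k::{comm_ring, monoid_mult} \<Rightarrow> 'k \<Rightarrow> (node, 'k) falg set" where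
  "TLD_unit m q c = TLD_class m q (fconst c)"

definition TLD_T ::
  "nat \<Rightarrow> 'k::{comm_ring, monoid_mult} \<Rightarrow> node \<Rightarrow> (node, 'k) falg set" where
  "TLD_T m q a = TLD_class m q (fgen a)"


section \<open>The morphisms $P_n$\<close>

text \<open>Images of the generators of $TL\tilde D_n(q)$ in $TL\tilde D_{n+1}(q)$, for $n \ge 4$.\<close>

definition P_gen ::
  "nat \<Rightarrow> 'k::{comm_ring, monoid_mult} \<Rightarrow> node \<Rightarrow> (node, 'k) falg set" where
  "P_gen n q a =
     (let A = TLD (n + 1) q; T = TLD_T (n + 1) q in
      if a = Sigbar (n - 1)
      then T (Sig n) \<otimes>\<^bsub>A\<^esub> T (Sig (n - 1)) \<otimes>\<^bsub>A\<^esub> T (Sigbar n)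
             \<otimes>\<^bsub>A\<^esub> inv\<^bsub>A\<^esub> T (Sig (n - 1)) \<otimes>\<^bsub>A\<^esub> inv\<^bsub>A\<^esub> T (Sig n)
      else T a)"

text \<open>
  The map induced on the quotient $TL\tilde D_n(q)$ by evaluation of the free algebra, which is
  constant on each coset \<open>X\<close> because the defining relations are preserved.
\<close>

definition P ::
  "nat \<Rightarrow> 'k::{comm_ring, monoid_mult} \<Rightarrow> (node, 'k) falg set \<Rightarrow> (node, 'k) falg set" where
  "P n q X = the_elem (falg_eval (TLD (n + 1) q) (TLD_unit (n + 1) q) (P_gen n q) ` X)"

definition P3 :: "'k::{comm_ring, monoid_mult} \<Rightarrow> 'k \<Rightarrow> (node, 'k) falg set" where
  "P3 q = TLD_unit 4 q"

end

theory Submission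
  imports Defs
begin

text \<open>
  In terms of \<open>b = T + 1\<close> the relations say \<open>b\<^sup>2 = (q + 1) b\<close>, \<open>b b' b = q b\<close> for neighbours and
  \<open>b b' = b' b\<close> otherwise. As rewriting rules on words modulo commutations they are confluent, so
  the reduced (fully commutative) words are a basis of the target algebra and they span the source.

  Conjugating $P_n$ by $T_{\sigma_n} \cdots T_{\sigma_3}$ turns it into the map \<open>\<psi>\<close> which subdivides
  the node $\sigma_2$: all other generators are only renamed, and $b_{\sigma_2}$ goes to
  $a + a' - a a' - q^{-1} a' a$ for the two adjacent nodes that replace it. In the image of a reduced
  word every $\sigma_2$ contributes \<open>a a'\<close> or \<open>a' a\<close> to the terms of maximal length; each such term
  determines the original word, and the choices can be made such that one of them is reduced. Its
  coefficient is a unit, which gives injectivity by looking at the longest terms.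
\<close>

section \<open>Reduction of words and confluence up to commutations\<close>

text \<open>The image of the last barred generator under \<open>P\<close> has five factors, two of
  them inverses, and its expansion in the b is unwieldy; after conjugation a single generator
  changes, and its image has terms of length at most two. The node sigma_2 suits this because its
  left neighbours are end nodes. The obstacle is the choice between a a' and a' a. Consecutive
  sigma_2 are separated by s left and r right letters with s + r at least 2, and after subdivision
  both a and a' must again see two neighbours in between. A gap with s = 0 forces a a' before it and
  a' a after it, r = 0 forces the opposite, and s = 1 or r = 1 each excludes one combination. Along
  a word such demands might conflict. The bounds that prevent this come from the left end nodes and,
  propagated along the path, from the right fork. Independence of the reduced words needs no model
  of the algebra: confluence makes the coefficient of a normal form a function on words, and its
  linear extension kills the relation ideal. K may have zero divisors, so it matters that the
  leading coefficient is, up to sign, a power of the inverse of q.\<close>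

locale tl_graph =
  fixes adj :: "'g \<Rightarrow> 'g \<Rightarrow> bool"
  assumes adj_sym: "adj a b \<Longrightarrow> adj b a"
    and adj_irrefl: "\<not> adj a a"
begin

definition swap :: "'g list \<Rightarrow> 'g list \<Rightarrow> bool" where
  "swap w w' \<longleftrightarrow> (\<exists>u a b v. w = u @ a # b # v \<and> w' = u @ b # a # v \<and> a \<noteq> b \<and> \<not> adj a b)"

text \<open>The congruence of the partially commutative (trace) monoid in which exactly the distinct
  nonadjacent letters commute.\<close>

definition teq :: "'g list \<Rightarrow> 'g list \<Rightarrow> bool" (infix "\<sim>" 50) where
  "teq = swap\<^sup>*\<^sup>*"

lemma swapI: "a \<noteq> b \<Longrightarrow> \<not> adj a b \<Longrightarrow> swap (u @ a # b # v) (u @ b # a # v)"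
  unfolding swap_def by blast

lemma swap_sym: "swap w w' \<Longrightarrow> swap w' w"
  unfolding swap_def using adj_sym by metis

lemma swap_append: "swap w w' \<Longrightarrow> swap (u @ w @ v) (u @ w' @ v)"
  unfolding swap_def by (metis append.assoc append_Cons)

lemma teq_refl [simp]: "w \<sim> w"
  by (simp add: teq_def)

lemma swap_teq: "swap w w' \<Longrightarrow> w \<sim> w'"
  by (auto simp: teq_def)

lemma teq_trans [trans]: "u \<sim> v \<Longrightarrow> v \<sim> w \<Longrightarrow> u \<sim> w"
  by (simp add: teq_def)

lemma teq_sym: "u \<sim> v \<Longrightarrow> v \<sim> u"
  unfolding teq_def
  by (induction rule: rtranclp_induct) (auto intro: swap_sym converse_rtranclp_into_rtranclp)

lemma teq_append: "w \<sim> w' \<Longrightarrow> u @ w @ v \<sim> u @ w' @ v"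
  unfolding teq_def
  by (induction rule: rtranclp_induct) (auto intro: swap_append rtranclp.rtrancl_into_rtrancl)

lemma teq_Cons: "w \<sim> w' \<Longrightarrow> a # w \<sim> a # w'"
  using teq_append[of w w' "[a]" "[]"] by simp

lemma swap_length: "swap w w' \<Longrightarrow> length w = length w'"
  unfolding swap_def by auto

lemma teq_length: "w \<sim> w' \<Longrightarrow> length w = length w'"
  unfolding teq_def by (induction rule: rtranclp_induct) (auto dest: swap_length)

lemma swap_set: "swap w w' \<Longrightarrow> set w = set w'"
  unfolding swap_def by auto

lemma teq_set: "w \<sim> w' \<Longrightarrow> set w = set w'"
  unfolding teq_def by (induction rule: rtranclp_induct) (auto dest: swap_set)

lemma teq_move: "\<forall>a\<in>set x. a \<noteq> s \<and> \<not> adj s a \<Longrightarrow> s # x @ v \<sim> x @ s # v"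
proof (induction x)
  case (Cons a x)
  have "swap ([] @ s # a # (x @ v)) ([] @ a # s # (x @ v))"
    using Cons.prems by (intro swapI) auto
  then have "s # (a # x) @ v \<sim> a # s # x @ v"
    using swap_teq by simp
  also have "\<dots> \<sim> (a # x) @ s # v"
    using Cons by (simp add: teq_Cons)
  finally show ?case .
qed simp

lemma swap_filter:
  assumes "swap w w'"
  shows "filter p w = filter p w' \<or> swap (filter p w) (filter p w')"
proof -
  obtain u a b v where w: "w = u @ a # b # v" "w' = u @ b # a # v" "a \<noteq> b" "\<not> adj a b"
    using assms unfolding swap_def by blast
  show ?thesis
    using w swapI[of a b "filter p u" "filter p v"] by (cases "p a"; cases "p b") auto
qed

text \<open>The two copies of \<open>s\<close> need not be contiguous. All letters between them
  except at most one neighbour commute with \<open>s\<close>, so this is a contraction of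
  \<open>s s\<close> or \<open>s t s\<close> to \<open>s\<close>, carried out modulo commutations;
  \<open>k\<close> tells which of the two scalars it produces. In this form a step survives every
  commutation.\<close>

definition step :: "'g list \<Rightarrow> nat \<Rightarrow> 'g list \<Rightarrow> bool" where
  "step w k w' \<longleftrightarrow> (\<exists>u s x v. w = u @ s # x @ s # v \<and> s \<notin> set x \<and>
     k = length (filter (adj s) x) \<and> k \<le> 1 \<and> w' = u @ s # filter (\<lambda>a. \<not> adj s a) x @ v)"

definition FC :: "'g list \<Rightarrow> bool" where
  "FC w \<longleftrightarrow> (\<nexists>k w'. step w k w')"

lemma stepI:
  "s \<notin> set x \<Longrightarrow> length (filter (adj s) x) = k \<Longrightarrow> k \<le> 1 \<Longrightarrow>
   step (u @ s # x @ s # v) k (u @ s # filter (\<lambda>a. \<not> adj s a) x @ v)"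
  unfolding step_def by blast

lemma step_length: "step w k w' \<Longrightarrow> length w' < length w"
  unfolding step_def by (auto intro!: le_imp_less_Suc length_filter_le)

lemma step_set: "step w k w' \<Longrightarrow> set w' \<subseteq> set w"
  unfolding step_def by auto

text \<open>A commutation cannot move a neighbour of \<open>s\<close> past a copy of
  \<open>s\<close>, so the same contraction stays available with the same \<open>k\<close>. The
  seven cases locate the exchanged pair relative to the two copies of \<open>s\<close>.\<close>

lemma swap_step:
  assumes "swap w w'" "step w k v"
  shows "\<exists>v'. step w' k v' \<and> v \<sim> v'"
proof -
  obtain p a b r where w: "w = p @ a # b # r" and w': "w' = p @ b # a # r"
    and ab: "a \<noteq> b" "\<not> adj a b" "\<not> adj b a"
    using assms(1) adj_sym unfolding swap_def by metis
  obtain u s x z where w2: "w = u @ s # x @ s # z" and s: "s \<notin> set x"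
    and k: "length (filter (adj s) x) = k" "k \<le> 1"
    and v: "v = u @ s # filter (\<lambda>a. \<not> adj s a) x @ z"
    using assms(2) unfolding step_def by metis
  define N where "N = filter (\<lambda>a. \<not> adj s a)"
  have eq: "p @ a # b # r = u @ s # x @ s # z" using w w2 by simp
  have mv: "\<And>u v. u @ a # b # v \<sim> u @ b # a # v"
    using ab swapI swap_teq by blast
  consider (inu) us where "u = p @ a # b # us" "r = us @ s # x @ s # z"
    | (us) "u = p @ [a]" "b = s" "r = x @ s # z"
    | (sx) "u = p" "a = s" "b # r = x @ s # z"
    | (inx) us zs where "p = u @ s # us" "x = us @ a # b # zs" "r = zs @ s # z"
    | (xs) us where "p = u @ s # us" "x = us @ [a]" "b = s" "r = z"
    | (sv) "p = u @ s # x" "a = s" "z = b # r"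
    | (inv) xs where "p = u @ s # x @ s # xs" "z = xs @ a # b # r"
    using eq by (auto simp: append_eq_append_conv2 Cons_eq_append_conv append_eq_Cons_conv)
  then show ?thesis
  proof cases
    case inu
    have "step w' k (p @ b # a # us @ s # N x @ z)"
      using stepI[OF s k, of "p @ b # a # us" z] inu w' by (simp add: N_def)
    then show ?thesis
      using v inu mv[of p] by (auto simp: N_def)
  next
    case us
    have "step w' k (p @ s # N (a # x) @ z)"
      using stepI[of s "a # x" k p z] us w' s k ab by (simp add: N_def)
    then show ?thesis
      using v us mv[of p "N x @ z"] ab by (auto simp: N_def)
  next
    case sx
    then obtain x0 where x0: "x = b # x0" "r = x0 @ s # z"
      using ab by (auto simp: Cons_eq_append_conv)
    have "step w' k ((p @ [b]) @ s # N x0 @ z)"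
      using stepI[of s x0 k "p @ [b]" z] sx w' s k ab x0 by (simp add: N_def)
    then show ?thesis
      using v sx mv[of p "N x0 @ z"] ab x0 by (auto simp: N_def)
  next
    case inx
    let ?x' = "us @ b # a # zs"
    have "swap x ?x'" using ab swapI inx by simp
    then have "N x \<sim> N ?x'"
      using swap_filter[of x ?x' "\<lambda>a. \<not> adj s a"] swap_teq unfolding N_def by auto
    then have "v \<sim> u @ s # N ?x' @ z"
      using v teq_append[of "N x" "N ?x'" "u @ [s]" z] by (simp add: N_def)
    moreover have "step w' k (u @ s # N ?x' @ z)"
      using stepI[of s ?x' k u z] inx w' s k by (auto simp: N_def)
    ultimately show ?thesis by blast
  next
    case xs
    have "step w' k (u @ s # N us @ a # z)"
      using stepI[of s us k u "a # z"] xs w' s k ab by (simp add: N_def)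
    then show ?thesis
      using v xs ab by (auto simp: N_def)
  next
    case sv
    have "step w' k (u @ s # N (x @ [b]) @ r)"
      using stepI[of s "x @ [b]" k u r] sv w' s k ab by (simp add: N_def)
    then show ?thesis
      using v sv ab by (auto simp: N_def)
  next
    case inv
    have "step w' k (u @ s # N x @ xs @ b # a # r)"
      using stepI[OF s k, of u "xs @ b # a # r"] inv w' by (simp add: N_def)
    then show ?thesis
      using v inv mv[of "u @ s # N x @ xs" r] by (auto simp: N_def)
  qed
qed

lemma teq_step:
  assumes "w \<sim> w'" "step w k v"
  shows "\<exists>v'. step w' k v' \<and> v \<sim> v'"
  using assms unfolding teq_def
proof (induction rule: rtranclp_induct)
  case (step y z)
  then show ?case
    using swap_step teq_trans unfolding teq_def by (meson rtranclp_trans)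
qed auto

lemma teq_FC: "w \<sim> w' \<Longrightarrow> FC w \<Longrightarrow> FC w'"
  unfolding FC_def using teq_step teq_sym by blast

end

section \<open>Confluence modulo commutations, for arbitrary weights\<close>

lemma append_Cons_cases:
  assumes "x @ a # v = x' @ a' # v'"
  obtains (less) y where "x = x' @ a' # y" "v' = y @ a # v"
    | (eq) "x = x'" "a = a'" "v = v'"
    | (greater) y where "x' = x @ a # y" "v = y @ a' # v'"
  using assms by (fastforce simp: append_eq_append_conv2 Cons_eq_append_conv append_eq_Cons_conv)

lemma length_filter_conj:
  "length (filter p x) = length (filter (\<lambda>a. p a \<and> q a) x) + length (filter p (filter (\<lambda>a. \<not> q a) x))"
  by (induction x) auto

locale tl_scalars = tl_graph adj for adj :: "'g \<Rightarrow> 'g \<Rightarrow> bool" +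
  fixes wt :: "nat \<Rightarrow> 'k::{comm_ring, monoid_mult}"
begin

text \<open>\<open>red w c v\<close> says that the monomial of \<open>w\<close> reduces to \<open>c\<close> times the monomial of \<open>v\<close>.\<close>

inductive red :: "'g list \<Rightarrow> 'k \<Rightarrow> 'g list \<Rightarrow> bool" where
  refl: "red w 1 w"
| step: "step w k w' \<Longrightarrow> red w' c v \<Longrightarrow> red w (wt k * c) v"

lemma red_step: "step w k w' \<Longrightarrow> red w (wt k) w'"
  using red.step[OF _ red.refl] by simp

lemma red_trans: "red u c v \<Longrightarrow> red v e w \<Longrightarrow> red u (c * e) w"
  by (induction rule: red.induct) (auto simp: mult.assoc intro: red.step)

lemma red_length: "red w c v \<Longrightarrow> length v \<le> length w \<and> (length v = length w \<longrightarrow> v = w \<and> c = 1)"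
  by (induction rule: red.induct) (auto dest!: step_length)

lemma red_set: "red w c v \<Longrightarrow> set v \<subseteq> set w"
  by (induction rule: red.induct) (auto dest!: step_set)

lemma ex_red_FC: "\<exists>c v. red w c v \<and> FC v"
proof (induction w rule: length_induct)
  case (1 w)
  show ?case
  proof (cases "FC w")
    case False
    then obtain k w' where "step w k w'" by (auto simp: FC_def)
    then show ?thesis using 1 step_length red.step by blast
  qed (use red.refl in blast)
qed

definition joinable :: "nat \<Rightarrow> 'g list \<Rightarrow> nat \<Rightarrow> 'g list \<Rightarrow> bool" where
  "joinable k v k' v' \<longleftrightarrow>
     (\<exists>c z c' z'. red v c z \<and> red v' c' z' \<and> wt k * c = wt k' * c' \<and> z \<sim> z')"

lemma joinable_sym: "joinable k v k' v' \<Longrightarrow> joinable k' v' k v"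
  unfolding joinable_def using teq_sym by metis

lemma joinable_teq: "v \<sim> v' \<Longrightarrow> joinable k v k v'"
  unfolding joinable_def by (rule exI[of _ 1], rule exI[of _ v], rule exI[of _ 1], rule exI[of _ v']) (simp add: red.refl)

lemma joinable_step: "step v k1 z \<Longrightarrow> step v' k1' z \<Longrightarrow> wt k * wt k1 = wt k' * wt k1' \<Longrightarrow> joinable k v k' v'"
  unfolding joinable_def using red_step teq_refl by blast

text \<open>Two pairs of equal letters coincide, touch, are disjoint, nested or interleaved. In the
  last two situations, for nonadjacent \<open>s\<close> and \<open>s'\<close>, they interact only
  through common neighbours, counted by \<open>c\<close>: contracting one pair takes
  \<open>c\<close> neighbours away from the other. If \<open>c\<close> is 1, then \<open>k\<close>
  and \<open>k'\<close> are both 1, and either order produces \<open>wt 1\<close> and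
  \<open>wt 0\<close> once each.\<close>

lemma local_confluence_ordered:
  assumes w: "u @ s # x @ s # v = (u @ us) @ s' # x' @ s' # v'"
    and s: "s \<notin> set x" "s' \<notin> set x'"
    and k: "length (filter (adj s) x) = k" "k \<le> 1"
    and k': "length (filter (adj s') x') = k'" "k' \<le> 1"
  shows "joinable k (u @ s # filter (\<lambda>a. \<not> adj s a) x @ v)
                  k' ((u @ us) @ s' # filter (\<lambda>a. \<not> adj s' a) x' @ v')"
proof -
  define N where "N = filter (\<lambda>a. \<not> adj s a)"
  define N' where "N' = filter (\<lambda>a. \<not> adj s' a)"
  define n where "n = (\<lambda>x. length (filter (adj s) x))"
  define n' where "n' = (\<lambda>x. length (filter (adj s') x))"
  define c where "c = (\<lambda>x. length (filter (\<lambda>a. adj s a \<and> adj s' a) x))"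
  have NN: "N (N' y) = N' (N y)" for y
    by (simp add: N_def N'_def conj_commute)
  have n1: "n y = c y + n (N' y)" for y
    unfolding n_def c_def N'_def by (rule length_filter_conj)
  have n2: "n' y = c y + n' (N y)" for y
    using length_filter_conj[of "adj s'" y "adj s"] unfolding n'_def c_def N_def by (simp add: conj_commute)
  have nN: "n (N y) = 0" "n' (N' y) = 0" for y
    by (auto simp: n_def N_def n'_def N'_def filter_empty_conv)
  have st: "s \<notin> set y \<Longrightarrow> n y \<le> 1 \<Longrightarrow> step (u @ s # y @ s # v) (n y) (u @ s # N y @ v)" for y u v
    using stepI unfolding n_def N_def by blast
  have st': "s' \<notin> set y \<Longrightarrow> n' y \<le> 1 \<Longrightarrow> step (u @ s' # y @ s' # v) (n' y) (u @ s' # N' y @ v)" for y u v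
    using stepI unfolding n'_def N'_def by blast
  have app: "n (y @ z) = n y + n z" "n' (y @ z) = n' y + n' z" "N (y @ z) = N y @ N z" "N' (y @ z) = N' y @ N' z"
    "c (y @ z) = c y + c z" for y z
    by (simp_all add: n_def n'_def N_def N'_def c_def)
  have nc: "n (a # z) = (if adj s a then 1 else 0) + n z" "n' (a # z) = (if adj s' a then 1 else 0) + n' z"
    "N (a # z) = (if adj s a then N z else a # N z)" "N' (a # z) = (if adj s' a then N' z else a # N' z)"
    "n [] = 0" "n' [] = 0" "N [] = []" "N' [] = []"
    "c (a # z) = (if adj s a \<and> adj s' a then 1 else 0) + c z" "c [] = 0" for a z
    by (simp_all add: n_def n'_def N_def N'_def c_def)
  have sets: "set (N y) \<subseteq> set y" "set (N' y) \<subseteq> set y" for y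
    by (auto simp: N_def N'_def)
  have kk: "n x = k" "n' x' = k'" using k k' by (auto simp: n_def n'_def)
  consider (eq) "us = []" "s = s'" "x = x'" "v = v'"
    | (touch) "us = s # x" "s = s'" "v = x' @ s # v'"
    | (disj) y where "us = s # x @ s # y" "v = y @ s' # x' @ s' # v'"
    | (nest) A B where "us = s # A" "x = A @ s' # x' @ s' # B" "v' = B @ s # v"
    | (inter) A B C where "us = s # A" "x = A @ s' # B" "x' = B @ s # C" "v = C @ s' # v'" "s \<noteq> s'"
  proof (cases us)
    case Nil
    then have e: "s = s'" "x @ s # v = x' @ s' # v'" using w by auto
    from e(2) show ?thesis
      by (cases rule: append_Cons_cases) (use s e(1) Nil that(1) in auto)
  next
    case (Cons s0 us')
    then have e: "us = s # us'" "us' @ s' # (x' @ s' # v') = x @ s # v" using w by auto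
    from e(2) show ?thesis
    proof (cases rule: append_Cons_cases)
      case (less y)
      with e(1) s show ?thesis by (intro that(3)) auto
    next
      case eq
      with e(1) show ?thesis by (intro that(2)) auto
    next
      case (greater zs)
      have ne: "s \<noteq> s'" using greater s by auto
      from greater(2)[symmetric] show ?thesis
      proof (cases rule: append_Cons_cases)
        case (less ys)
        with greater(1) e(1) show ?thesis by (intro that(4)) auto
      next
        case eq
        with ne show ?thesis by simp
      next
        case (greater ys)
        with \<open>x = us' @ s' # zs\<close> e(1) ne show ?thesis by (intro that(5)) auto
      qed
    qed
  qed
  then have "joinable k (u @ s # N x @ v) k' ((u @ us) @ s' # N' x' @ v')"
  proof cases
    case eq
    moreover have "k = k'" using eq k(1) k'(1) by simp
    ultimately show ?thesis using joinable_teq[OF teq_refl] by (simp add: N_def N'_def)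
  next
    case touch
    have eqs: "N' = N" "n' = n" using touch by (auto simp: N_def N'_def n_def n'_def)
    have "step (u @ s # (N x @ x') @ s # v') (n (N x @ x')) (u @ s # N (N x @ x') @ v')"
      using s touch k' kk eqs sets by (intro st) (auto simp: app nN)
    moreover have "N (N x) = N x" by (simp add: N_def)
    ultimately have "step (u @ s # N x @ v) k' (u @ s # N x @ N x' @ v')"
      using kk nN touch eqs by (simp add: app)
    moreover have "step (u @ s # x @ s # (N x' @ v')) k (u @ s # N x @ N x' @ v')"
      using st[of x u "N x' @ v'"] s k kk by simp
    ultimately show ?thesis using touch eqs by (auto intro!: joinable_step simp: mult.commute)
  next
    case disj
    have "step ((u @ s # N x @ y) @ s' # x' @ s' # v') k' ((u @ s # N x @ y) @ s' # N' x' @ v')"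
      using st'[of x' "u @ s # N x @ y" v'] s k' kk by simp
    moreover have "step (u @ s # x @ s # (y @ s' # N' x' @ v')) k (u @ s # N x @ y @ s' # N' x' @ v')"
      using st[of x u "y @ s' # N' x' @ v'"] s k kk by simp
    ultimately show ?thesis using disj by (auto intro!: joinable_step simp: mult.commute)
  next
    case nest
    have na: "\<not> adj s s'"
    proof
      assume "adj s s'"
      then have "n x \<ge> 2" unfolding nest(2) by (simp add: app nc)
      then show False using k(2) kk(1) by simp
    qed
    have e1: "n' (N x') = k' - c x'" "c x' \<le> k'" using n2[of x'] kk by auto
    have e2: "n (A @ s' # N' x' @ B) = k - c x'" "c x' \<le> k"
      using n1[of x'] kk nest na by (auto simp: app nc)
    have "s' \<notin> set (N x')" "n' (N x') \<le> 1" using s(2) k'(2) e1(1) sets(1)[of x'] by auto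
    then have "step ((u @ s # N A) @ s' # N x' @ s' # (N B @ v)) (k' - c x') ((u @ s # N A) @ s' # N' (N x') @ N B @ v)"
      using st'[of "N x'" "u @ s # N A" "N B @ v"] e1(1) by simp
    moreover have "step (u @ s # (A @ s' # N' x' @ B) @ s # v) (k - c x') (u @ s # N (A @ s' # N' x' @ B) @ v)"
      using s nest e2 k sets by (subst e2(1)[symmetric], intro st) auto
    moreover have "wt k * wt (k' - c x') = wt k' * wt (k - c x')"
      using e1 e2 k k' by (cases "c x' = 0") (auto simp: mult.commute le_Suc_eq)
    ultimately show ?thesis using nest na NN by (auto intro!: joinable_step simp: app nc)
  next
    case inter
    show ?thesis
    proof (cases "adj s s'")
      \<comment> \<open>In an interleaving of adjacent letters each is the only neighbour the other
        may enclose. The two contractions then differ only by the position of \<open>s'\<close>,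
        which commutes with \<open>B\<close> and \<open>C\<close>, so no further step is
        taken.\<close>
      case True
      then have a': "adj s' s" using adj_sym by blast
      have "n A = 0" "n B = 0" "n' B = 0" "n' C = 0" "k = 1" "k' = 1"
        using k k' kk inter True a' by (auto simp: app nc)
      then have N: "N A = A" "N B = B" "N' B = B" "N' C = C"
        and nadj: "\<forall>a\<in>set (B @ C). a \<noteq> s' \<and> \<not> adj s' a"
        using inter s by (auto simp: n_def N_def n'_def N'_def filter_empty_conv filter_id_conv)
      have "(u @ s # A) @ (s' # (B @ C) @ v') @ [] \<sim> (u @ s # A) @ ((B @ C) @ s' # v') @ []"
        using teq_move[OF nadj] by (intro teq_append)
      then have "u @ s # N x @ v \<sim> (u @ us) @ s' # N' x' @ v'"
        using inter N True a' teq_sym by (auto simp: app nc)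
      then show ?thesis
        using joinable_teq \<open>k = 1\<close> \<open>k' = 1\<close> by simp
    next
      case False
      then have a': "\<not> adj s' s" using adj_sym by blast
      have e1: "n' (N B @ C) = k' - c B" "c B \<le> k'" using n2[of B] kk inter a' by (auto simp: app nc)
      have e2: "n (A @ s' # N' B) = k - c B" "c B \<le> k"
        using n1[of B] kk inter False by (auto simp: app nc)
      have "step ((u @ s # N A) @ s' # (N B @ C) @ s' # v') (k' - c B) ((u @ s # N A) @ s' # N' (N B @ C) @ v')"
        using s inter e1 k' sets by (subst e1(1)[symmetric], intro st') auto
      moreover have "step (u @ s # (A @ s' # N' B) @ s # (N' C @ v')) (k - c B) (u @ s # N (A @ s' # N' B) @ N' C @ v')"
        using s inter e2 k sets by (subst e2(1)[symmetric], intro st) auto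
      moreover have "wt k * wt (k' - c B) = wt k' * wt (k - c B)"
        using e1 e2 k k' by (cases "c B = 0") (auto simp: mult.commute le_Suc_eq)
      ultimately show ?thesis using inter False a' NN by (auto intro!: joinable_step simp: app nc)
    qed
  qed
  then show ?thesis by (simp add: N_def N'_def)
qed

lemma local_confluence:
  assumes "step w k v" "step w k' v'"
  shows "joinable k v k' v'"
proof -
  obtain u s x z where 1: "w = u @ s # x @ s # z" "s \<notin> set x"
    "length (filter (adj s) x) = k" "k \<le> 1" "v = u @ s # filter (\<lambda>a. \<not> adj s a) x @ z"
    using assms(1) unfolding step_def by metis
  obtain u' s' x' z' where 2: "w = u' @ s' # x' @ s' # z'" "s' \<notin> set x'"
    "length (filter (adj s') x') = k'" "k' \<le> 1" "v' = u' @ s' # filter (\<lambda>a. \<not> adj s' a) x' @ z'"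
    using assms(2) unfolding step_def by metis
  from 1(1) 2(1) consider us where "u' = u @ us" | us where "u = u' @ us"
    by (auto simp: append_eq_append_conv2)
  then show ?thesis
  proof cases
    case 1
    then show ?thesis
      using local_confluence_ordered[of u s x z us s' x' z' k k'] \<open>w = u @ s # x @ s # z\<close> 2
        \<open>s \<notin> set x\<close> \<open>length (filter (adj s) x) = k\<close> \<open>k \<le> 1\<close> \<open>v = _\<close> by simp
  next
    case 2
    then show ?thesis
      using local_confluence_ordered[of u' s' x' z' us s x z k' k] 1 \<open>w = u' @ s' # x' @ s' # z'\<close>
        \<open>s' \<notin> set x'\<close> \<open>length (filter (adj s') x') = k'\<close> \<open>k' \<le> 1\<close> \<open>v' = _\<close> joinable_sym by simp
  qed
qed

text \<open>Newman's lemma modulo \<open>teq\<close>, by induction on the length. The first step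
  from \<open>w'\<close> is transported to \<open>w\<close> by \<open>teq_step\<close>, so that
  local confluence can compare two steps of one word.\<close>

theorem red_unique:
  assumes "w \<sim> w'" "red w c v" "FC v" "red w' c' v'" "FC v'"
  shows "c = c' \<and> v \<sim> v'"
  using assms
proof (induction "length w" arbitrary: w w' c c' v v' rule: less_induct)
  case less
  note IH = less.hyps and prems = less.prems
  show ?case
  proof (cases "FC w")
    case True
    then have "FC w'" using prems(1) teq_FC by blast
    have "v = w" "c = 1" "v' = w'" "c' = 1"
      using prems(2,4) True \<open>FC w'\<close> by (auto elim: red.cases simp: FC_def)
    then show ?thesis using prems by simp
  next
    case False
    then have F': "\<not> FC w'" using prems(1) teq_FC teq_sym by blast
    obtain k w1 c1 where 1: "step w k w1" "red w1 c1 v" "c = wt k * c1"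
      using prems(2,3) False by (auto elim: red.cases)
    obtain k' w1' c1' where 2: "step w' k' w1'" "red w1' c1' v'" "c' = wt k' * c1'"
      using prems(4,5) F' by (auto elim: red.cases)
    obtain w2 where w2: "step w k' w2" "w1' \<sim> w2"
      using teq_step[OF teq_sym[OF prems(1)] 2(1)] by blast
    obtain e z e' z' where z: "red w1 e z" "red w2 e' z'" "wt k * e = wt k' * e'" "z \<sim> z'"
      using local_confluence[OF 1(1) w2(1)] unfolding joinable_def by blast
    obtain f y f' y' where y: "red z f y" "FC y" "red z' f' y'" "FC y'"
      using ex_red_FC by metis
    have l: "length w1 < length w" "length w2 < length w" "length w1' < length w" "length z < length w"
      using step_length[OF 1(1)] step_length[OF w2(1)] teq_length[OF w2(2)] red_length[OF z(1)] by auto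
    have a: "c1 = e * f \<and> v \<sim> y"
      using IH[OF l(1) teq_refl 1(2) prems(3) red_trans[OF z(1) y(1)] y(2)] .
    have b: "f = f' \<and> y \<sim> y'"
      using IH[OF l(4) z(4) y] .
    have d: "c1' = e' * f' \<and> v' \<sim> y'"
      using IH[OF l(3) w2(2) 2(2) prems(5) red_trans[OF z(2) y(3)] y(4)] .
    have "c = c'" using a b d 1(3) 2(3) z(3) by (metis mult.assoc)
    then show ?thesis using a b d teq_trans teq_sym by blast
  qed
qed

text \<open>The coefficient of the class of \<open>h\<close> in the normal form of \<open>w\<close>.
  Extended linearly, these functions serve as a dual basis to the reduced words.\<close>

definition nf_coeff :: "'g list \<Rightarrow> 'g list \<Rightarrow> 'k" where
  "nf_coeff h w = (if \<exists>c v. red w c v \<and> FC v \<and> v \<sim> h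
                   then THE c. \<exists>v. red w c v \<and> FC v \<and> v \<sim> h else 0)"

lemma nf_coeff_eq:
  assumes "red w c v" "FC v"
  shows "nf_coeff h w = (if v \<sim> h then c else 0)"
proof (cases "v \<sim> h")
  case True
  have "(THE c. \<exists>v. red w c v \<and> FC v \<and> v \<sim> h) = c"
    using assms True red_unique[OF teq_refl] by (intro the_equality) blast+
  then show ?thesis using assms True by (auto simp: nf_coeff_def)
next
  case False
  then have "\<not> (\<exists>c v. red w c v \<and> FC v \<and> v \<sim> h)"
    using red_unique[OF teq_refl assms] teq_trans by blast
  then show ?thesis using False unfolding nf_coeff_def by (subst if_not_P) auto
qed

lemma nf_coeff_teq:
  assumes "w \<sim> w'" shows "nf_coeff h w = nf_coeff h w'"
proof -
  obtain c v c' v' where r: "red w c v" "FC v" "red w' c' v'" "FC v'" using ex_red_FC by metis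
  then show ?thesis
    using red_unique[OF assms r] nf_coeff_eq[OF r(1,2)] nf_coeff_eq[OF r(3,4)] teq_trans teq_sym by metis
qed

lemma nf_coeff_step:
  assumes "step w k w'" shows "nf_coeff h w = wt k * nf_coeff h w'"
proof -
  obtain c v where r: "red w' c v" "FC v" using ex_red_FC by metis
  then show ?thesis using nf_coeff_eq[OF r] nf_coeff_eq[OF red.step[OF assms r(1)] r(2)] by simp
qed

lemma nf_coeff_self: "FC h \<Longrightarrow> nf_coeff h h = 1"
  using nf_coeff_eq[OF red.refl] by simp

text \<open>Every proper reduction shortens the word, so a word no longer than \<open>h\<close> can
  reach the class of \<open>h\<close> only by already lying in it.\<close>

lemma nf_coeff_eq_0:
  assumes "length w \<le> length h" "\<not> w \<sim> h" shows "nf_coeff h w = 0"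
proof -
  obtain c v where r: "red w c v" "FC v" using ex_red_FC by metis
  have "\<not> v \<sim> h" using red_length[OF r(1)] teq_length[of v h] assms by auto
  then show ?thesis using nf_coeff_eq[OF r] by simp
qed

end

section \<open>Words: counting neighbours and projecting to pairs of letters\<close>

context tl_graph
begin

text \<open>In \<open>spaced c k w\<close> the number \<open>k\<close> counts the neighbours of \<open>c\<close> read since the last \<open>c\<close>.\<close>

fun spaced :: "'g \<Rightarrow> nat \<Rightarrow> 'g list \<Rightarrow> bool" where
  "spaced c k [] = True"
| "spaced c k (z # w) =
     (if z = c then 2 \<le> k \<and> spaced c 0 w else if adj c z then spaced c (Suc k) w else spaced c k w)"

lemma spaced_append_free:
  "c \<notin> set x \<Longrightarrow> spaced c k (x @ w) = spaced c (k + length (filter (adj c) x)) w"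
  by (induction x arbitrary: k) auto

lemma spaced_not_in: "c \<notin> set w \<Longrightarrow> spaced c k w"
  using spaced_append_free[of c w k "[]"] by simp

lemma spaced_appendD: "spaced c k (u @ w) \<Longrightarrow> \<exists>k. spaced c k w"
  by (induction u arbitrary: k) (auto split: if_splits)

lemma step_Cons: "step w k w' \<Longrightarrow> step (z # w) k (z # w')"
  unfolding step_def by (metis append_Cons)

lemma FC_Cons: "FC (z # w) \<Longrightarrow> FC w"
  unfolding FC_def using step_Cons by blast

text \<open>Too few neighbours between two copies of \<open>c\<close> would give a reduction step;
  in a reduced word only the stretch before the first \<open>c\<close> can fall short, and that
  depends on the initial \<open>k\<close>.\<close>

lemma FC_imp_spaced:
  assumes "FC w" "\<not> spaced c k w"
  shows "\<exists>x v. w = x @ c # v \<and> c \<notin> set x \<and> k + length (filter (adj c) x) < 2"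
  using assms
proof (induction w arbitrary: k)
  case (Cons z w)
  have F: "FC w" using Cons.prems(1) FC_Cons by blast
  consider "z = c" "k < 2" | "z = c" "\<not> spaced c 0 w"
    | "z \<noteq> c" "adj c z" "\<not> spaced c (Suc k) w" | "z \<noteq> c" "\<not> adj c z" "\<not> spaced c k w"
    using Cons.prems(2) by (auto split: if_splits)
  then show ?case
  proof cases
    case 1
    then show ?thesis by (intro exI[of _ "[]"] exI[of _ w]) auto
  next
    case 2
    then obtain x v where "w = x @ c # v" "c \<notin> set x" "length (filter (adj c) x) < 2"
      using Cons.IH[OF F, of 0] by auto
    then have "step ([] @ c # x @ c # v) (length (filter (adj c) x)) ([] @ c # filter (\<lambda>a. \<not> adj c a) x @ v)"
      by (intro stepI) auto
    then have "\<not> FC (z # w)" using 2 \<open>w = x @ c # v\<close> by (auto simp: FC_def)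
    then show ?thesis using Cons.prems by simp
  next
    case 3
    then obtain x v where x: "w = x @ c # v" "c \<notin> set x" "Suc k + length (filter (adj c) x) < 2"
      using Cons.IH[OF F, of "Suc k"] by auto
    then show ?thesis using 3 by (intro exI[of _ "z # x"] exI[of _ v]) auto
  next
    case 4
    then obtain x v where x: "w = x @ c # v" "c \<notin> set x" "k + length (filter (adj c) x) < 2"
      using Cons.IH[OF F, of k] by auto
    then show ?thesis using 4 by (intro exI[of _ "z # x"] exI[of _ v]) auto
  qed
qed simp

text \<open>The counter starts at 2 so that the first occurrence of a letter is
  unrestricted.\<close>

lemma FC_iff: "FC w \<longleftrightarrow> (\<forall>c. spaced c 2 w)"
proof
  show "FC w \<Longrightarrow> \<forall>c. spaced c 2 w"
    using FC_imp_spaced[of w _ 2] by fastforce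
  assume r: "\<forall>c. spaced c 2 w"
  show "FC w"
    unfolding FC_def
  proof (intro notI, elim exE)
    fix k w' assume "step w k w'"
    then obtain u s x v where w: "w = u @ s # x @ s # v" "s \<notin> set x"
      "length (filter (adj s) x) \<le> 1"
      unfolding step_def by blast
    obtain k where "spaced s k (s # x @ s # v)"
      using spaced_appendD[of s 2 u "s # x @ s # v"] r w by auto
    then have "spaced s 0 (x @ s # v)" by simp
    then show False using spaced_append_free[OF w(2), of 0 "s # v"] w(3) by simp
  qed
qed

lemma teq_filter:
  assumes "w \<sim> w'" "\<And>a b. p a \<Longrightarrow> p b \<Longrightarrow> a = b \<or> adj a b"
  shows "filter p w = filter p w'"
  using assms(1) unfolding teq_def
proof (induction rule: rtranclp_induct)
  case (step y z)
  from \<open>swap y z\<close> obtain u a b v where "y = u @ a # b # v" "z = u @ b # a # v" "a \<noteq> b" "\<not> adj a b"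
    unfolding swap_def by blast
  then show ?case using step.IH assms(2)[of a b] by auto
qed simp

text \<open>The projection criterion for traces; the pairs with \<open>s = t\<close> record
  multiplicities. The first letter of \<open>w\<close> can be moved to the front of
  \<open>w'\<close>, because a neighbour standing before it in \<open>w'\<close> would show up in
  their common projection.\<close>

lemma teq_filterI:
  assumes "set w \<subseteq> A" "set w' \<subseteq> A"
    and "\<And>s t. s \<in> A \<Longrightarrow> t \<in> A \<Longrightarrow> s = t \<or> adj s t \<Longrightarrow>
           filter (\<lambda>a. a = s \<or> a = t) w = filter (\<lambda>a. a = s \<or> a = t) w'"
  shows "w \<sim> w'"
  using assms
proof (induction w arbitrary: w')
  case Nil
  have "w' = []"
  proof (cases w')
    case (Cons a l)
    then show ?thesis using Nil.prems(2) Nil.prems(3)[of a a] by simp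
  qed simp
  then show ?case by simp
next
  case (Cons s w)
  have sA: "s \<in> A" using Cons.prems by simp
  have "set (filter (\<lambda>a. a = s \<or> a = s) (s # w)) = set (filter (\<lambda>a. a = s \<or> a = s) w')"
    using Cons.prems(3)[OF sA sA] by simp
  then have "s \<in> set w'" by auto
  then obtain x y where w': "w' = x @ s # y" "s \<notin> set x"
    using split_list_first by fast
  have free: "a \<noteq> s \<and> \<not> adj s a" if ax: "a \<in> set x" for a
  proof -
    have "a \<noteq> s" using ax w' by blast
    moreover have "\<not> adj s a"
    proof
      assume "adj s a"
      then have "filter (\<lambda>b. b = s \<or> b = a) (s # w) = filter (\<lambda>b. b = s \<or> b = a) w'"
        using Cons.prems(2) Cons.prems(3)[OF sA, of a] ax w' by auto
      moreover obtain b l where "filter (\<lambda>b. b = s \<or> b = a) x = b # l"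
        using ax by (cases "filter (\<lambda>b. b = s \<or> b = a) x") (auto simp: filter_empty_conv)
      moreover then have "b \<in> set x" by (metis filter_is_subset list.set_intros(1) subsetD)
      ultimately show False using w' by simp
    qed
    ultimately show ?thesis by simp
  qed
  have "w \<sim> x @ y"
  proof (rule Cons.IH)
    show "set w \<subseteq> A" "set (x @ y) \<subseteq> A" using Cons.prems w' by auto
    fix b c assume bc: "b \<in> A" "c \<in> A" "b = c \<or> adj b c"
    have e: "filter (\<lambda>a. a = b \<or> a = c) (s # w) = filter (\<lambda>a. a = b \<or> a = c) (x @ s # y)"
      using Cons.prems(3)[OF bc] w' by simp
    have "s = b \<or> s = c \<Longrightarrow> filter (\<lambda>a. a = b \<or> a = c) x = []"
      using free bc(3) adj_sym by (auto simp: filter_empty_conv)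
    then show "filter (\<lambda>a. a = b \<or> a = c) w = filter (\<lambda>a. a = b \<or> a = c) (x @ y)"
      using e by (cases "s = b \<or> s = c") auto
  qed
  then have "s # w \<sim> s # x @ y" by (rule teq_Cons)
  also have "\<dots> \<sim> x @ s # y" using free by (intro teq_move) blast
  finally show ?case using w' by simp
qed

end

section \<open>Fully commutative words of affine type D\<close>

text \<open>The affine diagram of type D is a path with a fork at each end: \<open>Sig 1\<close> and
  \<open>Sigbar 1\<close> hang on \<open>Sig 2\<close>, while \<open>Sig m\<close> and
  \<open>Sigbar m\<close> hang on \<open>Sig (m - 1)\<close>. For \<open>m = 3\<close> both forks
  meet at \<open>Sig 2\<close>, which is why left neighbours are later singled out by name.\<close>

fun adjD :: "nat \<Rightarrow> node \<Rightarrow> node \<Rightarrow> bool" where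
  "adjD m (Sig i) (Sig j) = (i = Suc j \<or> j = Suc i)"
| "adjD m (Sigbar i) (Sig j) = (i = 1 \<and> j = 2 \<or> i = m \<and> Suc j = m)"
| "adjD m (Sig j) (Sigbar i) = (i = 1 \<and> j = 2 \<or> i = m \<and> Suc j = m)"
| "adjD m (Sigbar i) (Sigbar j) = False"

interpretation D: tl_graph "adjD m" for m
proof
  show "adjD m a b \<Longrightarrow> adjD m b a" for a b by (cases a; cases b) auto
  show "\<not> adjD m a a" for a by (cases a) auto
qed

text \<open>The node \<open>Sig 2\<close> is split into the adjacent nodes \<open>Sig 2\<close>, which keeps the left neighbours,
  and \<open>Sig 3\<close>, which receives the right neighbours; \<open>shift\<close> renames the other nodes.\<close>

fun shift :: "node \<Rightarrow> node" where
  "shift (Sig i) = (if i \<le> 2 then Sig i else Sig (Suc i))"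
| "shift (Sigbar i) = (if i = 1 then Sigbar 1 else Sigbar (Suc i))"

text \<open>The list \<open>t\<close> holds one bit for each \<open>Sig 2\<close>, the order in
  which its two halves are written. If \<open>t\<close> runs out, \<open>hd []\<close> is an
  unspecified but fixed bit and \<open>tl [] = []\<close>, so every \<open>t\<close> still yields a
  genuine lift.\<close>

fun lift_word :: "bool list \<Rightarrow> node list \<Rightarrow> node list" where
  "lift_word t [] = []"
| "lift_word t (z # w) =
     (if z = Sig 2 then (if hd t then [Sig 2, Sig 3] else [Sig 3, Sig 2]) @ lift_word (tl t) w
      else shift z # lift_word t w)"

lemma length_lift_word: "length (lift_word t w) = length w + count_list w (Sig 2)"
  by (induction t w rule: lift_word.induct) auto

lemma nodes_cases:
  assumes "z \<in> nodes m"
  obtains i where "z = Sig i" "1 \<le> i" "i \<le> m" | "z = Sigbar 1" | "z = Sigbar m"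
  using assms by (auto simp: nodes_def)

lemma shift_neq:
  assumes "z \<noteq> Sig 2" shows "shift z \<noteq> Sig 2" "shift z \<noteq> Sig 3"
  using assms by (cases z; auto)+

lemma shift_inj_on: "1 \<le> m \<Longrightarrow> inj_on shift (nodes m)"
proof (rule inj_onI)
  fix x y assume "1 \<le> m" and "x \<in> nodes m" "y \<in> nodes m" "shift x = shift y"
  then show "x = y" by (cases x; cases y) (auto simp: nodes_def split: if_splits)
qed

lemma adjD_shift:
  assumes "3 \<le> m" "c \<in> nodes m" "z \<in> nodes m" "c \<noteq> Sig 2" "z \<noteq> Sig 2"
  shows "adjD (Suc m) (shift c) (shift z) = adjD m c z"
  using assms(1,4,5) by (rule_tac nodes_cases[OF assms(2)]; rule_tac nodes_cases[OF assms(3)]) auto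

lemma adjD_shift_split:
  assumes "3 \<le> m" "c \<in> nodes m" "c \<noteq> Sig 2"
  shows "adjD (Suc m) (shift c) (Sig 2) \<longleftrightarrow> c = Sig 1 \<or> c = Sigbar 1"
    and "adjD (Suc m) (shift c) (Sig 3) \<longleftrightarrow> adjD m c (Sig 2) \<and> c \<noteq> Sig 1 \<and> c \<noteq> Sigbar 1"
  using assms(1,3) by (rule_tac nodes_cases[OF assms(2)]; auto)+

text \<open>A neighbour of \<open>Sig 2\<close> becomes adjacent to exactly one of the two halves
  and any other node to neither, so these counters do not see the chosen orders.\<close>

lemma spaced_lift_other:
  assumes "3 \<le> m" "c \<in> nodes m" "c \<noteq> Sig 2" "set w \<subseteq> nodes m"
  shows "D.spaced (Suc m) (shift c) k (lift_word t w) = D.spaced m c k w"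
  using assms(4)
proof (induction w arbitrary: k t)
  case (Cons z w)
  have adj2: "c = Sig 1 \<or> c = Sigbar 1 \<Longrightarrow> adjD m c (Sig 2)" by auto
  show ?case
  proof (cases "z = Sig 2")
    case True
    then show ?thesis
      using Cons assms adj2 adjD_shift_split[OF assms(1-3)] shift_neq[OF assms(3)] by (auto split: if_splits)
  next
    case False
    then have "shift z = shift c \<longleftrightarrow> z = c"
      using Cons.prems assms(1,2) inj_onD[OF shift_inj_on, of m z c] by auto
    then show ?thesis using Cons False adjD_shift[OF assms(1,2) _ assms(3) False] by auto
  qed
qed simp

text \<open>The numbers of left and of right neighbours of \<open>Sig 2\<close> between its consecutive occurrences.\<close>

fun gaps :: "nat \<Rightarrow> nat \<Rightarrow> nat \<Rightarrow> node list \<Rightarrow> (nat \<times> nat) list" where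
  "gaps m s r [] = []"
| "gaps m s r (z # w) =
     (if z = Sig 2 then (s, r) # gaps m 0 0 w
      else if z = Sig 1 \<or> z = Sigbar 1 then gaps m (Suc s) r w
      else if adjD m (Sig 2) z then gaps m s (Suc r) w
      else gaps m s r w)"

text \<open>Here \<open>b\<close> is the order at the previous \<open>Sig 2\<close> and
  \<open>hd t\<close> the order at the next one. Two copies of the half \<open>Sig 2\<close> enclose
  the \<open>s\<close> left letters, the \<open>Sig 3\<close> written after the first copy if
  \<open>b\<close>, and the \<open>Sig 3\<close> written before the second unless
  \<open>hd t\<close>. The half \<open>Sig 3\<close> is treated in the same way with the
  \<open>r\<close> right letters.\<close>

fun valid_types :: "bool \<Rightarrow> bool list \<Rightarrow> (nat \<times> nat) list \<Rightarrow> bool" where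
  "valid_types b t [] = True"
| "valid_types b t ((s, r) # l) =
     (2 \<le> s + of_bool b + of_bool (\<not> hd t) \<and> 2 \<le> r + of_bool (\<not> b) + of_bool (hd t) \<and>
      valid_types (hd t) (tl t) l)"

lemma spaced_lift_split:
  assumes "3 \<le> m" "set w \<subseteq> nodes m" "valid_types b t (gaps m s r w)"
  shows "D.spaced (Suc m) (Sig 2) (s + of_bool b) (lift_word t w) \<and>
         D.spaced (Suc m) (Sig 3) (r + of_bool (\<not> b)) (lift_word t w)"
  using assms(2,3)
proof (induction w arbitrary: b t s r)
  case (Cons z w)
  show ?case
  proof (cases "z = Sig 2")
    case True
    then have v: "2 \<le> s + of_bool b + of_bool (\<not> hd t)" "2 \<le> r + of_bool (\<not> b) + of_bool (hd t)"
      "valid_types (hd t) (tl t) (gaps m 0 0 w)"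
      using Cons.prems by auto
    show ?thesis
      using Cons.IH[OF _ v(3)] Cons.prems(1) v(1,2) True by (cases "hd t") auto
  next
    case False
    have z: "z \<in> nodes m" using Cons.prems by simp
    have a: "adjD (Suc m) (Sig 2) (shift z) \<longleftrightarrow> z = Sig 1 \<or> z = Sigbar 1"
      "adjD (Suc m) (Sig 3) (shift z) \<longleftrightarrow> adjD m (Sig 2) z \<and> z \<noteq> Sig 1 \<and> z \<noteq> Sigbar 1"
      using adjD_shift_split[OF assms(1) z False] D.adj_sym by blast+
    show ?thesis
      using Cons.IH[of b t "Suc s" r] Cons.IH[of b t s "Suc r"] Cons.IH[of b t s r] Cons.prems a False
        shift_neq[OF False] by (auto split: if_splits)
  qed
qed simp

text \<open>A gap without left letters turns the order from True to False, and a gap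
  \<open>(1, 1)\<close> preserves it; two gaps of the former kind joined by gaps
  \<open>(1, 1)\<close> are therefore incompatible. Since \<open>s = 0\<close> implies that
  \<open>r\<close> is at least 2, this can be excluded in terms of \<open>r\<close> alone;
  \<open>f\<close> marks an open pattern.\<close>

fun no_turn :: "bool \<Rightarrow> (nat \<times> nat) list \<Rightarrow> bool" where
  "no_turn f [] = True"
| "no_turn f ((s, r) # l) = (if 2 \<le> r then \<not> f \<and> no_turn True l else no_turn (f \<and> r = 1) l)"

text \<open>The orders are chosen from the end of the list. The clause on \<open>f\<close>
  strengthens the induction: while a pattern is open the order in front of the remaining gaps is
  False, as the gap that opened it may require.\<close>

lemma ex_valid_types:
  assumes "\<forall>(s, r) \<in> set l. 2 \<le> s + r" "successively (\<lambda>p p'. fst p + fst p' \<le> 2) l" "no_turn f l"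
  shows "\<exists>b t. valid_types b t l \<and> (f \<longrightarrow> \<not> b)"
  using assms
proof (induction l arbitrary: f)
  case (Cons p l)
  obtain s r where p: "p = (s, r)" by fastforce
  define f' where "f' = (if 2 \<le> r then True else f \<and> r = 1)"
  have "no_turn f' l" "2 \<le> r \<longrightarrow> \<not> f" using Cons.prems(3) p by (auto simp: f'_def split: if_splits)
  moreover have "successively (\<lambda>p p'. fst p + fst p' \<le> 2) l"
    using Cons.prems(2) by (cases l) auto
  ultimately obtain b t where bt: "valid_types b t l" "f' \<longrightarrow> \<not> b"
    using Cons.IH[of f'] Cons.prems(1) by auto
  have sr: "2 \<le> s + r" using Cons.prems(1) p by auto
  have mk: "2 \<le> s + of_bool c + of_bool (\<not> b) \<Longrightarrow> 2 \<le> r + of_bool (\<not> c) + of_bool b \<Longrightarrow> (f \<longrightarrow> \<not> c) \<Longrightarrow> ?case" for c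
    using bt(1) p by (intro exI[of _ c] exI[of _ "b # t"]) auto
  show ?case
  proof (cases "s \<ge> 2")
    case True
    show ?thesis
    proof (cases "r = 0")
      case r0: True
      have "valid_types True t' l \<longrightarrow> ?thesis" for t'
        using True r0 p by (intro impI exI[of _ False] exI[of _ "True # t'"]) auto
      \<comment> \<open>Two consecutive left counts add up to at most 2, so a following gap has no
        left letters and itself demands the order True in front of it.\<close>
      moreover have "\<exists>t'. valid_types True t' l"
      proof (cases l)
        case (Cons p' l')
        obtain s' r' where p': "p' = (s', r')" by fastforce
        then have "s' = 0" using Cons.prems(2) p True \<open>l = p' # l'\<close> by simp
        then have "b" using bt(1) Cons p' by (cases b; cases "hd t") auto
        then show ?thesis using bt by auto
      qed simp
      ultimately show ?thesis by blast
    next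
      case False
      show ?thesis
        using True False bt(2) by (intro mk[of False]) (auto simp: f'_def of_bool_def split: if_splits)
    qed
  next
    case False
    then consider "s = 0" "r \<ge> 2" | "s = 1" "r \<ge> 2" | "s = 1" "r = 1" using sr by linarith
    then show ?thesis
    proof cases
      case 1
      then show ?thesis using bt(2) \<open>2 \<le> r \<longrightarrow> \<not> f\<close> by (intro mk[of True]) (auto simp: f'_def)
    next
      case 2
      then show ?thesis using bt(2) by (intro mk[of False]) (auto simp: f'_def)
    next
      case 3
      then show ?thesis using bt(2) by (intro mk[of b]) (auto simp: f'_def)
    qed
  qed
qed auto

lemma gaps_sum:
  assumes "set w \<subseteq> nodes m" "D.spaced m (Sig 2) (s + r) w"
  shows "\<forall>(s, r) \<in> set (gaps m s r w). 2 \<le> s + r"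
  using assms
proof (induction w arbitrary: s r)
  case (Cons z w)
  show ?case
    using Cons.IH[of 0 0] Cons.IH[of "Suc s" r] Cons.IH[of s "Suc r"] Cons.IH[of s r] Cons.prems
    by (auto split: if_splits)
qed simp

text \<open>\<open>Sig 2\<close> is the only neighbour of \<open>Sig 1\<close> and of
  \<open>Sigbar 1\<close>, so each of them returns only after two \<open>Sig 2\<close> and occurs at
  most once in two consecutive gaps. \<open>x\<close> and \<open>y\<close> count
  \<open>Sig 1\<close> in the previous and the current gap, \<open>x'\<close> and \<open>y'\<close>
  count \<open>Sigbar 1\<close>; \<open>k\<close> and \<open>k'\<close> are the running counters of
  \<open>spaced\<close>.\<close>

lemma gaps_left:
  assumes "3 \<le> m" "set w \<subseteq> nodes m" "D.spaced m (Sig 1) k w" "D.spaced m (Sigbar 1) k' w"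
    and "x + y \<le> 1" "1 \<le> y \<longrightarrow> k = 0" "1 \<le> x \<longrightarrow> k \<le> 1"
    and "x' + y' \<le> 1" "1 \<le> y' \<longrightarrow> k' = 0" "1 \<le> x' \<longrightarrow> k' \<le> 1"
  shows "successively (\<lambda>p p'. fst p + fst p' \<le> 2) ((x + x', r') # gaps m (y + y') r w)"
  using assms(2-)
proof (induction w arbitrary: k k' x y x' y' r r')
  case (Cons z w)
  have z: "z \<in> nodes m" and w: "set w \<subseteq> nodes m" using Cons.prems by auto
  have a: "adjD m (Sig 1) z \<longleftrightarrow> z = Sig 2" "adjD m (Sigbar 1) z \<longleftrightarrow> z = Sig 2"
    using assms(1) by (rule_tac nodes_cases[OF z]; auto)+
  consider "z = Sig 2" | "z = Sig 1" | "z = Sigbar 1" | "z \<noteq> Sig 2" "z \<noteq> Sig 1" "z \<noteq> Sigbar 1" by blast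
  then show ?case
  proof cases
    case 1
    have "successively (\<lambda>p p'. fst p + fst p' \<le> 2) ((y + y', r) # gaps m (0 + 0) 0 w)"
      using Cons.prems a 1 w by (intro Cons.IH[of "Suc k" "Suc k'"]) auto
    then show ?thesis using 1 Cons.prems by auto
  next
    case 2
    have "x = 0" "y = 0" using Cons.prems 2 by auto
    moreover have "successively (\<lambda>p p'. fst p + fst p' \<le> 2) ((0 + x', r') # gaps m (1 + y') r w)"
      using Cons.prems a 2 w by (intro Cons.IH[of 0 k']) auto
    ultimately show ?thesis using 2 by simp
  next
    case 3
    have "x' = 0" "y' = 0" using Cons.prems 3 by auto
    moreover have "successively (\<lambda>p p'. fst p + fst p' \<le> 2) ((x + 0, r') # gaps m (y + 1) r w)"
      using Cons.prems a 3 w by (intro Cons.IH[of k 0]) auto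
    ultimately show ?thesis using 3 by simp
  next
    case 4
    have "successively (\<lambda>p p'. fst p + fst p' \<le> 2) ((x + x', r') # gaps m (y + y') r0 w)" for r0
      using Cons.prems a 4 w by (intro Cons.IH[of k k']) auto
    then show ?thesis using 4 by simp
  qed
qed auto

text \<open>\<open>turn_free R c f r w\<close> forbids a gap between occurrences of \<open>c\<close> with at least two letters from
  \<open>R\<close>, followed by gaps with at least one, and then by another one with at least two; \<open>f\<close> records
  that such a pattern has been started. Such a pattern at \<open>Sig i\<close> forces one at \<open>Sig (Suc i)\<close>, and
  it is impossible at the last node before the right fork.\<close>

fun turn_free :: "(node \<Rightarrow> bool) \<Rightarrow> node \<Rightarrow> bool \<Rightarrow> nat \<Rightarrow> node list \<Rightarrow> bool" where
  "turn_free R c f r [] = True"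
| "turn_free R c f r (z # w) =
     (if z = c then (if 2 \<le> r then \<not> f \<and> turn_free R c True 0 w else turn_free R c (f \<and> r = 1) 0 w)
      else if R z then turn_free R c f (Suc r) w else turn_free R c f r w)"

definition right_nbr :: "nat \<Rightarrow> nat \<Rightarrow> node \<Rightarrow> bool" where
  "right_nbr m i z \<longleftrightarrow> z = Sig (Suc i) \<or> Suc i = m \<and> z = Sigbar m"

text \<open>Each of the end nodes \<open>Sig m\<close> and \<open>Sigbar m\<close> returns only
  after two \<open>Sig (m - 1)\<close>. A gap with two right letters thus contains each of them
  once, and the next gap contains neither, which breaks the pattern at once.\<close>

lemma turn_free_last:
  assumes "3 \<le> m" "set w \<subseteq> nodes m" "D.spaced m (Sig m) k w" "D.spaced m (Sigbar m) k' w"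
    and "x \<le> 1" "1 \<le> x \<longrightarrow> k = 0" "x' \<le> 1" "1 \<le> x' \<longrightarrow> k' = 0"
    and "f \<longrightarrow> x = 0 \<and> x' = 0 \<and> k \<le> 1 \<and> k' \<le> 1"
  shows "turn_free (right_nbr m (m - 1)) (Sig (m - 1)) f (x + x') w"
  using assms(2-)
proof (induction w arbitrary: k k' x x' f)
  case (Cons z w)
  have z: "z \<in> nodes m" and w: "set w \<subseteq> nodes m" using Cons.prems by auto
  have a: "adjD m (Sig m) z \<longleftrightarrow> z = Sig (m - 1)" "adjD m (Sigbar m) z \<longleftrightarrow> z = Sig (m - 1)"
    using assms(1) by (rule_tac nodes_cases[OF z]; auto)+
  have R: "right_nbr m (m - 1) z \<longleftrightarrow> z = Sig m \<or> z = Sigbar m"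
    using assms(1) by (auto simp: right_nbr_def)
  consider "z = Sig (m - 1)" | "z = Sig m" | "z = Sigbar m" | "z \<noteq> Sig (m - 1)" "z \<noteq> Sig m" "z \<noteq> Sigbar m" by blast
  then show ?case
  proof cases
    case 1
    have "turn_free (right_nbr m (m - 1)) (Sig (m - 1)) f' (0 + 0) w" if "f' \<longrightarrow> k = 0 \<and> k' = 0" for f'
      using Cons.prems a 1 w that assms(1) by (intro Cons.IH[of "Suc k" "Suc k'"]) (auto split: if_splits)
    then show ?thesis using 1 Cons.prems by auto
  next
    case 2
    have "turn_free (right_nbr m (m - 1)) (Sig (m - 1)) f (1 + x') w"
      using Cons.prems a 2 w assms(1) by (intro Cons.IH[of 0 k']) (auto split: if_splits)
    moreover have "x = 0" using Cons.prems 2 by auto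
    ultimately show ?thesis using 2 R assms(1) by auto
  next
    case 3
    have "turn_free (right_nbr m (m - 1)) (Sig (m - 1)) f (x + 1) w"
      using Cons.prems a 3 w assms(1) by (intro Cons.IH[of k 0]) (auto split: if_splits)
    moreover have "x' = 0" using Cons.prems 3 by auto
    ultimately show ?thesis using 3 R assms(1) by auto
  next
    case 4
    have "turn_free (right_nbr m (m - 1)) (Sig (m - 1)) f (x + x') w"
      using Cons.prems a 4 w assms(1) by (intro Cons.IH[of k k']) (auto split: if_splits)
    then show ?thesis using 4 R by simp
  qed
qed simp

text \<open>Two \<open>Sig (Suc i)\<close> in one gap of \<open>Sig i\<close> are separated by right
  letters only, hence by at least two. If successive gaps of \<open>Sig i\<close> hold one
  \<open>Sig (Suc i)\<close> each, then these enclose one \<open>Sig i\<close> and so at least one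
  right letter. The pattern is thereby copied to the next node. After the first
  \<open>Sig (Suc i)\<close>, \<open>k\<close> exceeds \<open>r'\<close> by the number of
  \<open>Sig i\<close> read since the last one.\<close>

lemma turn_free_step:
  assumes "2 \<le> i" "Suc i < m" "set w \<subseteq> nodes m"
    and "D.spaced m (Sig (Suc i)) k w" "turn_free (right_nbr m (Suc i)) (Sig (Suc i)) f' r' w"
    and "1 \<le> r \<longrightarrow> k \<le> r'" "f \<longrightarrow> k \<le> Suc r'" "f \<or> 2 \<le> r \<longrightarrow> f'" "\<not> (f \<and> 2 \<le> r)"
  shows "turn_free (right_nbr m i) (Sig i) f r w"
  using assms(3-)
proof (induction w arbitrary: k f r f' r')
  case (Cons z w)
  have z: "z \<in> nodes m" and w: "set w \<subseteq> nodes m" using Cons.prems by auto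
  have R: "right_nbr m i z \<longleftrightarrow> z = Sig (Suc i)" using assms(2) by (auto simp: right_nbr_def)
  have a: "adjD m (Sig (Suc i)) z \<longleftrightarrow> z = Sig i \<or> right_nbr m (Suc i) z"
    using assms(1,2) by (rule_tac nodes_cases[OF z]; auto simp: right_nbr_def)
  consider "z = Sig i" | "z = Sig (Suc i)" | "right_nbr m (Suc i) z" "z \<noteq> Sig i" "z \<noteq> Sig (Suc i)"
    | "z \<noteq> Sig i" "z \<noteq> Sig (Suc i)" "\<not> right_nbr m (Suc i) z" by blast
  then show ?case
  proof cases
    case 1
    have nR: "\<not> right_nbr m (Suc i) z" using 1 by (auto simp: right_nbr_def)
    have "turn_free (right_nbr m i) (Sig i) g 0 w" if "g \<longrightarrow> (1 \<le> r \<and> f')" for g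
      using Cons.prems a 1 w that nR by (intro Cons.IH[of "Suc k" f' r']) auto
    then show ?thesis using 1 Cons.prems by auto
  next
    case 2
    have k: "2 \<le> k" "D.spaced m (Sig (Suc i)) 0 w" using Cons.prems 2 by auto
    define g where "g = (if 2 \<le> r' then True else f' \<and> r' = 1)"
    have g: "turn_free (right_nbr m (Suc i)) (Sig (Suc i)) g 0 w" "2 \<le> r' \<longrightarrow> \<not> f'"
      using Cons.prems 2 by (auto simp: g_def split: if_splits)
    have "turn_free (right_nbr m i) (Sig i) f (Suc r) w"
      using Cons.prems k g w by (intro Cons.IH[OF w k(2) g(1)]) (auto simp: g_def)
    then show ?thesis using 2 R by simp
  next
    case 3
    have "turn_free (right_nbr m i) (Sig i) f r w"
      using Cons.prems a 3 w by (intro Cons.IH[of "Suc k" f' "Suc r'"]) auto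
    then show ?thesis using 3 R by simp
  next
    case 4
    have "turn_free (right_nbr m i) (Sig i) f r w"
      using Cons.prems a 4 w by (intro Cons.IH[of k f' r']) auto
    then show ?thesis using 4 R by simp
  qed
qed simp

lemma turn_free_all:
  assumes "3 \<le> m" "set w \<subseteq> nodes m" "\<And>c. \<exists>k. D.spaced m c k w" "2 \<le> i" "i \<le> m - 1"
  shows "turn_free (right_nbr m i) (Sig i) False 0 w"
  using assms(5,4)
proof (induction i rule: inc_induct)
  case base
  obtain k k' where "D.spaced m (Sig m) k w" "D.spaced m (Sigbar m) k' w" using assms(3) by blast
  then show ?case using turn_free_last[of m w k k' 0 0 False] assms by simp
next
  case (step i)
  obtain k where "D.spaced m (Sig (Suc i)) k w" using assms(3) by blast
  then show ?case using turn_free_step[of i m w k False 0 0 False] step assms by simp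
qed

lemma no_turn_gaps:
  "3 \<le> m \<Longrightarrow> set w \<subseteq> nodes m \<Longrightarrow> turn_free (right_nbr m 2) (Sig 2) f r w \<Longrightarrow> no_turn f (gaps m s r w)"
proof (induction w arbitrary: f s r)
  case (Cons z w)
  have z: "z \<in> nodes m" and w: "set w \<subseteq> nodes m" using Cons.prems by auto
  have "right_nbr m 2 z \<longleftrightarrow> adjD m (Sig 2) z \<and> z \<noteq> Sig 1 \<and> z \<noteq> Sigbar 1"
    using Cons.prems(1) by (rule_tac nodes_cases[OF z]; auto simp: right_nbr_def)
  then show ?case using Cons w by (auto split: if_splits)
qed simp

section \<open>Every reduced word has a reduced lift\<close>

lemma spaced_lift_prefix:
  assumes "Sig 2 \<notin> set y" "c = Sig 2 \<or> c = Sig 3" "2 \<le> k"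
    "D.spaced m c (of_bool ((c = Sig 2) = hd t)) (lift_word (tl t) w)"
  shows "D.spaced m c k (lift_word t (y @ Sig 2 # w))"
  using assms(1,3)
proof (induction y arbitrary: k)
  case Nil
  then show ?case using assms(2,4) by (cases "hd t") (auto split: if_splits)
next
  case (Cons z y)
  then show ?case using assms(2) shift_neq[of z] by auto
qed

lemma spaced_lift_no_split:
  assumes "Sig 2 \<notin> set w" "c = Sig 2 \<or> c = Sig 3"
  shows "D.spaced m c k (lift_word t w)"
proof (rule D.spaced_not_in)
  show "c \<notin> set (lift_word t w)" using assms
  proof (induction w)
    case (Cons z w)
    then show ?case using shift_neq[of z] by auto
  qed simp
qed

lemma set_lift_word: "set w \<subseteq> A \<Longrightarrow> set (lift_word t w) \<subseteq> shift ` A \<union> {Sig 2, Sig 3}"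
  by (induction t w rule: lift_word.induct) auto

text \<open>Only the counters of the two halves depend on the orders. The part before the first
  \<open>Sig 2\<close> imposes nothing on them, so the gaps are read from what follows it.\<close>

theorem ex_FC_lift:
  assumes m: "3 \<le> m" and w: "set w \<subseteq> nodes m" and FC: "D.FC m w"
  shows "\<exists>t. D.FC (Suc m) (lift_word t w)"
proof -
  have sp: "D.spaced m c 2 w" for c using FC D.FC_iff by blast
  have "\<exists>t. D.spaced (Suc m) (Sig 2) 2 (lift_word t w) \<and> D.spaced (Suc m) (Sig 3) 2 (lift_word t w)"
  proof (cases "Sig 2 \<in> set w")
    case True
    then obtain y v where v: "w = y @ Sig 2 # v" "Sig 2 \<notin> set y"
      using split_list_first by fast
    have vn: "set v \<subseteq> nodes m" using w v by auto
    have spv: "\<exists>k. D.spaced m c k v" for c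
      using D.spaced_appendD[of m c 2 "y @ [Sig 2]" v] sp v by simp
    have sp2: "D.spaced m (Sig 2) (0 + 0) v"
      using D.spaced_append_free[OF v(2), of m 2 "Sig 2 # v"] sp[of "Sig 2"] v by simp
    obtain k k' where k: "D.spaced m (Sig 1) k v" "D.spaced m (Sigbar 1) k' v" using spv by blast
    \<comment> \<open>A fictitious empty gap provides the previous gap required by the invariant and
      is dropped afterwards.\<close>
    have "successively (\<lambda>p p'. fst p + fst p' \<le> 2) ((0 + 0, 0) # gaps m (0 + 0) 0 v)"
      by (rule gaps_left[OF m vn k]) auto
    then have "successively (\<lambda>p p'. fst p + fst p' \<le> 2) (gaps m 0 0 v)"
      by (cases "gaps m 0 0 v") auto
    moreover have "no_turn False (gaps m 0 0 v)"
      using m by (intro no_turn_gaps vn turn_free_all spv) auto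
    ultimately obtain b t where "valid_types b t (gaps m 0 0 v)"
      using ex_valid_types gaps_sum[OF vn sp2] by blast
    from spaced_lift_split[OF m vn this] show ?thesis
      using v by (intro exI[of _ "b # t"]) (auto intro!: spaced_lift_prefix)
  qed (use spaced_lift_no_split in auto)
  then obtain t where t: "D.spaced (Suc m) (Sig 2) 2 (lift_word t w)" "D.spaced (Suc m) (Sig 3) 2 (lift_word t w)"
    by blast
  have "D.spaced (Suc m) c 2 (lift_word t w)" for c
  proof (cases "c \<in> shift ` (nodes m - {Sig 2})")
    case True
    then show ?thesis using spaced_lift_other[OF m _ _ w] sp by auto
  next
    case False
    show ?thesis
    proof (cases "c = Sig 2 \<or> c = Sig 3")
      case False
      then have "c \<notin> shift ` nodes m"
        using \<open>c \<notin> shift ` (nodes m - {Sig 2})\<close> by auto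
      then show ?thesis using set_lift_word[OF w, of t] False by (intro D.spaced_not_in) blast
    qed (use t in auto)
  qed
  then show ?thesis using D.FC_iff by blast
qed

section \<open>Recovering a word from its lifts\<close>

lemma filter_lift_word:
  assumes m: "1 \<le> m" and "set w \<subseteq> nodes m" "s \<in> nodes m" "t \<in> nodes m"
    and e: "e = shift \<or> e = shift(Sig 2 := Sig 3)"
  shows "filter (\<lambda>a. a = e s \<or> a = e t) (lift_word b w) = map e (filter (\<lambda>a. a = s \<or> a = t) w)"
  using assms(2)
proof (induction w arbitrary: b)
  case (Cons z w)
  have inj: "e z = e x \<longleftrightarrow> z = x" if "x \<in> nodes m" for x
    using that Cons.prems e inj_onD[OF shift_inj_on[OF m], of z x] shift_neq[of z] shift_neq[of x]
    by (auto split: if_splits)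
  have ne: "e x \<noteq> Sig 3" if "e = shift" for x
    using that shift_neq[of x] by (cases "x = Sig 2") auto
  have ne2: "e x \<noteq> Sig 2" if "e = shift(Sig 2 := Sig 3)" for x
    using that shift_neq[of x] by auto
  define p where "p = (\<lambda>a. a = e s \<or> a = e t)"
  have pz: "p (e z) \<longleftrightarrow> z = s \<or> z = t"
    unfolding p_def inj[OF assms(3)] inj[OF assms(4)] ..
  show ?case
  proof (cases "z = Sig 2")
    case True
    have IH: "filter p (lift_word (tl b) w) = map e (filter (\<lambda>a. a = s \<or> a = t) w)"
      using Cons unfolding p_def by simp
    from e show ?thesis
    proof
      assume "e = shift"
      then have "p (Sig 2) \<longleftrightarrow> z = s \<or> z = t" "\<not> p (Sig 3)" "e z = Sig 2"
        using pz ne[of s] ne[of t] True by (auto simp: p_def)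
      then show ?thesis
        using IH True unfolding p_def[symmetric] by (cases "Sig 2 = s \<or> Sig 2 = t") auto
    next
      assume "e = shift(Sig 2 := Sig 3)"
      then have "p (Sig 3) \<longleftrightarrow> z = s \<or> z = t" "\<not> p (Sig 2)" "e z = Sig 3"
        using pz ne2[of s] ne2[of t] True by (auto simp: p_def)
      then show ?thesis
        using IH True unfolding p_def[symmetric] by (cases "Sig 2 = s \<or> Sig 2 = t") auto
    qed
  next
    case False
    have IH: "filter p (lift_word b w) = map e (filter (\<lambda>a. a = s \<or> a = t) w)"
      using Cons unfolding p_def by simp
    have "e z = shift z" using e False by auto
    then show ?thesis using IH pz False unfolding p_def[symmetric] by simp
  qed
qed simp

text \<open>The projection criterion is applied to each dependent pair. \<open>e\<close> represents
  \<open>Sig 2\<close> by the half adjacent to the other letter of the pair; the projection of a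
  lift to \<open>e s\<close> and \<open>e t\<close> is then constant on its class and is a renaming
  of the projection of the word, whatever the orders.\<close>

lemma lift_word_teq:
  assumes m: "3 \<le> m" and w: "set w \<subseteq> nodes m" and w': "set w' \<subseteq> nodes m"
    and eq: "D.teq (Suc m) (lift_word b w) (lift_word b' w')"
  shows "D.teq m w w'"
proof (rule D.teq_filterI[OF w w'])
  fix s t assume st: "s \<in> nodes m" "t \<in> nodes m" "s = t \<or> adjD m s t"
  define right where "right = (\<lambda>z. adjD m (Sig 2) z \<and> z \<noteq> Sig 1 \<and> z \<noteq> Sigbar 1)"
  define e where "e = (if s = Sig 2 \<and> right t \<or> t = Sig 2 \<and> right s then shift(Sig 2 := Sig 3) else shift)"
  have e: "e = shift \<or> e = shift(Sig 2 := Sig 3)" by (simp add: e_def)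
  have adj: "e s = e t \<or> adjD (Suc m) (e s) (e t)"
  proof (cases "s = t")
    case False
    then have a: "adjD m s t" "adjD m t s" using st D.adj_sym by blast+
    consider "s \<noteq> Sig 2" "t \<noteq> Sig 2" | "s = Sig 2" "t \<noteq> Sig 2" | "s \<noteq> Sig 2" "t = Sig 2"
      using False by blast
    then show ?thesis
    proof cases
      case 1
      then show ?thesis using adjD_shift[OF m st(1,2)] a by (auto simp: e_def)
    next
      case 2
      then show ?thesis
        using adjD_shift_split[OF m st(2)] a D.adj_sym[of "Suc m" "shift t"] by (auto simp: e_def right_def)
    next
      case 3
      then show ?thesis
        using adjD_shift_split[OF m st(1)] a by (auto simp: e_def right_def)
    qed
  qed simp
  have "filter (\<lambda>a. a = e s \<or> a = e t) (lift_word b w) = filter (\<lambda>a. a = e s \<or> a = e t) (lift_word b' w')"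
    using adj D.adj_sym[of "Suc m" "e s" "e t"] by (intro D.teq_filter[OF eq]) auto
  then have "map e (filter (\<lambda>a. a = s \<or> a = t) w) = map e (filter (\<lambda>a. a = s \<or> a = t) w')"
    using filter_lift_word[OF _ w st(1,2) e] filter_lift_word[OF _ w' st(1,2) e] m by simp
  moreover have "inj_on e (nodes m)"
  proof (rule inj_onI)
    fix x y assume "x \<in> nodes m" "y \<in> nodes m" "e x = e y"
    then show "x = y"
      using e m inj_onD[OF shift_inj_on[of m], of x y] shift_neq[of x] shift_neq[of y] by (auto split: if_splits)
  qed
  ultimately show "filter (\<lambda>a. a = s \<or> a = t) w = filter (\<lambda>a. a = s \<or> a = t) w'"
    using w w' by (elim map_inj_on) (auto intro: inj_on_subset)
qed

text \<open>\<open>Sig 2\<close> and \<open>Sig 3\<close> do not commute, so their projection is an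
  invariant of the class, and it spells out all the orders. The lists \<open>b\<close> and
  \<open>b'\<close> may still differ in surplus bits.\<close>

lemma lift_word_types:
  assumes "D.teq (Suc m) (lift_word b w) (lift_word b' w)"
  shows "lift_word b w = lift_word b' w"
proof -
  have "filter (\<lambda>a. a = Sig 2 \<or> a = Sig 3) (lift_word b w) = filter (\<lambda>a. a = Sig 2 \<or> a = Sig 3) (lift_word b' w)"
    by (intro D.teq_filter[OF assms]) auto
  then show ?thesis
  proof (induction w arbitrary: b b')
    case (Cons z w)
    then show ?case using shift_neq[of z] by (auto split: if_splits)
  qed simp
qed

section \<open>Free algebras and their quotients\<close>

definition mon :: "'g list \<Rightarrow> ('g, 'k::{comm_ring, monoid_mult}) falg" where
  "mon w = Poly_Mapping.single (Word w) 1"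

lemma fconst_mult_single: "fconst c * Poly_Mapping.single w d = Poly_Mapping.single w (c * d)"
  by (simp add: fconst_def mult_single)

lemma single_mult_fconst: "Poly_Mapping.single w d * fconst c = Poly_Mapping.single w (c * d)"
  by (simp add: fconst_def mult_single mult.commute)

lemma single_eq_fconst_mon: "Poly_Mapping.single w c = fconst c * mon (letters w)"
  by (cases w) (simp add: mon_def fconst_mult_single)

lemma mon_append: "mon u * mon v = mon (u @ v)"
  by (simp add: mon_def mult_single plus_word_def)

lemma mon_Nil: "mon [] = fconst 1"
  by (simp add: mon_def fconst_def zero_word_def)

lemma mon_single: "mon [g] = fgen g"
  by (simp add: mon_def fgen_def)

lemma mon_Cons: "mon (g # w) = (fgen g * mon w :: ('g, 'k::{comm_ring, monoid_mult}) falg)"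
  by (rule mon_append[of "[g]" w, unfolded mon_single append.simps, symmetric])

lemma falg_induct [case_names single add]:
  fixes f :: "('g, 'k::{comm_ring, monoid_mult}) falg"
  assumes "\<forall>w \<in> Poly_Mapping.keys f. set (letters w) \<subseteq> S"
    and "\<And>c w. set w \<subseteq> S \<Longrightarrow> Q (fconst c * mon w)"
    and "\<And>f g. Q f \<Longrightarrow> Q g \<Longrightarrow> Q (f + g)"
  shows "Q f"
  using assms(1)
proof (induction f rule: update_induct)
  case const
  show ?case using assms(2)[of "[]" 0] by (simp add: fconst_def)
next
  case (update f a b)
  have e: "Poly_Mapping.update a b f = Poly_Mapping.single a b + f"
    using update.hyps(1)
    by (intro poly_mapping_eqI) (auto simp: lookup_update lookup_add lookup_single when_def in_keys_iff)
  have "Poly_Mapping.keys (Poly_Mapping.update a b f) = insert a (Poly_Mapping.keys f)"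
    using update.hyps(2) by (auto simp: in_keys_iff lookup_update split: if_splits)
  then show ?case using update assms(2)[of "letters a" b] assms(3) by (simp add: e single_eq_fconst_mon)
qed

lemma falg_induct_UNIV [case_names single add]:
  fixes f :: "('g, 'k::{comm_ring, monoid_mult}) falg"
  assumes "\<And>c w. Q (fconst c * mon w)" and "\<And>f g. Q f \<Longrightarrow> Q g \<Longrightarrow> Q (f + g)"
  shows "Q f"
  by (rule falg_induct[where S = UNIV]) (use assms in auto)

lemma fconst_one_mult [simp]: "fconst 1 * f = f" "f * fconst 1 = f"
  by (induction f rule: falg_induct_UNIV)
    (simp_all add: mon_def fconst_mult_single single_mult_fconst distrib_left distrib_right)

lemma fconst_add: "fconst (a + b) = fconst a + fconst b"
  by (simp add: fconst_def single_add)

lemma fconst_mult: "fconst (a * b) = fconst a * fconst b"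
  by (simp add: fconst_def mult_single)

lemma fconst_0 [simp]: "fconst 0 = 0"
  by (simp add: fconst_def)

lemma fconst_uminus: "fconst (- a) = - fconst a"
  using fconst_add[of a "- a"] by (simp add: eq_neg_iff_add_eq_0 add.commute)

lemma fconst_diff: "fconst (a - b) = fconst a - fconst b"
  using fconst_add[of a "- b"] by (simp add: fconst_uminus)

lemma fconst_commute: "f * fconst c = fconst c * f"
  by (induction f rule: falg_induct_UNIV)
    (simp_all add: mon_def fconst_mult_single single_mult_fconst distrib_left distrib_right mult.commute)

lemma fconst_left_commute: "f * (fconst c * g) = fconst c * (f * g)"
  by (metis fconst_commute mult.assoc)

lemma carrier_free_algebra:
  "carrier (free_algebra S) = {f. \<forall>w \<in> Poly_Mapping.keys f. set (letters w) \<subseteq> S}"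
  by (simp add: free_algebra_def)

lemma free_algebra_simps [simp]:
  "x \<otimes>\<^bsub>free_algebra S\<^esub> y = x * y" "x \<oplus>\<^bsub>free_algebra S\<^esub> y = x + y"
  "\<one>\<^bsub>free_algebra S\<^esub> = fconst 1" "\<zero>\<^bsub>free_algebra S\<^esub> = 0"
  by (simp_all add: free_algebra_def)

lemma free_algebra_closed:
  "0 \<in> carrier (free_algebra S)" "fconst c \<in> carrier (free_algebra S)"
  "set w \<subseteq> S \<Longrightarrow> mon w \<in> carrier (free_algebra S)"
  "g \<in> S \<Longrightarrow> fgen g \<in> carrier (free_algebra S)"
  "x \<in> carrier (free_algebra S) \<Longrightarrow> y \<in> carrier (free_algebra S) \<Longrightarrow> x + y \<in> carrier (free_algebra S)"
  "x \<in> carrier (free_algebra S) \<Longrightarrow> y \<in> carrier (free_algebra S) \<Longrightarrow> x - y \<in> carrier (free_algebra S)"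
  "x \<in> carrier (free_algebra S) \<Longrightarrow> - x \<in> carrier (free_algebra S)"
  "x \<in> carrier (free_algebra S) \<Longrightarrow> y \<in> carrier (free_algebra S) \<Longrightarrow> x * y \<in> carrier (free_algebra S)"
proof -
  show "x \<in> carrier (free_algebra S) \<Longrightarrow> y \<in> carrier (free_algebra S) \<Longrightarrow> x + y \<in> carrier (free_algebra S)"
    using keys_add[of x y] by (auto simp: carrier_free_algebra)
  show "x \<in> carrier (free_algebra S) \<Longrightarrow> y \<in> carrier (free_algebra S) \<Longrightarrow> x - y \<in> carrier (free_algebra S)"
    using keys_diff[of x y] by (auto simp: carrier_free_algebra)
  show "x \<in> carrier (free_algebra S) \<Longrightarrow> - x \<in> carrier (free_algebra S)"
    by (auto simp: carrier_free_algebra in_keys_iff)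
  show "x \<in> carrier (free_algebra S) \<Longrightarrow> y \<in> carrier (free_algebra S) \<Longrightarrow> x * y \<in> carrier (free_algebra S)"
    using keys_mult[of x y] by (fastforce simp: carrier_free_algebra plus_word_def)
qed (auto simp: carrier_free_algebra fconst_def mon_def fgen_def zero_word_def)

lemma ring_free_algebra: "ring (free_algebra S :: ('g, 'k::{comm_ring, monoid_mult}) falg ring)"
proof (rule ringI)
  show "abelian_group (free_algebra S :: ('g, 'k) falg ring)"
  proof (rule abelian_groupI)
    fix x :: "('g, 'k) falg" assume "x \<in> carrier (free_algebra S)"
    then show "\<exists>y\<in>carrier (free_algebra S). y \<oplus>\<^bsub>free_algebra S\<^esub> x = \<zero>\<^bsub>free_algebra S\<^esub>"
      by (intro bexI[of _ "- x"]) (auto simp: free_algebra_closed)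
  qed (auto simp: free_algebra_closed add.assoc add.commute)
  show "Group.monoid (free_algebra S :: ('g, 'k) falg ring)"
    by (rule monoidI) (auto simp: free_algebra_closed mult.assoc)
qed (auto simp: distrib_left distrib_right)

lemma falg_hom_eq:
  fixes f :: "('g, 'k::{comm_ring, monoid_mult}) falg"
  assumes h: "h \<in> ring_hom (free_algebra S) A" and h': "h' \<in> ring_hom (free_algebra S) A"
    and g: "\<And>g. g \<in> S \<Longrightarrow> h (fgen g) = h' (fgen g)" and c: "\<And>c. h (fconst c) = h' (fconst c)"
    and f: "f \<in> carrier (free_algebra S)"
  shows "h f = h' f"
proof -
  have m: "set w \<subseteq> S \<Longrightarrow> h (mon w) = h' (mon w)" for w
  proof (induction w)
    case Nil
    then show ?case using c[of 1] by (simp add: mon_Nil)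
  next
    case (Cons a w)
    then show ?case
      using ring_hom_mult[OF h, of "fgen a" "mon w"] ring_hom_mult[OF h', of "fgen a" "mon w"] g[of a]
      by (simp add: mon_Cons free_algebra_closed)
  qed
  have "f \<in> carrier (free_algebra S) \<and> h f = h' f"
  proof (rule falg_induct[where S = S])
    show "\<forall>w\<in>Poly_Mapping.keys f. set (letters w) \<subseteq> S" using f by (simp add: carrier_free_algebra)
    fix k w assume w: "set w \<subseteq> S"
    then show "fconst k * mon w \<in> carrier (free_algebra S) \<and> h (fconst k * mon w) = h' (fconst k * mon w)"
      using ring_hom_mult[OF h, of "fconst k" "mon w"] ring_hom_mult[OF h', of "fconst k" "mon w"] c m
      by (simp add: free_algebra_closed)
  next
    fix f g assume "f \<in> carrier (free_algebra S) \<and> h f = h' f" "g \<in> carrier (free_algebra S) \<and> h g = h' g"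
    then show "f + g \<in> carrier (free_algebra S) \<and> h (f + g) = h' (f + g)"
      using ring_hom_add[OF h, of f g] ring_hom_add[OF h', of f g] by (simp add: free_algebra_closed)
  qed
  then show ?thesis by blast
qed

section \<open>Evaluation of the free algebra with central constants\<close>

locale falg_target = ring A for A (structure) +
  fixes \<iota> :: "'k::{comm_ring, monoid_mult} \<Rightarrow> 'a" and \<phi> :: "'g \<Rightarrow> 'a" and S :: "'g set"
  assumes const_closed: "\<iota> c \<in> carrier A"
    and const_add: "\<iota> (c + d) = \<iota> c \<oplus> \<iota> d"
    and const_mult: "\<iota> (c * d) = \<iota> c \<otimes> \<iota> d"
    and const_one: "\<iota> 1 = \<one>"
    and const_commute: "x \<in> carrier A \<Longrightarrow> \<iota> c \<otimes> x = x \<otimes> \<iota> c"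
    and gen_closed: "g \<in> S \<Longrightarrow> \<phi> g \<in> carrier A"
begin

abbreviation eval_word :: "'g list \<Rightarrow> 'a" where
  "eval_word w \<equiv> foldr (\<lambda>g x. \<phi> g \<otimes> x) w \<one>"

lemma const_zero: "\<iota> 0 = \<zero>"
  using const_add[of 0 0] const_closed[of 0] by (simp add: add.l_cancel_one)

lemma eval_word_closed: "set w \<subseteq> S \<Longrightarrow> eval_word w \<in> carrier A"
  by (induction w) (auto simp: gen_closed)

lemma eval_word_append: "set u \<subseteq> S \<Longrightarrow> set v \<subseteq> S \<Longrightarrow> eval_word (u @ v) = eval_word u \<otimes> eval_word v"
proof (induction u)
  case Nil
  then show ?case using eval_word_closed by simp
next
  case (Cons a u)
  then show ?case using eval_word_closed[of u] eval_word_closed[of v] by (simp add: m_assoc gen_closed)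
qed

lemma eval_superset:
  assumes "finite X" "Poly_Mapping.keys f \<subseteq> X" "\<forall>w\<in>X. set (letters w) \<subseteq> S"
  shows "falg_eval A \<iota> \<phi> f = (\<Oplus>w\<in>X. \<iota> (Poly_Mapping.lookup f w) \<otimes> eval_word (letters w))"
  unfolding falg_eval_def
proof (rule add.finprod_mono_neutral_cong_left)
  show "\<iota> (Poly_Mapping.lookup f w) \<otimes> eval_word (letters w) = \<zero>" if "w \<in> X - Poly_Mapping.keys f" for w
    using that assms(3) eval_word_closed by (auto simp: in_keys_iff const_zero)
qed (use assms eval_word_closed const_closed in auto)

lemma eval_add:
  assumes "f \<in> carrier (free_algebra S)" "g \<in> carrier (free_algebra S)"
  shows "falg_eval A \<iota> \<phi> (f + g) = falg_eval A \<iota> \<phi> f \<oplus> falg_eval A \<iota> \<phi> g"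
proof -
  let ?X = "Poly_Mapping.keys f \<union> Poly_Mapping.keys g"
  have X: "\<forall>w\<in>?X. set (letters w) \<subseteq> S" using assms by (auto simp: carrier_free_algebra)
  have c: "(\<lambda>w. \<iota> (Poly_Mapping.lookup h w) \<otimes> eval_word (letters w)) \<in> ?X \<rightarrow> carrier A" for h
    using X const_closed eval_word_closed by blast
  have "falg_eval A \<iota> \<phi> (f + g) =
      (\<Oplus>w\<in>?X. \<iota> (Poly_Mapping.lookup f w) \<otimes> eval_word (letters w) \<oplus>
               \<iota> (Poly_Mapping.lookup g w) \<otimes> eval_word (letters w))"
    unfolding eval_superset[OF _ keys_add X, simplified]
    by (rule add.finprod_cong')
      (use X const_closed eval_word_closed in \<open>auto simp: lookup_add const_add l_distr\<close>)
  then show ?thesis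
    using eval_superset[OF _ _ X, of f] eval_superset[OF _ _ X, of g] c by (simp add: finsum_addf)
qed

lemma eval_single:
  assumes "set w \<subseteq> S"
  shows "falg_eval A \<iota> \<phi> (fconst c * mon w) = \<iota> c \<otimes> eval_word w"
proof -
  have "falg_eval A \<iota> \<phi> (Poly_Mapping.single (Word w) c) = \<iota> c \<otimes> eval_word w"
    using eval_superset[of "{Word w}" "Poly_Mapping.single (Word w) c"] assms const_closed eval_word_closed
    by simp
  then show ?thesis by (simp add: single_eq_fconst_mon)
qed

lemma eval_closed: "f \<in> carrier (free_algebra S) \<Longrightarrow> falg_eval A \<iota> \<phi> f \<in> carrier A"
  unfolding falg_eval_def
  by (rule finsum_closed) (auto simp: carrier_free_algebra const_closed eval_word_closed)

lemma eval_mult: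
  assumes f: "f \<in> carrier (free_algebra S)" and g: "g \<in> carrier (free_algebra S)"
  shows "falg_eval A \<iota> \<phi> (f * g) = falg_eval A \<iota> \<phi> f \<otimes> falg_eval A \<iota> \<phi> g"
proof -
  let ?e = "falg_eval A \<iota> \<phi>"
  have mm: "?e ((fconst c * mon u) * (fconst d * mon v)) = ?e (fconst c * mon u) \<otimes> ?e (fconst d * mon v)"
    if "set u \<subseteq> S" "set v \<subseteq> S" for c d u v
  proof -
    have "(fconst c * mon u) * (fconst d * mon v) = fconst (c * d) * mon (u @ v)"
      by (simp only: fconst_mult mon_append[symmetric] mult.assoc fconst_left_commute[of "mon u"])
    moreover have "\<iota> (c * d) \<otimes> eval_word (u @ v) = \<iota> c \<otimes> eval_word u \<otimes> (\<iota> d \<otimes> eval_word v)"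
    proof -
      have cl: "eval_word u \<in> carrier A" "eval_word v \<in> carrier A" "\<iota> c \<in> carrier A" "\<iota> d \<in> carrier A"
        using that eval_word_closed const_closed by auto
      have "\<iota> c \<otimes> \<iota> d \<otimes> (eval_word u \<otimes> eval_word v) = \<iota> c \<otimes> (\<iota> d \<otimes> eval_word u) \<otimes> eval_word v"
        using cl by (simp only: m_assoc m_closed)
      also have "\<iota> d \<otimes> eval_word u = eval_word u \<otimes> \<iota> d"
        using cl by (simp only: const_commute)
      finally show ?thesis
        using cl that by (simp only: m_assoc m_closed eval_word_append const_mult)
    qed
    ultimately show ?thesis using that eval_single[of "u @ v"] eval_single by simp
  qed
  have sm: "g \<in> carrier (free_algebra S) \<and> ?e ((fconst c * mon u) * g) = ?e (fconst c * mon u) \<otimes> ?e g"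
    if u: "set u \<subseteq> S" for c u
  proof (rule falg_induct[where S = S and f = g])
    show "\<forall>w\<in>Poly_Mapping.keys g. set (letters w) \<subseteq> S" using g by (simp add: carrier_free_algebra)
    show "set v \<subseteq> S \<Longrightarrow> fconst d * mon v \<in> carrier (free_algebra S) \<and>
        ?e (fconst c * mon u * (fconst d * mon v)) = ?e (fconst c * mon u) \<otimes> ?e (fconst d * mon v)" for d v
      using mm[OF u] by (simp add: free_algebra_closed)
  next
    fix f g
    assume "f \<in> carrier (free_algebra S) \<and> ?e (fconst c * mon u * f) = ?e (fconst c * mon u) \<otimes> ?e f"
      "g \<in> carrier (free_algebra S) \<and> ?e (fconst c * mon u * g) = ?e (fconst c * mon u) \<otimes> ?e g"
    then show "f + g \<in> carrier (free_algebra S) \<and>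
        ?e (fconst c * mon u * (f + g)) = ?e (fconst c * mon u) \<otimes> ?e (f + g)"
      using u by (simp add: distrib_left eval_add free_algebra_closed eval_closed r_distr)
  qed
  have "f \<in> carrier (free_algebra S) \<and> ?e (f * g) = ?e f \<otimes> ?e g"
  proof (rule falg_induct[where S = S and f = f])
    show "\<forall>w\<in>Poly_Mapping.keys f. set (letters w) \<subseteq> S" using f by (simp add: carrier_free_algebra)
    show "set v \<subseteq> S \<Longrightarrow> fconst d * mon v \<in> carrier (free_algebra S) \<and>
        ?e (fconst d * mon v * g) = ?e (fconst d * mon v) \<otimes> ?e g" for d v
      using sm by (simp add: free_algebra_closed)
  next
    fix f f'
    assume "f \<in> carrier (free_algebra S) \<and> ?e (f * g) = ?e f \<otimes> ?e g"
      "f' \<in> carrier (free_algebra S) \<and> ?e (f' * g) = ?e f' \<otimes> ?e g"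
    then show "f + f' \<in> carrier (free_algebra S) \<and> ?e ((f + f') * g) = ?e (f + f') \<otimes> ?e g"
      using g by (simp add: distrib_right eval_add free_algebra_closed eval_closed l_distr)
  qed
  then show ?thesis by blast
qed

lemma eval_gen: "g \<in> S \<Longrightarrow> falg_eval A \<iota> \<phi> (fgen g) = \<phi> g"
  using eval_single[of "[g]" 1] by (simp add: mon_single const_one gen_closed)

lemma eval_const: "falg_eval A \<iota> \<phi> (fconst c) = \<iota> c"
  using eval_single[of "[]" c] by (simp add: mon_Nil const_closed)

lemma eval_hom: "falg_eval A \<iota> \<phi> \<in> ring_hom (free_algebra S) A"
  by (rule ring_hom_memI) (auto simp: eval_closed eval_mult eval_add eval_const const_one)

end

text \<open>Taking all generators avoids carrier conditions in computations;
  \<open>subst_closed\<close> recovers the subalgebra on \<open>S\<close>.\<close>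

definition subst :: "('g \<Rightarrow> ('h, 'k) falg) \<Rightarrow> ('g, 'k::{comm_ring, monoid_mult}) falg \<Rightarrow> ('h, 'k) falg" where
  "subst = falg_eval (free_algebra UNIV) fconst"

interpretation subst: falg_target "free_algebra UNIV" fconst \<phi> UNIV for \<phi>
proof (intro falg_target.intro ring_free_algebra falg_target_axioms.intro)
  show "fconst c \<otimes>\<^bsub>free_algebra UNIV\<^esub> x = x \<otimes>\<^bsub>free_algebra UNIV\<^esub> fconst c" for c x
    unfolding free_algebra_simps by (rule fconst_commute[symmetric])
qed (simp_all add: fconst_add fconst_mult carrier_free_algebra)

lemma carrier_free_algebra_UNIV [simp]: "carrier (free_algebra UNIV) = UNIV"
  by (simp add: carrier_free_algebra)

lemma subst_simps [simp]:
  "subst \<phi> (f + g) = subst \<phi> f + subst \<phi> g" "subst \<phi> (f * g) = subst \<phi> f * subst \<phi> g"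
  "subst \<phi> (fgen a) = \<phi> a" "subst \<phi> (fconst c) = fconst c"
  using subst.eval_add[of f g \<phi>] subst.eval_mult[of f g \<phi>] subst.eval_gen[of a \<phi>] subst.eval_const[of \<phi> c]
  unfolding subst_def by simp_all

lemma subst_0 [simp]: "subst \<phi> 0 = 0"
  using subst_simps(4)[of \<phi> 0] by simp

lemma subst_uminus [simp]: "subst \<phi> (- f) = - subst \<phi> f"
  using subst_simps(1)[of \<phi> f "- f"] by (simp add: eq_neg_iff_add_eq_0 add.commute)

lemma subst_diff [simp]: "subst \<phi> (f - g) = subst \<phi> f - subst \<phi> g"
  using subst_simps(1)[of \<phi> f "- g"] by simp

lemma subst_mon_Cons: "subst \<phi> (mon (a # w)) = \<phi> a * subst \<phi> (mon w)"
  by (simp add: mon_Cons)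

lemma subst_mon_Nil [simp]: "subst \<phi> (mon []) = mon []"
  by (simp add: mon_Nil)

lemma subst_closed:
  assumes "\<And>g. g \<in> S \<Longrightarrow> \<phi> g \<in> carrier (free_algebra S')" "f \<in> carrier (free_algebra S)"
  shows "subst \<phi> f \<in> carrier (free_algebra S')"
proof (rule falg_induct[where S = S])
  show "\<forall>w\<in>Poly_Mapping.keys f. set (letters w) \<subseteq> S" using assms by (simp add: carrier_free_algebra)
  fix c w assume "set w \<subseteq> S"
  then have "subst \<phi> (mon w) \<in> carrier (free_algebra S')"
    by (induction w) (auto simp: subst_mon_Cons free_algebra_closed assms(1))
  then show "subst \<phi> (fconst c * mon w) \<in> carrier (free_algebra S')" by (simp add: free_algebra_closed)
qed (simp add: free_algebra_closed)

lemma subst_hom: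
  "(\<And>g. g \<in> S \<Longrightarrow> \<phi> g \<in> carrier (free_algebra S')) \<Longrightarrow> subst \<phi> \<in> ring_hom (free_algebra S) (free_algebra S')"
  by (rule ring_hom_memI) (auto intro: subst_closed)

lemma subst_subst_id:
  assumes "\<And>g. subst \<phi> (\<psi> g) = fgen g"
  shows "subst \<phi> (subst \<psi> f) = f"
proof -
  have "subst \<phi> \<circ> subst \<psi> \<in> ring_hom (free_algebra UNIV) (free_algebra UNIV)"
    by (rule ring_hom_trans[OF subst_hom[where S = UNIV and S' = UNIV] subst_hom]) auto
  then show ?thesis
    using falg_hom_eq[of "subst \<phi> \<circ> subst \<psi>" UNIV "free_algebra UNIV" id f] assms by simp
qed

section \<open>Quotients by the relation ideal\<close>

locale presentation =
  fixes S :: "'g set" and R :: "(('g, 'k::{comm_ring, monoid_mult}) falg \<times> ('g, 'k) falg) set"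
  assumes rel_closed: "(l, r) \<in> R \<Longrightarrow> l \<in> carrier (free_algebra S) \<and> r \<in> carrier (free_algebra S)"
begin

abbreviation "I \<equiv> relation_ideal S R"
abbreviation "A \<equiv> presented_algebra S R"
abbreviation "cls f \<equiv> I +>\<^bsub>free_algebra S\<^esub> f"

sublocale F: ring "free_algebra S :: ('g, 'k) falg ring"
  by (rule ring_free_algebra)

lemma gens_closed: "{l - r | l r. (l, r) \<in> R} \<subseteq> carrier (free_algebra S)"
  using rel_closed by (auto intro: free_algebra_closed)

sublocale I: ideal I "free_algebra S :: ('g, 'k) falg ring"
  unfolding relation_ideal_def by (rule F.genideal_ideal[OF gens_closed])

sublocale A: ring A
  unfolding presented_algebra_def by (rule I.quotient_is_ring)

lemma rel_in_ideal: "(l, r) \<in> R \<Longrightarrow> l - r \<in> I"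
  unfolding relation_ideal_def using F.genideal_self[OF gens_closed] by blast

lemma cls_hom: "cls \<in> ring_hom (free_algebra S) A"
  unfolding presented_algebra_def by (rule I.rcos_ring_hom)

lemma carrier_A: "carrier A = cls ` carrier (free_algebra S)"
  by (simp add: presented_algebra_def FactRing_def A_RCOSETS_def' UNION_singleton_eq_range)

lemma cls_closed: "f \<in> carrier (free_algebra S) \<Longrightarrow> cls f \<in> carrier A"
  by (simp add: carrier_A)

lemma cls_eq_iff:
  assumes "f \<in> carrier (free_algebra S)" "g \<in> carrier (free_algebra S)"
  shows "cls f = cls g \<longleftrightarrow> f - g \<in> I"
proof
  assume "cls f = cls g"
  then have "f \<in> cls g" using I.a_rcos_self[OF assms(1)] by simp
  then show "f - g \<in> I" by (auto simp: a_r_coset_def r_coset_def)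
next
  assume "f - g \<in> I"
  then have "(f - g) + g \<in> cls g" unfolding a_r_coset_def r_coset_def by (auto intro!: bexI[of _ "f - g"])
  then show "cls f = cls g" using F.a_repr_independence[OF _ assms(2) I.a_subgroup] by simp
qed

lemma cls_mult: "f \<in> carrier (free_algebra S) \<Longrightarrow> g \<in> carrier (free_algebra S) \<Longrightarrow> cls (f * g) = cls f \<otimes>\<^bsub>A\<^esub> cls g"
  using ring_hom_mult[OF cls_hom] by simp

lemma cls_add: "f \<in> carrier (free_algebra S) \<Longrightarrow> g \<in> carrier (free_algebra S) \<Longrightarrow> cls (f + g) = cls f \<oplus>\<^bsub>A\<^esub> cls g"
  using ring_hom_add[OF cls_hom] by simp

lemma cls_one: "cls (fconst 1) = \<one>\<^bsub>A\<^esub>"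
  using ring_hom_one[OF cls_hom] by simp

lemma const_commute_A: "x \<in> carrier A \<Longrightarrow> cls (fconst c) \<otimes>\<^bsub>A\<^esub> x = x \<otimes>\<^bsub>A\<^esub> cls (fconst c)"
  unfolding carrier_A
proof (elim imageE)
  fix f assume "x = cls f" "f \<in> carrier (free_algebra S)"
  then show "cls (fconst c) \<otimes>\<^bsub>A\<^esub> x = x \<otimes>\<^bsub>A\<^esub> cls (fconst c)"
    using cls_mult[of "fconst c" f] cls_mult[of f "fconst c"] fconst_commute[of f c]
    by (simp add: free_algebra_closed)
qed

lemma falg_target_A:
  "(\<And>g. g \<in> S' \<Longrightarrow> \<phi> g \<in> carrier A) \<Longrightarrow> falg_target A (\<lambda>c. cls (fconst c)) \<phi> S'"
  by (intro falg_target.intro A.ring_axioms falg_target_axioms.intro const_commute_A)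
    (simp_all add: fconst_add fconst_mult cls_add cls_mult cls_one cls_closed free_algebra_closed)

lemma hom_factors:
  assumes h: "h \<in> ring_hom (free_algebra S) A'" and A': "ring A'"
    and rels: "\<And>l r. (l, r) \<in> R \<Longrightarrow> h l = h r"
    and fg: "f \<in> carrier (free_algebra S)" "g \<in> carrier (free_algebra S)" "cls f = cls g"
  shows "h f = h g"
proof -
  interpret h: ring_hom_ring "free_algebra S" A' h
    by (rule ring_hom_ringI2[OF F.ring_axioms A' h])
  have k: "f - g \<in> a_kernel (free_algebra S) A' h \<longleftrightarrow> h f = h g"
    if "f \<in> carrier (free_algebra S)" "g \<in> carrier (free_algebra S)" for f g
  proof -
    have d: "f - g \<in> carrier (free_algebra S)" by (rule free_algebra_closed(6)[OF that])
    have "h f = h (f - g) \<oplus>\<^bsub>A'\<^esub> h g"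
      using ring_hom_add[OF h d that(2), unfolded free_algebra_simps diff_add_cancel] .
    moreover have "f - g \<in> a_kernel (free_algebra S) A' h \<longleftrightarrow> h (f - g) = \<zero>\<^bsub>A'\<^esub>"
      unfolding a_kernel_def' using d by blast
    ultimately show ?thesis
      using h.S.add.r_cancel_one[of "h g" "h (f - g)"] ring_hom_closed[OF h d] ring_hom_closed[OF h that(2)] by metis
  qed
  have "I \<subseteq> a_kernel (free_algebra S) A' h"
    unfolding relation_ideal_def
    using rels rel_closed k by (intro F.genideal_minimal h.kernel_is_ideal) auto
  then show ?thesis using cls_eq_iff[OF fg(1,2)] fg(3) k[OF fg(1,2)] by blast
qed

end

section \<open>Monomials in the generators $T_\sigma + 1$\<close>

context tl_graph
begin

text \<open>Equivalent words name the same basis element, so one word per class is fixed.\<close>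

definition canon :: "'g list \<Rightarrow> 'g list" where
  "canon w = (SOME v. v \<sim> w)"

lemma canon_teq: "canon w \<sim> w"
  unfolding canon_def by (rule someI) (rule teq_refl)

lemma canon_eq: "w \<sim> w' \<Longrightarrow> canon w = canon w'"
  unfolding canon_def using teq_trans teq_sym by meson

end

definition tl_wt :: "'k::{comm_ring, monoid_mult} \<Rightarrow> nat \<Rightarrow> 'k" where
  "tl_wt q k = (if k = 0 then q + 1 else q)"

interpretation D: tl_scalars "adjD m" "tl_wt q" for m q ..

text \<open>A letter is read either as T or as b = T + 1. \<open>to_b\<close> rewrites an expression
  in the T as one in the b and \<open>to_T\<close> goes back, both inside the same free
  algebra.\<close>

definition to_b :: "('g, 'k::{comm_ring, monoid_mult}) falg \<Rightarrow> ('g, 'k) falg" where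
  "to_b = subst (\<lambda>s. fgen s - fconst 1)"

definition to_T :: "('g, 'k::{comm_ring, monoid_mult}) falg \<Rightarrow> ('g, 'k) falg" where
  "to_T = subst (\<lambda>s. fgen s + fconst 1)"

lemma to_b_to_T [simp]: "to_b (to_T f) = f" "to_T (to_b f) = f"
  unfolding to_b_def to_T_def by (intro subst_subst_id; simp)+

lemma to_b_closed: "f \<in> carrier (free_algebra S) \<Longrightarrow> to_b f \<in> carrier (free_algebra S)"
  unfolding to_b_def by (rule subst_closed) (auto intro!: free_algebra_closed)

lemma to_T_closed: "f \<in> carrier (free_algebra S) \<Longrightarrow> to_T f \<in> carrier (free_algebra S)"
  unfolding to_T_def by (rule subst_closed) (auto intro!: free_algebra_closed)

lemma to_b_simps [simp]:
  "to_b (f + g) = to_b f + to_b g" "to_b (f * g) = to_b f * to_b g" "to_b (f - g) = to_b f - to_b g"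
  "to_b (fgen a) = fgen a - fconst 1" "to_b (fconst c) = fconst c" "to_b 0 = 0" "to_b (- f) = - to_b f"
  by (simp_all add: to_b_def)

lemma to_T_simps [simp]:
  "to_T (f + g) = to_T f + to_T g" "to_T (f * g) = to_T f * to_T g" "to_T (f - g) = to_T f - to_T g"
  "to_T (fgen a) = fgen a + fconst 1" "to_T (fconst c) = fconst c" "to_T 0 = 0" "to_T (- f) = - to_T f"
  by (simp_all add: to_T_def)

text \<open>Edges carry the orientation of the given braid and V relations; the V relation for the
  reversed edge is derived in \<open>V_in_ideal\<close>.\<close>

definition edges :: "nat \<Rightarrow> (node \<times> node) set" where
  "edges m = {(Sig i, Sig (i + 1)) | i. 1 \<le> i \<and> i \<le> m - 1} \<union> {(Sigbar 1, Sig 2), (Sigbar m, Sig (m - 1))}"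

lemma edges_nodes: "3 \<le> m \<Longrightarrow> (a, b) \<in> edges m \<Longrightarrow> a \<in> nodes m \<and> b \<in> nodes m \<and> adjD m a b"
  by (auto simp: edges_def nodes_def)

lemma adjD_edges:
  "3 \<le> m \<Longrightarrow> a \<in> nodes m \<Longrightarrow> b \<in> nodes m \<Longrightarrow> adjD m a b \<Longrightarrow> (a, b) \<in> edges m \<or> (b, a) \<in> edges m"
  by (auto simp: edges_def nodes_def)

lemma TLD_rels_comm:
  assumes "3 \<le> m" "a \<in> nodes m" "b \<in> nodes m" "a \<noteq> b" "\<not> adjD m a b"
  shows "comm_rel a b \<in> TLD_rels m q \<or> comm_rel b a \<in> TLD_rels m q"
proof -
  have 1: "comm_rel (Sig i) (Sig j) \<in> TLD_rels m q"
    if "1 \<le> i" "i \<le> m" "1 \<le> j" "j \<le> m" "i \<noteq> j" "i \<noteq> Suc j" "j \<noteq> Suc i" for i j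
  proof -
    have "2 \<le> \<bar>int i - int j\<bar>" using that by linarith
    then show ?thesis using that unfolding TLD_rels_def by blast
  qed
  have 2: "comm_rel (Sigbar 1) (Sigbar m) \<in> TLD_rels m q"
    unfolding TLD_rels_def by blast
  have 3: "comm_rel (Sigbar 1) (Sig i) \<in> TLD_rels m q" if "1 \<le> i" "i \<le> m" "i \<noteq> 2" for i
    using that unfolding TLD_rels_def by blast
  have 4: "comm_rel (Sigbar m) (Sig i) \<in> TLD_rels m q" if "1 \<le> i" "i \<le> m" "i \<noteq> m - 1" for i
    using that unfolding TLD_rels_def by blast
  show ?thesis
    using assms(1,4,5)
    by (rule_tac nodes_cases[OF assms(2)]; rule_tac nodes_cases[OF assms(3)]) (auto simp: 1 2 3 4 simp del: One_nat_def)
qed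

lemma TLD_rels_edge:
  assumes "(a, b) \<in> edges m"
  shows "braid_rel a b \<in> TLD_rels m q" "V_rel a b \<in> TLD_rels m q"
  using assms unfolding edges_def TLD_rels_def by blast+

lemma TLD_rels_quad: "a \<in> nodes m \<Longrightarrow> quad_rel q a \<in> TLD_rels m q"
  unfolding TLD_rels_def by blast

lemma TLD_rels_cases:
  assumes "x \<in> TLD_rels m q" "3 \<le> m"
  obtains (comm) a b where "a \<in> nodes m" "b \<in> nodes m" "a \<noteq> b" "\<not> adjD m a b" "x = comm_rel a b"
    | (braid) a b where "(a, b) \<in> edges m" "x = braid_rel a b"
    | (V) a b where "(a, b) \<in> edges m" "x = V_rel a b"
    | (quad) a where "a \<in> nodes m" "x = quad_rel q a"
  using assms(1) unfolding TLD_rels_def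
proof (elim UnE)
  assume "x \<in> {comm_rel (Sig i) (Sig j) | i j. 1 \<le> i \<and> i \<le> m \<and> 1 \<le> j \<and> j \<le> m \<and> \<bar>int i - int j\<bar> \<ge> 2}"
  then obtain i j where "1 \<le> i" "i \<le> m" "1 \<le> j" "j \<le> m" "\<bar>int i - int j\<bar> \<ge> 2" "x = comm_rel (Sig i) (Sig j)"
    by blast
  then show thesis using assms(2) by (intro comm[of "Sig i" "Sig j"]) (auto simp: nodes_def)
next
  assume "x \<in> {comm_rel (Sigbar 1) (Sigbar m)}"
  then show thesis using assms(2) by (intro comm[of "Sigbar 1" "Sigbar m"]) (auto simp: nodes_def)
next
  assume "x \<in> {comm_rel (Sigbar 1) (Sig i) | i. 1 \<le> i \<and> i \<le> m \<and> i \<noteq> 2}"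
  then obtain i where "1 \<le> i" "i \<le> m" "i \<noteq> 2" "x = comm_rel (Sigbar 1) (Sig i)" by blast
  then show thesis using assms(2) by (intro comm[of "Sigbar 1" "Sig i"]) (auto simp: nodes_def)
next
  assume "x \<in> {comm_rel (Sigbar m) (Sig i) | i. 1 \<le> i \<and> i \<le> m \<and> i \<noteq> m - 1}"
  then obtain i where "1 \<le> i" "i \<le> m" "i \<noteq> m - 1" "x = comm_rel (Sigbar m) (Sig i)" by blast
  then show thesis using assms(2) by (intro comm[of "Sigbar m" "Sig i"]) (auto simp: nodes_def)
next
  assume "x \<in> {braid_rel (Sig i) (Sig (i + 1)) | i. 1 \<le> i \<and> i \<le> m - 1}"
  then show thesis using braid unfolding edges_def by blast
next
  assume "x \<in> {braid_rel (Sigbar 1) (Sig 2), braid_rel (Sigbar m) (Sig (m - 1))}"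
  then show thesis using braid unfolding edges_def by blast
next
  assume "x \<in> {quad_rel q a | a. a \<in> nodes m}"
  then show thesis using quad by blast
next
  assume "x \<in> {V_rel (Sigbar 1) (Sig 2), V_rel (Sigbar m) (Sig (m - 1))}"
  then show thesis using V unfolding edges_def by blast
next
  assume "x \<in> {V_rel (Sig i) (Sig (i + 1)) | i. 1 \<le> i \<and> i \<le> m - 1}"
  then show thesis using V unfolding edges_def by blast
qed

lemma V_free_algebra:
  "V (free_algebra S) x y = x * y * x + x * y + y * x + x + y + fconst 1"
  by (simp add: V_def)

lemma to_b_comm_rel: "to_b (fgen a * fgen b) - to_b (fgen b * fgen a) = mon [a, b] - mon [b, a]"
  by (simp add: mon_Cons mon_Nil algebra_simps)

lemma to_b_quad_rel:
  "to_b (fgen a * fgen a) - to_b (fconst (q - 1) * fgen a + fconst q) = mon [a, a] - fconst (q + 1) * mon [a]"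
  by (simp add: mon_Cons mon_Nil fconst_add fconst_diff algebra_simps)

text \<open>V(x, y) equals (x+1)(y+1)(x+1) - (x+1)(x+1) + (x+1). Modulo the quadratic relation its
  vanishing means b b' b = q b.\<close>

lemma to_b_V_rel:
  "to_b (V (free_algebra S) (fgen a) (fgen b)) = mon [a, b, a] - mon [a, a] + mon [a]"
  by (simp add: V_free_algebra mon_Cons mon_Nil algebra_simps)

text \<open>This lets the V relations in both orders replace the braid relation, and it yields the V
  relation of a reversed edge from the braid relation.\<close>

lemma braid_V:
  "fgen a * fgen b * fgen a - fgen b * fgen a * fgen b =
   V (free_algebra S) (fgen a) (fgen b) - V (free_algebra S) (fgen b) (fgen a)"
  by (simp add: V_free_algebra algebra_simps)

section \<open>Coefficient functionals\<close>

definition lin :: "('g list \<Rightarrow> 'k) \<Rightarrow> ('g, 'k::{comm_ring, monoid_mult}) falg \<Rightarrow> 'k" where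
  "lin F f = (\<Sum>w \<in> Poly_Mapping.keys f. Poly_Mapping.lookup f w * F (letters w))"

lemma lin_superset:
  "finite X \<Longrightarrow> Poly_Mapping.keys f \<subseteq> X \<Longrightarrow> lin F f = (\<Sum>w \<in> X. Poly_Mapping.lookup f w * F (letters w))"
  unfolding lin_def by (rule sum.mono_neutral_left) (auto simp: in_keys_iff)

lemma lin_add: "lin F (f + g) = lin F f + lin F g"
  using lin_superset[of "Poly_Mapping.keys f \<union> Poly_Mapping.keys g" _ F] keys_add[of f g]
  by (simp add: lookup_add distrib_right sum.distrib)

lemma lin_0 [simp]: "lin F 0 = 0"
  by (simp add: lin_def)

lemma lin_uminus: "lin F (- f) = - lin F f"
  using lin_add[of F f "- f"] by (simp add: eq_neg_iff_add_eq_0 add.commute)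

lemma lin_diff: "lin F (f - g) = lin F f - lin F g"
  using lin_add[of F f "- g"] by (simp add: lin_uminus)

lemma lin_single: "lin F (fconst c * mon w) = c * F w"
proof -
  have "lin F (Poly_Mapping.single (Word w) c) = c * F w"
    by (subst lin_superset[of "{Word w}"]) auto
  then show ?thesis by (simp add: single_eq_fconst_mon)
qed

lemma lin_mon [simp]: "lin F (mon w) = F w"
  using lin_single[of F 1 w] by simp

lemma lin_fconst_mult: "lin F (fconst c * f) = c * lin F f"
proof (induction f rule: falg_induct_UNIV)
  case (single d w)
  have "fconst c * (fconst d * mon w) = fconst (c * d) * mon w"
    by (simp add: fconst_mult mult.assoc)
  then show ?case by (simp add: lin_single mult.assoc)
qed (simp add: distrib_left lin_add)

lemma lin_context_eq_0:
  assumes "\<And>u v. lin F (mon u * f * mon v) = 0"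
  shows "lin F (g * f * h) = 0"
proof (induction g rule: falg_induct_UNIV)
  case (single c u)
  show ?case
  proof (induction h rule: falg_induct_UNIV)
    case (single d v)
    have "fconst c * mon u * f * (fconst d * mon v) = fconst c * (fconst d * (mon u * f * mon v))"
      by (simp only: mult.assoc fconst_left_commute[of f] fconst_left_commute[of "mon u"])
    then show ?case by (simp add: lin_fconst_mult assms)
  qed (simp add: distrib_left lin_add)
qed (simp add: distrib_right lin_add)

section \<open>Reduced words are independent in the quotient and span it\<close>

locale TLD_alg =
  fixes m :: nat and q r :: "'k::{comm_ring, monoid_mult}"
  assumes m3: "3 \<le> m" and qr: "q * r = 1"
begin

sublocale presentation "nodes m" "TLD_rels m q"
proof
  fix l r assume "(l, r) \<in> TLD_rels m q"
  then show "l \<in> carrier (free_algebra (nodes m)) \<and> r \<in> carrier (free_algebra (nodes m))"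
    using m3
  proof (cases rule: TLD_rels_cases)
    case (comm a b)
    then show ?thesis by (auto simp: comm_rel_def intro!: free_algebra_closed)
  next
    case (braid a b)
    then show ?thesis using edges_nodes[OF m3] by (auto simp: braid_rel_def intro!: free_algebra_closed)
  next
    case (V a b)
    then show ?thesis using edges_nodes[OF m3]
      by (auto simp: V_rel_def V_free_algebra intro!: free_algebra_closed)
  next
    case (quad a)
    then show ?thesis by (auto simp: quad_rel_def intro!: free_algebra_closed)
  qed
qed

text \<open>The kernel of a functional need not be an ideal, so \<open>J\<close> asks for vanishing
  in every context \<open>u\<close>, \<open>v\<close>. This condition does define an ideal; it
  contains the relations and hence I.\<close>

lemma functional_vanishes:
  assumes comm: "\<And>u a b v. a \<noteq> b \<Longrightarrow> \<not> adjD m a b \<Longrightarrow> F (u @ [a, b] @ v) = F (u @ [b, a] @ v)"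
    and quad: "\<And>u a v. F (u @ [a, a] @ v) = (q + 1) * F (u @ [a] @ v)"
    and braid: "\<And>u a b v. adjD m a b \<Longrightarrow> F (u @ [a, b, a] @ v) = q * F (u @ [a] @ v)"
    and f: "f \<in> I"
  shows "lin F (to_b f) = 0"
proof -
  define J where "J = {f \<in> carrier (free_algebra (nodes m)). \<forall>u v. lin F (mon u * to_b f * mon v) = 0}"
  have "ideal J (free_algebra (nodes m))"
  proof (rule idealI[OF ring_free_algebra])
    show "subgroup J (add_monoid (free_algebra (nodes m)))"
    proof (rule F.add.subgroupI)
      show "J \<subseteq> carrier (free_algebra (nodes m))" by (auto simp: J_def)
      show "J \<noteq> {}" by (auto simp: J_def intro!: exI[of _ 0] free_algebra_closed)
      fix x assume x: "x \<in> J"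
      have "\<ominus>\<^bsub>free_algebra (nodes m)\<^esub> x = - x"
        using x by (intro F.add.inv_equality) (auto simp: J_def intro: free_algebra_closed)
      then show "\<ominus>\<^bsub>free_algebra (nodes m)\<^esub> x \<in> J"
        using x by (auto simp: J_def lin_uminus intro: free_algebra_closed)
      fix y assume "y \<in> J"
      then show "x \<oplus>\<^bsub>free_algebra (nodes m)\<^esub> y \<in> J"
        using x by (auto simp: J_def lin_add distrib_left distrib_right intro: free_algebra_closed)
    qed
    fix a x :: "(node, 'k) falg"
    assume a: "a \<in> J" and x: "x \<in> carrier (free_algebra (nodes m))"
    have "lin F (y * to_b a * z) = 0" for y z
      using a by (rule_tac lin_context_eq_0) (simp add: J_def)
    from this[of "mon u * to_b x" "mon v" for u v] this[of "mon u" "to_b x * mon v" for u v]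
    show "x \<otimes>\<^bsub>free_algebra (nodes m)\<^esub> a \<in> J" "a \<otimes>\<^bsub>free_algebra (nodes m)\<^esub> x \<in> J"
      using a x by (auto simp: J_def mult.assoc intro: free_algebra_closed)
  qed
  moreover have "{l - r | l r. (l, r) \<in> TLD_rels m q} \<subseteq> J"
  proof clarify
    fix l r assume lr: "(l, r) \<in> TLD_rels m q"
    have V0: "lin F (mon u * to_b (V (free_algebra UNIV) (fgen a) (fgen b)) * mon v) = 0"
      if "adjD m a b" for a b u v
      using quad[of u a v] braid[OF that, of u v]
      by (simp add: to_b_V_rel distrib_left distrib_right left_diff_distrib right_diff_distrib
          lin_add lin_diff mon_append)
    have "lin F (mon u * to_b (l - r) * mon v) = 0" for u v
      using lr m3
    proof (cases rule: TLD_rels_cases)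
      case (comm a b)
      then have "to_b (l - r) = mon [a, b] - mon [b, a]"
        using to_b_comm_rel by (simp add: comm_rel_def)
      then show ?thesis
        using assms(1)[of a b u v] comm
        by (simp add: left_diff_distrib right_diff_distrib lin_diff mon_append)
    next
      case (braid a b)
      then have ab: "adjD m a b" "adjD m b a"
        using edges_nodes[OF m3] D.adj_sym by blast+
      have "l - r = V (free_algebra UNIV) (fgen a) (fgen b) - V (free_algebra UNIV) (fgen b) (fgen a)"
        using braid by (simp add: braid_rel_def braid_V[where S = UNIV])
      then have "to_b (l - r) =
          to_b (V (free_algebra UNIV) (fgen a) (fgen b)) - to_b (V (free_algebra UNIV) (fgen b) (fgen a))"
        by (simp only: to_b_simps)
      then show ?thesis
        using V0[OF ab(1)] V0[OF ab(2)] by (simp add: left_diff_distrib right_diff_distrib lin_diff)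
    next
      case (V a b)
      then show ?thesis using V0 edges_nodes[OF m3] by (simp add: V_rel_def)
    next
      case (quad a)
      then have "to_b (l - r) = mon [a, a] - fconst (q + 1) * mon [a]"
        using to_b_quad_rel[of a q] by (simp add: quad_rel_def)
      moreover have "mon u * (fconst (q + 1) * mon [a]) * mon v = fconst (q + 1) * mon (u @ [a] @ v)"
        by (simp only: fconst_left_commute[of "mon u"] mult.assoc mon_append append_assoc)
      ultimately show ?thesis
        using assms(2)[of u a v]
        by (simp add: left_diff_distrib right_diff_distrib lin_diff lin_single mon_append)
    qed
    then show "l - r \<in> J" using rel_closed[OF lr] by (auto simp: J_def intro: free_algebra_closed)
  qed
  ultimately have "I \<subseteq> J" unfolding relation_ideal_def by (rule F.genideal_minimal)
  then have "lin F (mon [] * to_b f * mon []) = 0" using f by (auto simp: J_def)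
  then show ?thesis by (simp add: mon_Nil)
qed

lemma nf_coeff_vanishes:
  assumes "f \<in> I" shows "lin (D.nf_coeff m q h) (to_b f) = 0"
proof (rule functional_vanishes[OF _ _ _ assms])
  show "D.nf_coeff m q h (u @ [a, b] @ v) = D.nf_coeff m q h (u @ [b, a] @ v)"
    if "a \<noteq> b" "\<not> adjD m a b" for u a b v
    using D.nf_coeff_teq[OF D.swap_teq[OF D.swapI[OF that, of u v]]] by simp
  show "D.nf_coeff m q h (u @ [a, a] @ v) = (q + 1) * D.nf_coeff m q h (u @ [a] @ v)" for u a v
    using D.nf_coeff_step[OF D.stepI[of a "[]" m 0 u v], of q h] by (simp add: tl_wt_def)
  show "D.nf_coeff m q h (u @ [a, b, a] @ v) = q * D.nf_coeff m q h (u @ [a] @ v)"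
    if "adjD m a b" for u a b v
  proof -
    have "a \<noteq> b" using that D.adj_irrefl by blast
    then show ?thesis
      using D.nf_coeff_step[OF D.stepI[of a "[b]" m 1 u v], of q h] that by (simp add: tl_wt_def)
  qed
qed

definition bm :: "node list \<Rightarrow> (node, 'k) falg set" where
  "bm w = cls (to_T (mon w))"

abbreviation const :: "'k \<Rightarrow> (node, 'k) falg set" where
  "const c \<equiv> cls (fconst c)"

lemma const_closed: "const c \<in> carrier A"
  by (intro cls_closed free_algebra_closed)

lemma bm_closed: "set w \<subseteq> nodes m \<Longrightarrow> bm w \<in> carrier A"
  unfolding bm_def by (intro cls_closed to_T_closed free_algebra_closed)

lemma bm_append:
  "set u \<subseteq> nodes m \<Longrightarrow> set v \<subseteq> nodes m \<Longrightarrow> bm (u @ v) = bm u \<otimes>\<^bsub>A\<^esub> bm v"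
  unfolding bm_def mon_append[symmetric] to_T_simps by (intro cls_mult to_T_closed free_algebra_closed)

lemma cls_const_mult: "f \<in> carrier (free_algebra (nodes m)) \<Longrightarrow> cls (fconst c * f) = const c \<otimes>\<^bsub>A\<^esub> cls f"
  by (intro cls_mult free_algebra_closed)

lemma I_add: "x \<in> I \<Longrightarrow> y \<in> I \<Longrightarrow> x + y \<in> I"
  using I.a_closed by simp

lemma I_uminus: "x \<in> I \<Longrightarrow> - x \<in> I"
proof -
  assume x: "x \<in> I"
  then have "\<ominus>\<^bsub>free_algebra (nodes m)\<^esub> x = - x"
    by (intro F.add.inv_equality) (auto intro!: free_algebra_closed)
  then show ?thesis using I.a_inv_closed[OF x] by simp
qed

lemma comm_in_ideal:
  assumes "a \<in> nodes m" "b \<in> nodes m" "a \<noteq> b" "\<not> adjD m a b"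
  shows "fgen a * fgen b - fgen b * fgen a \<in> I"
  using TLD_rels_comm[OF m3 assms, of q]
proof
  assume "comm_rel b a \<in> TLD_rels m q"
  then have "- (fgen b * fgen a - fgen a * fgen b) \<in> I"
    unfolding comm_rel_def by (intro I_uminus rel_in_ideal)
  then show ?thesis by simp
qed (auto simp: comm_rel_def dest: rel_in_ideal)

lemma bm_comm:
  assumes "a \<in> nodes m" "b \<in> nodes m" "a \<noteq> b" "\<not> adjD m a b"
  shows "bm [a, b] = bm [b, a]"
proof -
  have "to_T (mon [a, b]) - to_T (mon [b, a]) = (fgen a * fgen b - fgen b * fgen a :: (node, 'k) falg)"
    by (simp add: mon_Cons mon_Nil algebra_simps)
  then show ?thesis
    unfolding bm_def using assms comm_in_ideal[OF assms]
    by (subst cls_eq_iff) (auto intro!: to_T_closed free_algebra_closed)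
qed

lemma quad_in_ideal:
  "a \<in> nodes m \<Longrightarrow> fgen a * fgen a - (fconst (q - 1) * fgen a + fconst q) \<in> I"
  using rel_in_ideal TLD_rels_quad unfolding quad_rel_def by blast

lemma V_in_ideal:
  assumes "a \<in> nodes m" "b \<in> nodes m" "adjD m a b"
  shows "V (free_algebra UNIV) (fgen a) (fgen b) \<in> I"
  using adjD_edges[OF m3 assms]
proof
  assume "(a, b) \<in> edges m"
  then show ?thesis using rel_in_ideal[OF TLD_rels_edge(2)[unfolded V_rel_def]] by simp
next
  assume e: "(b, a) \<in> edges m"
  have "V (free_algebra UNIV) (fgen b) (fgen a) + - (fgen b * fgen a * fgen b - fgen a * fgen b * fgen a) \<in> I"
    using rel_in_ideal[OF TLD_rels_edge(2)[OF e, unfolded V_rel_def]]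
      rel_in_ideal[OF TLD_rels_edge(1)[OF e, unfolded braid_rel_def]]
    by (intro I_add I_uminus) simp_all
  then show ?thesis by (simp add: braid_V[of b a UNIV])
qed

lemma bm_quad:
  assumes "a \<in> nodes m" shows "bm [a, a] = const (q + 1) \<otimes>\<^bsub>A\<^esub> bm [a]"
proof -
  have "to_T (mon [a, a]) - fconst (q + 1) * to_T (mon [a]) = fgen a * fgen a - (fconst (q - 1) * fgen a + fconst q)"
    by (simp add: mon_Cons mon_Nil fconst_add fconst_diff algebra_simps)
  then have "cls (to_T (mon [a, a])) = cls (fconst (q + 1) * to_T (mon [a]))"
    using assms quad_in_ideal by (subst cls_eq_iff) (auto intro!: to_T_closed free_algebra_closed)
  then show ?thesis
    unfolding bm_def using assms by (simp add: cls_const_mult to_T_closed free_algebra_closed)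
qed

lemma bm_braid:
  assumes "a \<in> nodes m" "b \<in> nodes m" "adjD m a b"
  shows "bm [a, b, a] = const q \<otimes>\<^bsub>A\<^esub> bm [a]"
proof -
  have "to_T (mon [a, b, a]) - fconst q * to_T (mon [a]) = V (free_algebra UNIV) (fgen a) (fgen b) +
      (fgen a * fgen a - (fconst (q - 1) * fgen a + fconst q))"
    by (simp add: V_free_algebra mon_Cons mon_Nil fconst_add fconst_diff algebra_simps)
  then have "cls (to_T (mon [a, b, a])) = cls (fconst q * to_T (mon [a]))"
    using assms I_add[OF V_in_ideal[OF assms] quad_in_ideal[OF assms(1)]]
    by (subst cls_eq_iff) (auto intro!: to_T_closed free_algebra_closed)
  then show ?thesis
    unfolding bm_def using assms by (simp add: cls_const_mult to_T_closed free_algebra_closed)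
qed

lemma const_context:
  assumes "x \<in> carrier A" "y \<in> carrier A" "z \<in> carrier A"
  shows "x \<otimes>\<^bsub>A\<^esub> ((const c \<otimes>\<^bsub>A\<^esub> y) \<otimes>\<^bsub>A\<^esub> z) = const c \<otimes>\<^bsub>A\<^esub> (x \<otimes>\<^bsub>A\<^esub> (y \<otimes>\<^bsub>A\<^esub> z))"
proof -
  have "x \<otimes>\<^bsub>A\<^esub> ((const c \<otimes>\<^bsub>A\<^esub> y) \<otimes>\<^bsub>A\<^esub> z) = (x \<otimes>\<^bsub>A\<^esub> const c) \<otimes>\<^bsub>A\<^esub> (y \<otimes>\<^bsub>A\<^esub> z)"
    using assms const_closed by (simp only: A.m_assoc A.m_closed)
  also have "x \<otimes>\<^bsub>A\<^esub> const c = const c \<otimes>\<^bsub>A\<^esub> x"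
    using assms by (simp only: const_commute_A)
  finally show ?thesis using assms const_closed by (simp only: A.m_assoc A.m_closed)
qed

lemma bm_context:
  assumes "bm x = const c \<otimes>\<^bsub>A\<^esub> bm y" "set (u @ x @ y @ v) \<subseteq> nodes m"
  shows "bm (u @ x @ v) = const c \<otimes>\<^bsub>A\<^esub> bm (u @ y @ v)"
  using assms bm_closed const_context[of "bm u" "bm y" "bm v" c] by (simp add: bm_append)

lemma bm_teq:
  assumes "D.teq m w w'" "set w \<subseteq> nodes m"
  shows "bm w = bm w'"
  using assms(1) unfolding D.teq_def
proof (induction rule: rtranclp_induct)
  case (step y z)
  have "set y \<subseteq> nodes m" using D.teq_set[of m w y] step.hyps(1) assms(2) unfolding D.teq_def by simp
  moreover obtain u a b v where "y = u @ [a, b] @ v" "z = u @ [b, a] @ v" "a \<noteq> b" "\<not> adjD m a b"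
    using step.hyps(2) unfolding D.swap_def by auto
  ultimately have "bm y = bm z"
    using bm_comm[of a b] bm_append[of u "[a, b] @ v"] bm_append[of "[a, b]" v]
      bm_append[of u "[b, a] @ v"] bm_append[of "[b, a]" v] by simp
  then show ?case using step.IH by simp
qed simp

text \<open>Commutations bring the two copies of \<open>s\<close> together, around their single
  common neighbour if there is one. Then the quadratic relation or b b' b = q b applies to
  contiguous letters.\<close>

lemma bm_step:
  assumes "D.step m w k w'" "set w \<subseteq> nodes m"
  shows "bm w = const (tl_wt q k) \<otimes>\<^bsub>A\<^esub> bm w'"
proof -
  obtain u s x v where w: "w = u @ s # x @ s # v" "s \<notin> set x" "k = length (filter (adjD m s) x)" "k \<le> 1"
    "w' = u @ s # filter (\<lambda>a. \<not> adjD m s a) x @ v"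
    using assms(1) unfolding D.step_def by metis
  have n: "set u \<subseteq> nodes m" "s \<in> nodes m" "set x \<subseteq> nodes m" "set v \<subseteq> nodes m" using assms(2) w by auto
  consider "filter (adjD m s) x = []" | t where "filter (adjD m s) x = [t]"
    using w(3,4) by (cases "filter (adjD m s) x") auto
  then show ?thesis
  proof cases
    case 1
    then have free: "\<forall>a\<in>set x. a \<noteq> s \<and> \<not> adjD m s a" using w(2) by (auto simp: filter_empty_conv)
    have e1: "D.teq m w ((u @ x) @ [s, s] @ v)"
      using D.teq_append[OF D.teq_move[OF free, of "s # v"], of u "[]"] w by simp
    have e2: "D.teq m w' ((u @ x) @ [s] @ v)"
      using D.teq_append[OF D.teq_move[OF free, of v], of u "[]"] w free by (simp add: filter_id_conv)
    have "bm w = const (q + 1) \<otimes>\<^bsub>A\<^esub> bm ((u @ x) @ [s] @ v)"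
      using bm_teq[OF e1 assms(2)] bm_context[OF bm_quad[OF n(2)], of "u @ x" v] n by simp
    also have "bm ((u @ x) @ [s] @ v) = bm w'"
      using bm_teq[OF D.teq_sym[OF e2]] n by simp
    finally show ?thesis using 1 w by (simp add: tl_wt_def)
  next
    case (2 t)
    then obtain y z where x: "x = y @ t # z" "\<forall>a\<in>set y. \<not> adjD m s a" "adjD m s t"
      and "[] = filter (adjD m s) z"
      unfolding filter_eq_Cons_iff by blast
    then have z: "\<forall>a\<in>set z. \<not> adjD m s a" by (metis filter_empty_conv)
    then have free: "\<forall>a\<in>set y. a \<noteq> s \<and> \<not> adjD m s a" "\<forall>a\<in>set z. a \<noteq> s \<and> \<not> adjD m s a"
      using w(2) x z by auto
    have "D.teq m w (u @ y @ s # t # z @ s # v)"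
      using D.teq_append[OF D.teq_move[OF free(1), of "t # z @ s # v"], of u "[]"] w x by simp
    also have "D.teq m (u @ y @ s # t # z @ s # v) ((u @ y) @ [s, t, s] @ z @ v)"
      using D.teq_append[OF D.teq_sym[OF D.teq_move[OF free(2), of v]], of "u @ y @ [s, t]" "[]"] by simp
    finally have e1: "D.teq m w ((u @ y) @ [s, t, s] @ z @ v)" .
    have "filter (\<lambda>a. \<not> adjD m s a) x = y @ z" using x z by simp
    then have e2: "D.teq m w' ((u @ y) @ [s] @ z @ v)"
      using D.teq_append[OF D.teq_move[OF free(1), of "z @ v"], of u "[]"] w by simp
    have "bm w = const q \<otimes>\<^bsub>A\<^esub> bm ((u @ y) @ [s] @ z @ v)"
      using bm_teq[OF e1 assms(2)] bm_context[OF bm_braid[of s t], of "u @ y" "z @ v"] n x by simp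
    also have "bm ((u @ y) @ [s] @ z @ v) = bm w'"
      using bm_teq[OF D.teq_sym[OF e2]] n x by simp
    finally show ?thesis using 2 w by (simp add: tl_wt_def)
  qed
qed

lemma bm_red:
  assumes "D.red m q w c v" "set w \<subseteq> nodes m"
  shows "bm w = const c \<otimes>\<^bsub>A\<^esub> bm v"
  using assms
proof (induction rule: D.red.induct)
  case (refl w)
  then show ?case by (simp add: cls_one bm_closed)
next
  case (step w k w' c v)
  have "set w' \<subseteq> nodes m" "set v \<subseteq> nodes m"
    using D.step_set[OF step.hyps(1)] D.red_set[OF step.hyps(2)] step.prems by auto
  then show ?case
    using bm_step[OF step.hyps(1) step.prems] step.IH bm_closed const_closed
    by (simp add: fconst_mult cls_mult free_algebra_closed A.m_assoc)
qed

text \<open>Canonical representatives ensure that distinct words of \<open>g\<close> are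
  inequivalent. Membership of \<open>f\<close> is repeated in the conclusion so that the induction
  has it for the summands.\<close>

lemma FC_spanning:
  assumes "f \<in> carrier (free_algebra (nodes m))"
  shows "f \<in> carrier (free_algebra (nodes m)) \<and>
    (\<exists>g \<in> carrier (free_algebra (nodes m)). cls (to_T f) = cls (to_T g) \<and>
      (\<forall>w \<in> Poly_Mapping.keys g. D.FC m (letters w) \<and> D.canon m (letters w) = letters w))"
proof (rule falg_induct[where S = "nodes m" and f = f])
  show "\<forall>w\<in>Poly_Mapping.keys f. set (letters w) \<subseteq> nodes m" using assms by (simp add: carrier_free_algebra)
next
  fix k w assume w: "set w \<subseteq> nodes m"
  obtain c v where v: "D.red m q w c v" "D.FC m v" using D.ex_red_FC by blast
  define v' where "v' = D.canon m v"
  have v': "D.teq m v' v" "D.FC m v'" "D.canon m v' = v'"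
    using D.canon_teq D.teq_FC[OF D.teq_sym v(2)] D.canon_eq unfolding v'_def by blast+
  have vn: "set v \<subseteq> nodes m" "set v' \<subseteq> nodes m"
    using D.red_set[OF v(1)] w D.teq_set[OF v'(1)] by auto
  have "cls (to_T (fconst k * mon w)) = const k \<otimes>\<^bsub>A\<^esub> bm w"
    using w by (simp add: bm_def cls_const_mult to_T_closed free_algebra_closed)
  also have "bm w = const c \<otimes>\<^bsub>A\<^esub> bm v'"
    using bm_red[OF v(1) w] bm_teq[OF v'(1) vn(2)] by simp
  also have "const k \<otimes>\<^bsub>A\<^esub> (const c \<otimes>\<^bsub>A\<^esub> bm v') = const (k * c) \<otimes>\<^bsub>A\<^esub> bm v'"
    using bm_closed[OF vn(2)] const_closed
    by (simp add: fconst_mult cls_mult free_algebra_closed A.m_assoc)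
  also have "\<dots> = cls (to_T (fconst (k * c) * mon v'))"
    using vn by (simp add: bm_def cls_const_mult to_T_closed free_algebra_closed)
  finally have "cls (to_T (fconst k * mon w)) = cls (to_T (fconst (k * c) * mon v'))" .
  moreover have "fconst (k * c) * mon v' = Poly_Mapping.single (Word v') (k * c)"
    by (simp add: single_eq_fconst_mon)
  then have "\<forall>w \<in> Poly_Mapping.keys (fconst (k * c) * mon v'). D.FC m (letters w) \<and> D.canon m (letters w) = letters w"
    using v' by simp
  ultimately show "fconst k * mon w \<in> carrier (free_algebra (nodes m)) \<and>
    (\<exists>g \<in> carrier (free_algebra (nodes m)). cls (to_T (fconst k * mon w)) = cls (to_T g) \<and>
      (\<forall>w \<in> Poly_Mapping.keys g. D.FC m (letters w) \<and> D.canon m (letters w) = letters w))"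
    using vn w by (intro conjI bexI[of _ "fconst (k * c) * mon v'"]) (auto intro!: free_algebra_closed)
next
  fix f1 f2
  let ?F = "carrier (free_algebra (nodes m))"
  let ?C = "\<lambda>f g. cls (to_T f) = cls (to_T g) \<and>
    (\<forall>w \<in> Poly_Mapping.keys g. D.FC m (letters w) \<and> D.canon m (letters w) = letters w)"
  assume "f1 \<in> ?F \<and> (\<exists>g \<in> ?F. ?C f1 g)" "f2 \<in> ?F \<and> (\<exists>g \<in> ?F. ?C f2 g)"
  then obtain g1 g2 where g: "f1 \<in> ?F" "f2 \<in> ?F" "g1 \<in> ?F" "?C f1 g1" "g2 \<in> ?F" "?C f2 g2"
    by blast
  have "cls (to_T (f1 + f2)) = cls (to_T (g1 + g2))"
    using g by (simp add: cls_add to_T_closed)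
  moreover have "Poly_Mapping.keys (g1 + g2) \<subseteq> Poly_Mapping.keys g1 \<union> Poly_Mapping.keys g2"
    by (rule keys_add)
  ultimately have "?C (f1 + f2) (g1 + g2)" using g by blast
  then show "f1 + f2 \<in> ?F \<and> (\<exists>g \<in> ?F. ?C (f1 + f2) g)"
    using g free_algebra_closed(5) by blast
qed

end

section \<open>The morphisms up to conjugation\<close>

definition conj_by :: "('a, 'm) ring_scheme \<Rightarrow> 'a \<Rightarrow> 'a \<Rightarrow> 'a" where
  "conj_by R u x = u \<otimes>\<^bsub>R\<^esub> x \<otimes>\<^bsub>R\<^esub> inv\<^bsub>R\<^esub> u"

context ring
begin

lemma conj_by_closed: "u \<in> Units R \<Longrightarrow> x \<in> carrier R \<Longrightarrow> conj_by R u x \<in> carrier R"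
  by (simp add: conj_by_def Units_closed)

lemma conj_by_eqI:
  "u \<in> Units R \<Longrightarrow> x \<in> carrier R \<Longrightarrow> y \<in> carrier R \<Longrightarrow> u \<otimes> x = y \<otimes> u \<Longrightarrow> conj_by R u x = y"
  by (simp add: conj_by_def m_assoc Units_closed)

lemma conj_by_cancel: "u \<in> Units R \<Longrightarrow> x \<in> carrier R \<Longrightarrow> inv u \<otimes> conj_by R u x \<otimes> u = x"
  by (simp add: conj_by_def m_assoc Units_closed) (simp add: m_assoc[symmetric] Units_closed)

lemma conj_by_inj: "u \<in> Units R \<Longrightarrow> inj_on (conj_by R u) (carrier R)"
  by (rule inj_on_inverseI[where g = "\<lambda>y. inv u \<otimes> y \<otimes> u"]) (rule conj_by_cancel)

lemma conj_by_hom: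
  assumes u: "u \<in> Units R" shows "conj_by R u \<in> ring_hom R R"
proof (rule ring_hom_memI)
  fix x y assume xy: "x \<in> carrier R" "y \<in> carrier R"
  have c: "u \<in> carrier R" "inv u \<in> carrier R" using u by auto
  have "conj_by R u x \<otimes> conj_by R u y = u \<otimes> x \<otimes> (inv u \<otimes> u) \<otimes> y \<otimes> inv u"
    using c xy by (simp only: conj_by_def m_assoc m_closed)
  then show "conj_by R u (x \<otimes> y) = conj_by R u x \<otimes> conj_by R u y"
    using u c xy by (simp add: conj_by_def m_assoc)
  show "conj_by R u (x \<oplus> y) = conj_by R u x \<oplus> conj_by R u y"
    using c xy by (simp add: conj_by_def l_distr r_distr)
qed (use u in \<open>auto simp: conj_by_def Units_closed\<close>)

lemma inv_conj_eq:
  assumes "u \<in> Units R" "x \<in> carrier R" "y \<in> carrier R" "u \<otimes> y = x \<otimes> u"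
  shows "conj_by R (inv u) x = y"
proof -
  have c: "u \<in> carrier R" "inv u \<in> carrier R" using assms(1) by auto
  have "conj_by R (inv u) x = inv u \<otimes> (x \<otimes> u)"
    using assms(1,2) c by (simp add: conj_by_def m_assoc)
  also have "\<dots> = (inv u \<otimes> u) \<otimes> y"
    unfolding assms(4)[symmetric] using assms(3) c by (simp only: m_assoc)
  finally show ?thesis using assms(1,3) by simp
qed

lemma conj_by_one: "x \<in> carrier R \<Longrightarrow> conj_by R \<one> x = x"
  by (simp add: conj_by_def)

end

lemma V_hom:
  assumes "h \<in> ring_hom R S" "ring R" "x \<in> carrier R" "y \<in> carrier R"
  shows "h (V R x y) = V S (h x) (h y)"
proof -
  interpret ring R by fact
  note hom = ring_hom_mult[OF assms(1)] ring_hom_add[OF assms(1)] ring_hom_one[OF assms(1)]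
  show ?thesis using assms(3,4) by (simp add: V_def hom)
qed

context TLD_alg
begin

definition T :: "node \<Rightarrow> (node, 'k) falg set" where
  "T a = cls (fgen a)"

lemma T_closed: "a \<in> nodes m \<Longrightarrow> T a \<in> carrier A"
  unfolding T_def by (intro cls_closed free_algebra_closed)

lemma T_comm:
  assumes "a \<in> nodes m" "b \<in> nodes m" "a \<noteq> b" "\<not> adjD m a b"
  shows "T a \<otimes>\<^bsub>A\<^esub> T b = T b \<otimes>\<^bsub>A\<^esub> T a"
proof -
  have "cls (fgen a * fgen b) = cls (fgen b * fgen a)"
    using comm_in_ideal[OF assms] assms by (subst cls_eq_iff) (auto intro!: free_algebra_closed)
  then show ?thesis using assms by (simp add: T_def cls_mult free_algebra_closed)
qed

lemma T_braid:
  assumes "a \<in> nodes m" "b \<in> nodes m" "adjD m a b"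
  shows "T a \<otimes>\<^bsub>A\<^esub> T b \<otimes>\<^bsub>A\<^esub> T a = T b \<otimes>\<^bsub>A\<^esub> T a \<otimes>\<^bsub>A\<^esub> T b"
proof -
  have "adjD m b a" using assms(3) by (rule D.adj_sym)
  then have "V (free_algebra UNIV) (fgen a) (fgen b) + - V (free_algebra UNIV) (fgen b) (fgen a) \<in> I"
    using assms by (intro I_add I_uminus V_in_ideal)
  then have "fgen a * fgen b * fgen a - fgen b * fgen a * fgen b \<in> I"
    by (simp add: braid_V[where S = UNIV])
  then have "cls (fgen a * fgen b * fgen a) = cls (fgen b * fgen a * fgen b)"
    using assms by (subst cls_eq_iff) (auto intro!: free_algebra_closed)
  then show ?thesis using assms by (simp add: T_def cls_mult free_algebra_closed)
qed

lemma T_V: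
  assumes "a \<in> nodes m" "b \<in> nodes m" "adjD m a b"
  shows "V A (T a) (T b) = \<zero>\<^bsub>A\<^esub>"
proof -
  have "V (free_algebra (nodes m)) (fgen a) (fgen b) - 0 \<in> I"
    using V_in_ideal[OF assms] by (simp add: V_free_algebra)
  then have "cls (V (free_algebra (nodes m)) (fgen a) (fgen b)) = cls 0"
    using assms by (subst cls_eq_iff) (auto simp: V_free_algebra intro!: free_algebra_closed)
  then show ?thesis
    using V_hom[OF cls_hom F.ring_axioms, of "fgen a" "fgen b"] assms
      ring_hom_zero[OF cls_hom F.ring_axioms A.ring_axioms]
    by (simp add: T_def free_algebra_closed)
qed

lemma T_quad:
  assumes "a \<in> nodes m"
  shows "T a \<otimes>\<^bsub>A\<^esub> T a = const (q - 1) \<otimes>\<^bsub>A\<^esub> T a \<oplus>\<^bsub>A\<^esub> const q"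
proof -
  have "cls (fgen a * fgen a) = cls (fconst (q - 1) * fgen a + fconst q)"
    using quad_in_ideal[OF assms] assms by (subst cls_eq_iff) (auto intro!: free_algebra_closed)
  then show ?thesis using assms by (simp add: T_def cls_mult cls_add free_algebra_closed)
qed

lemma fconst_rq: "fconst r * (fconst q * f) = f"
proof -
  have "fconst r * (fconst q * f) = fconst 1 * f"
    by (simp only: mult.assoc[symmetric] fconst_mult[symmetric] mult.commute[of r q] qr)
  then show ?thesis by simp
qed

text \<open>The quadratic relation reads T (T - (q - 1)) = q, and \<open>r\<close> is the inverse of
  \<open>q\<close>.\<close>

lemma T_unit:
  assumes "a \<in> nodes m"
  shows "T a \<in> Units A" "inv\<^bsub>A\<^esub> T a = cls (fconst r * (fgen a - fconst (q - 1)))"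
proof -
  let ?i = "fconst r * (fgen a - fconst (q - 1))"
  let ?q = "fgen a * fgen a - (fconst (q - 1) * fgen a + fconst q)"
  have i: "?i \<in> carrier (free_algebra (nodes m))" using assms by (auto intro!: free_algebra_closed)
  have "fconst r * ?q \<in> I"
    using I.I_l_closed[OF quad_in_ideal[OF assms], of "fconst r"] by (simp add: free_algebra_closed)
  moreover have "?i * fgen a - fconst 1 = fconst r * ?q"
    using fconst_rq[of "fconst 1"] by (simp add: algebra_simps)
  moreover have "fgen a * ?i - fconst 1 = fconst r * ?q"
    using fconst_rq[of "fconst 1"]
    by (simp add: algebra_simps fconst_left_commute[of "fgen a"] fconst_commute[of "fgen a"])
  ultimately have "cls (?i * fgen a) = cls (fconst 1)" "cls (fgen a * ?i) = cls (fconst 1)"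
    using assms by (subst cls_eq_iff; auto intro!: free_algebra_closed)+
  then have e: "cls ?i \<otimes>\<^bsub>A\<^esub> T a = \<one>\<^bsub>A\<^esub>" "T a \<otimes>\<^bsub>A\<^esub> cls ?i = \<one>\<^bsub>A\<^esub>"
    using assms cls_mult[OF i, of "fgen a"] cls_mult[OF _ i, of "fgen a"]
    by (simp_all add: T_def cls_one free_algebra_closed)
  show "T a \<in> Units A"
    using e T_closed[OF assms] cls_closed[OF i] by (auto simp: Units_def)
  show "inv\<^bsub>A\<^esub> T a = cls ?i"
    using e T_closed[OF assms] cls_closed[OF i] by (intro A.inv_char)
qed

end

section \<open>The subdivision homomorphism\<close>

locale TLD_tower = TLD_alg m q r for m and q r :: "'k::{comm_ring, monoid_mult}"
begin

sublocale up: TLD_alg "Suc m" q r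
  using m3 qr by unfold_locales auto

lemma nodes_up:
  "Sig 2 \<in> nodes (Suc m)" "Sig 3 \<in> nodes (Suc m)" "s \<in> nodes m \<Longrightarrow> shift s \<in> nodes (Suc m)"
proof -
  show "s \<in> nodes m \<Longrightarrow> shift s \<in> nodes (Suc m)"
    by (rule nodes_cases[of s m]) (auto simp: nodes_def)
qed (use m3 in \<open>auto simp: nodes_def\<close>)

text \<open>By the braid relation the image of \<open>Sig 2\<close> is also T_2 T_3 T_2^-1. The form
  T_3^-1 T_2 T_3 suits the left neighbours, which commute with T_3, and the other form suits the
  right neighbours, which commute with T_2.\<close>

definition \<psi> :: "node \<Rightarrow> (node, 'k) falg set" where
  "\<psi> s = (if s = Sig 2 then conj_by up.A (inv\<^bsub>up.A\<^esub> up.T (Sig 3)) (up.T (Sig 2)) else up.T (shift s))"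

lemma \<psi>_other: "s \<noteq> Sig 2 \<Longrightarrow> \<psi> s = up.T (shift s)"
  by (simp add: \<psi>_def)

lemma conj_T_comm:
  assumes "a \<in> nodes (Suc m)" "b \<in> nodes (Suc m)" "a \<noteq> b" "\<not> adjD (Suc m) a b"
  shows "conj_by up.A (up.T a) (up.T b) = up.T b"
  using assms by (intro up.A.conj_by_eqI up.T_unit up.T_closed up.T_comm)

lemma conj_T_adj:
  assumes "a \<in> nodes (Suc m)" "b \<in> nodes (Suc m)" "adjD (Suc m) a b"
  shows "conj_by up.A (up.T a) (conj_by up.A (up.T b) (up.T a)) = up.T b"
    and "conj_by up.A (inv\<^bsub>up.A\<^esub> up.T b) (up.T a) = conj_by up.A (up.T a) (up.T b)"
proof -
  let ?x = "up.T a" and ?y = "up.T b"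
  note u = up.T_unit(1)[OF assms(1)] up.T_unit(1)[OF assms(2)]
  have c: "?x \<in> carrier up.A" "?y \<in> carrier up.A" "inv\<^bsub>up.A\<^esub> ?x \<in> carrier up.A" "inv\<^bsub>up.A\<^esub> ?y \<in> carrier up.A"
    using assms up.T_closed u by auto
  have b: "?x \<otimes>\<^bsub>up.A\<^esub> (?y \<otimes>\<^bsub>up.A\<^esub> ?x) = ?y \<otimes>\<^bsub>up.A\<^esub> (?x \<otimes>\<^bsub>up.A\<^esub> ?y)"
    using up.T_braid[OF assms] c by (simp only: up.A.m_assoc)
  show "conj_by up.A ?x (conj_by up.A ?y ?x) = ?y"
  proof (rule up.A.conj_by_eqI[OF u(1) up.A.conj_by_closed[OF u(2) c(1)] c(2)])
    have "?x \<otimes>\<^bsub>up.A\<^esub> conj_by up.A ?y ?x = ?x \<otimes>\<^bsub>up.A\<^esub> (?y \<otimes>\<^bsub>up.A\<^esub> ?x) \<otimes>\<^bsub>up.A\<^esub> inv\<^bsub>up.A\<^esub> ?y"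
      using c by (simp only: conj_by_def up.A.m_assoc up.A.m_closed)
    also have "\<dots> = ?y \<otimes>\<^bsub>up.A\<^esub> ?x \<otimes>\<^bsub>up.A\<^esub> (?y \<otimes>\<^bsub>up.A\<^esub> inv\<^bsub>up.A\<^esub> ?y)"
      unfolding b using c by (simp only: up.A.m_assoc up.A.m_closed)
    finally show "?x \<otimes>\<^bsub>up.A\<^esub> conj_by up.A ?y ?x = ?y \<otimes>\<^bsub>up.A\<^esub> ?x" using c u by simp
  qed
  show "conj_by up.A (inv\<^bsub>up.A\<^esub> ?y) ?x = conj_by up.A ?x ?y"
  proof (rule up.A.inv_conj_eq[OF u(2) c(1) up.A.conj_by_closed[OF u(1) c(2)]])
    have "?y \<otimes>\<^bsub>up.A\<^esub> conj_by up.A ?x ?y = ?y \<otimes>\<^bsub>up.A\<^esub> (?x \<otimes>\<^bsub>up.A\<^esub> ?y) \<otimes>\<^bsub>up.A\<^esub> inv\<^bsub>up.A\<^esub> ?x"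
      using c by (simp only: conj_by_def up.A.m_assoc up.A.m_closed)
    also have "\<dots> = ?x \<otimes>\<^bsub>up.A\<^esub> ?y \<otimes>\<^bsub>up.A\<^esub> (?x \<otimes>\<^bsub>up.A\<^esub> inv\<^bsub>up.A\<^esub> ?x)"
      unfolding b[symmetric] using c by (simp only: up.A.m_assoc up.A.m_closed)
    finally show "?y \<otimes>\<^bsub>up.A\<^esub> conj_by up.A ?x ?y = ?x \<otimes>\<^bsub>up.A\<^esub> ?y" using c u by simp
  qed
qed

text \<open>Every defining relation involves at most two generators. As any two images are
  conjugate, by one common unit, to generators with the same adjacency, each relation is inherited
  from the larger algebra. The unit depends on the pair: T_2 for \<open>Sig 2\<close> with a right
  neighbour, T_3^-1 for \<open>Sig 2\<close> with any other node, and 1 for pairs without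
  \<open>Sig 2\<close>.\<close>

lemma \<psi>_conj:
  assumes "a \<in> nodes m" "b \<in> nodes m" "a \<noteq> b"
  obtains u x y where "u \<in> Units up.A" "x \<in> nodes (Suc m)" "y \<in> nodes (Suc m)" "x \<noteq> y"
    "adjD (Suc m) x y = adjD m a b" "\<psi> a = conj_by up.A u (up.T x)" "\<psi> b = conj_by up.A u (up.T y)"
proof -
  have one: "\<exists>u x y. u \<in> Units up.A \<and> x \<in> nodes (Suc m) \<and> y \<in> nodes (Suc m) \<and> x \<noteq> y \<and>
      adjD (Suc m) x y = adjD m (Sig 2) b \<and> \<psi> (Sig 2) = conj_by up.A u (up.T x) \<and> \<psi> b = conj_by up.A u (up.T y)"
    if b: "b \<in> nodes m" "b \<noteq> Sig 2" for b
  proof -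
    note n = nodes_up(1,2) nodes_up(3)[OF b(1)]
    note s = adjD_shift_split[OF m3 b]
    have u3: "inv\<^bsub>up.A\<^esub> up.T (Sig 3) \<in> Units up.A" using up.T_unit(1)[OF n(2)] by simp
    show ?thesis
    proof (cases "adjD m b (Sig 2) \<and> b \<noteq> Sig 1 \<and> b \<noteq> Sigbar 1")
      case True
      have "conj_by up.A (up.T (Sig 2)) (up.T (shift b)) = up.T (shift b)"
        using n s True shift_neq[OF b(2)] D.adj_sym[of "Suc m" "Sig 2" "shift b"]
        by (intro conj_T_comm) auto
      moreover have "\<psi> (Sig 2) = conj_by up.A (up.T (Sig 2)) (up.T (Sig 3))"
        using conj_T_adj(2)[OF n(1,2)] by (simp add: \<psi>_def)
      moreover have "adjD (Suc m) (Sig 3) (shift b)" "adjD m (Sig 2) b" using s True D.adj_sym by blast+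
      ultimately show ?thesis
        using n shift_neq[OF b(2)] up.T_unit(1)[OF n(1)] \<psi>_other[OF b(2)]
        by (intro exI[of _ "up.T (Sig 2)"] exI[of _ "Sig 3"] exI[of _ "shift b"]) auto
    next
      case False
      have "conj_by up.A (inv\<^bsub>up.A\<^esub> up.T (Sig 3)) (up.T (shift b)) = up.T (shift b)"
      proof (rule up.A.inv_conj_eq[OF up.T_unit(1)[OF n(2)] up.T_closed[OF n(3)] up.T_closed[OF n(3)]])
        show "up.T (Sig 3) \<otimes>\<^bsub>up.A\<^esub> up.T (shift b) = up.T (shift b) \<otimes>\<^bsub>up.A\<^esub> up.T (Sig 3)"
          using n s False shift_neq[OF b(2)] D.adj_sym[of "Suc m" "Sig 3" "shift b"]
          by (intro up.T_comm) auto
      qed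
      moreover have "adjD (Suc m) (Sig 2) (shift b) = adjD m (Sig 2) b"
        using s False D.adj_sym[of m b "Sig 2"] D.adj_sym[of m "Sig 2" b] D.adj_sym[of "Suc m"] by auto
      moreover have "\<psi> (Sig 2) = conj_by up.A (inv\<^bsub>up.A\<^esub> up.T (Sig 3)) (up.T (Sig 2))" by (simp add: \<psi>_def)
      ultimately show ?thesis
        using n shift_neq[OF b(2)] u3 \<psi>_other[OF b(2)]
        by (intro exI[of _ "inv\<^bsub>up.A\<^esub> up.T (Sig 3)"] exI[of _ "Sig 2"] exI[of _ "shift b"]) auto
    qed
  qed
  consider "a = Sig 2" | "b = Sig 2" | "a \<noteq> Sig 2" "b \<noteq> Sig 2" by blast
  then show ?thesis
  proof cases
    case 1
    then show ?thesis using one[of b] assms that by metis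
  next
    case 2
    then obtain u x y where "u \<in> Units up.A" "x \<in> nodes (Suc m)" "y \<in> nodes (Suc m)" "x \<noteq> y"
      "adjD (Suc m) x y = adjD m b a" "\<psi> b = conj_by up.A u (up.T x)" "\<psi> a = conj_by up.A u (up.T y)"
      using one[of a] assms by metis
    then show ?thesis using that[of u y x] D.adj_sym by blast
  next
    case 3
    have "shift a \<noteq> shift b" using assms inj_onD[OF shift_inj_on[of m], of a b] m3 by auto
    then show ?thesis
      using 3 that[of "\<one>\<^bsub>up.A\<^esub>" "shift a" "shift b"] assms adjD_shift[OF m3 assms(1,2)]
      by (simp add: nodes_up \<psi>_other up.A.conj_by_one up.T_closed)
  qed
qed

lemma \<psi>_closed: "s \<in> nodes m \<Longrightarrow> \<psi> s \<in> carrier up.A"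
  using nodes_up up.T_closed up.T_unit(1) up.A.conj_by_closed by (simp add: \<psi>_def)

sublocale \<psi>: falg_target up.A up.const \<psi> "nodes m"
  by (rule up.falg_target_A) (rule \<psi>_closed)

abbreviation "ev\<psi> \<equiv> falg_eval up.A up.const \<psi>"

lemma conj_const: "u \<in> Units up.A \<Longrightarrow> conj_by up.A u (up.const c) = up.const c"
  by (intro up.A.conj_by_eqI up.const_closed up.const_commute_A[symmetric] up.A.Units_closed)

lemma ev\<psi>_rel:
  assumes lr: "(l, r') \<in> TLD_rels m q"
  shows "ev\<psi> l = ev\<psi> r'"
  using lr m3
proof (cases rule: TLD_rels_cases)
  case (comm a b)
  obtain u x y where u: "u \<in> Units up.A" "x \<in> nodes (Suc m)" "y \<in> nodes (Suc m)" "x \<noteq> y"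
    "adjD (Suc m) x y = adjD m a b" "\<psi> a = conj_by up.A u (up.T x)" "\<psi> b = conj_by up.A u (up.T y)"
    by (rule \<psi>_conj[OF comm(1-3)])
  have "\<psi> a \<otimes>\<^bsub>up.A\<^esub> \<psi> b = \<psi> b \<otimes>\<^bsub>up.A\<^esub> \<psi> a"
    using up.T_comm[OF u(2-4)] u(5-7) comm(4) ring_hom_mult[OF up.A.conj_by_hom[OF u(1)]] u(2,3)
    by (metis up.T_closed)
  then show ?thesis
    using comm by (simp add: comm_rel_def \<psi>.eval_mult \<psi>.eval_gen free_algebra_closed)
next
  case (braid a b)
  have ab: "a \<in> nodes m" "b \<in> nodes m" "a \<noteq> b" "adjD m a b"
    using edges_nodes[OF m3 braid(1)] D.adj_irrefl by auto
  obtain u x y where u: "u \<in> Units up.A" "x \<in> nodes (Suc m)" "y \<in> nodes (Suc m)" "x \<noteq> y"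
    "adjD (Suc m) x y = adjD m a b" "\<psi> a = conj_by up.A u (up.T x)" "\<psi> b = conj_by up.A u (up.T y)"
    by (rule \<psi>_conj[OF ab(1-3)])
  have "\<psi> a \<otimes>\<^bsub>up.A\<^esub> \<psi> b \<otimes>\<^bsub>up.A\<^esub> \<psi> a = \<psi> b \<otimes>\<^bsub>up.A\<^esub> \<psi> a \<otimes>\<^bsub>up.A\<^esub> \<psi> b"
    using up.T_braid[OF u(2,3)] u(5-7) ab(4) ring_hom_mult[OF up.A.conj_by_hom[OF u(1)]] u(2,3)
    by (metis up.T_closed up.A.m_closed)
  then show ?thesis
    using braid ab by (simp add: braid_rel_def \<psi>.eval_mult \<psi>.eval_gen free_algebra_closed)
next
  case (V a b)
  have ab: "a \<in> nodes m" "b \<in> nodes m" "a \<noteq> b" "adjD m a b"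
    using edges_nodes[OF m3 V(1)] D.adj_irrefl by auto
  obtain u x y where u: "u \<in> Units up.A" "x \<in> nodes (Suc m)" "y \<in> nodes (Suc m)" "x \<noteq> y"
    "adjD (Suc m) x y = adjD m a b" "\<psi> a = conj_by up.A u (up.T x)" "\<psi> b = conj_by up.A u (up.T y)"
    by (rule \<psi>_conj[OF ab(1-3)])
  have "ev\<psi> (V (free_algebra (nodes m)) (fgen a) (fgen b)) = V up.A (\<psi> a) (\<psi> b)"
    using V_hom[OF \<psi>.eval_hom ring_free_algebra, of "fgen a" "fgen b"] ab
    by (simp add: \<psi>.eval_gen free_algebra_closed)
  also have "\<dots> = conj_by up.A u (V up.A (up.T x) (up.T y))"
    using V_hom[OF up.A.conj_by_hom[OF u(1)] up.A.ring_axioms] u up.T_closed by metis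
  also have "\<dots> = conj_by up.A u \<zero>\<^bsub>up.A\<^esub>"
    using up.T_V[OF u(2,3)] u(5) ab(4) by simp
  also have "\<dots> = \<zero>\<^bsub>up.A\<^esub>"
    using ring_hom_zero[OF up.A.conj_by_hom[OF u(1)] up.A.ring_axioms up.A.ring_axioms] .
  also have "\<dots> = ev\<psi> 0"
    using ring_hom_zero[OF \<psi>.eval_hom ring_free_algebra up.A.ring_axioms] by simp
  finally show ?thesis using V by (simp add: V_rel_def V_free_algebra)
next
  case (quad a)
  \<comment> \<open>The quadratic relation has one generator, but \<open>\<psi>_conj\<close> takes a
    pair; any other node serves as the partner.\<close>
  have "\<exists>b. b \<in> nodes m \<and> a \<noteq> b" using m3 by (intro exI[of _ "if a = Sig 1 then Sig 2 else Sig 1"]) (auto simp: nodes_def)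
  then obtain b where b: "b \<in> nodes m" "a \<noteq> b" by blast
  obtain u x y where u: "u \<in> Units up.A" "x \<in> nodes (Suc m)" "y \<in> nodes (Suc m)" "x \<noteq> y"
    "adjD (Suc m) x y = adjD m a b" "\<psi> a = conj_by up.A u (up.T x)" "\<psi> b = conj_by up.A u (up.T y)"
    by (rule \<psi>_conj[OF quad(1) b])
  note hom = ring_hom_mult[OF up.A.conj_by_hom[OF u(1)]] ring_hom_add[OF up.A.conj_by_hom[OF u(1)]]
  have "\<psi> a \<otimes>\<^bsub>up.A\<^esub> \<psi> a = conj_by up.A u (up.T x \<otimes>\<^bsub>up.A\<^esub> up.T x)"
    using u up.T_closed hom by simp
  also have "\<dots> = up.const (q - 1) \<otimes>\<^bsub>up.A\<^esub> \<psi> a \<oplus>\<^bsub>up.A\<^esub> up.const q"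
    unfolding up.T_quad[OF u(2)] using u up.T_closed up.const_closed hom conj_const by simp
  finally show ?thesis
    using quad by (simp add: quad_rel_def \<psi>.eval_mult \<psi>.eval_add \<psi>.eval_gen \<psi>.eval_const free_algebra_closed)
qed

lemma ev\<psi>_cls:
  "f \<in> carrier (free_algebra (nodes m)) \<Longrightarrow> g \<in> carrier (free_algebra (nodes m)) \<Longrightarrow> cls f = cls g \<Longrightarrow> ev\<psi> f = ev\<psi> g"
  by (rule hom_factors[OF \<psi>.eval_hom up.A.ring_axioms ev\<psi>_rel])

text \<open>Source and target of \<open>split_b\<close> are both read in the generators \<open>T + 1\<close>.\<close>

definition split_b :: "node \<Rightarrow> (node, 'k) falg" where
  "split_b s = (if s = Sig 2
     then mon [Sig 2] + mon [Sig 3] - mon [Sig 2, Sig 3] - fconst r * mon [Sig 3, Sig 2]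
     else mon [shift s])"

lemma split_b_closed: "s \<in> nodes m \<Longrightarrow> split_b s \<in> carrier (free_algebra (nodes (Suc m)))"
  using nodes_up by (auto simp: split_b_def intro!: free_algebra_closed)

text \<open>Since q r = 1, the inverse of T_3 is r b_3 - 1. Expanding (r b_3 - 1)(b_2 - 1)(b_3 - 1)
  + 1 gives \<open>split_b\<close> plus r (b_3 b_2 b_3 - b_3 b_3 + b_3), and the bracket is V(T_3,
  T_2).\<close>

lemma ev\<psi>_to_T_gen:
  assumes s: "s \<in> nodes m"
  shows "ev\<psi> (to_T (fgen s)) = up.cls (to_T (split_b s))"
proof (cases "s = Sig 2")
  case False
  then show ?thesis
    using s nodes_up(3)[OF s]
    by (simp add: \<psi>.eval_add \<psi>.eval_gen \<psi>.eval_const free_algebra_closed split_b_def mon_single \<psi>_other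
        up.cls_add up.T_def)
next
  case True
  let ?x = "fgen (Sig 2)" and ?y = "fgen (Sig 3)"
  let ?i = "fconst r * (?y - fconst (q - 1))"
  have i: "?i \<in> carrier (free_algebra (nodes (Suc m)))" using nodes_up by (auto intro!: free_algebra_closed)
  have u: "up.T (Sig 3) \<in> Units up.A" "inv\<^bsub>up.A\<^esub> up.T (Sig 3) = up.cls ?i" using up.T_unit nodes_up by auto
  have "adjD (Suc m) (Sig 3) (Sig 2)" by simp
  then have "fconst r * V (free_algebra UNIV) ?y ?x \<in> up.I"
    using up.I.I_l_closed[OF up.V_in_ideal[of "Sig 3" "Sig 2"], of "fconst r"] nodes_up
    by (simp add: free_algebra_closed)
  moreover have "(?i * ?x * ?y + fconst 1) - to_T (split_b (Sig 2)) = fconst r * V (free_algebra UNIV) ?y ?x"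
    by (simp add: V_free_algebra split_b_def mon_Cons mon_Nil fconst_diff algebra_simps fconst_rq)
  ultimately have "up.cls (?i * ?x * ?y + fconst 1) = up.cls (to_T (split_b (Sig 2)))"
    using nodes_up i split_b_closed[OF s] True
    by (subst up.cls_eq_iff) (auto intro!: free_algebra_closed to_T_closed)
  moreover have "up.cls (?i * ?x * ?y + fconst 1) = \<psi> (Sig 2) \<oplus>\<^bsub>up.A\<^esub> \<one>\<^bsub>up.A\<^esub>"
  proof -
    have "\<psi> (Sig 2) = up.cls ?i \<otimes>\<^bsub>up.A\<^esub> up.T (Sig 2) \<otimes>\<^bsub>up.A\<^esub> up.T (Sig 3)"
      using up.A.Units_inv_inv[OF u(1)] unfolding \<psi>_def conj_by_def u(2) by simp
    then show ?thesis
      using nodes_up i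
      by (simp only: up.cls_add up.cls_mult up.cls_one free_algebra_closed up.T_def)
  qed
  ultimately show ?thesis
    using True s by (simp add: \<psi>.eval_add \<psi>.eval_gen \<psi>.eval_const free_algebra_closed up.cls_one)
qed

lemma ev\<psi>_to_T:
  assumes "f \<in> carrier (free_algebra (nodes m))"
  shows "ev\<psi> (to_T f) = up.cls (to_T (subst split_b f))"
proof -
  have T: "to_T \<in> ring_hom (free_algebra S) (free_algebra S)" for S :: "node set"
    unfolding to_T_def by (rule subst_hom) (auto intro!: free_algebra_closed)
  have "ev\<psi> \<circ> to_T \<in> ring_hom (free_algebra (nodes m)) up.A"
    by (rule ring_hom_trans[OF T \<psi>.eval_hom])
  moreover have "up.cls \<circ> (to_T \<circ> subst split_b) \<in> ring_hom (free_algebra (nodes m)) up.A"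
    by (rule ring_hom_trans[OF ring_hom_trans[OF subst_hom[OF split_b_closed] T] up.cls_hom])
  ultimately show ?thesis
    using falg_hom_eq[of "ev\<psi> \<circ> to_T" "nodes m" up.A "up.cls \<circ> (to_T \<circ> subst split_b)" f] assms
    by (simp add: ev\<psi>_to_T_gen \<psi>.eval_const del: to_T_simps(4))
qed

section \<open>Leading terms\<close>

primrec lead_unit :: "bool list \<Rightarrow> node list \<Rightarrow> 'k" where
  "lead_unit t [] = 1"
| "lead_unit t (z # w) =
     (if z = Sig 2 then (if hd t then - 1 else - r) * lead_unit (tl t) w else lead_unit t w)"

lemma lead_unit_invertible: "\<exists>k. lead_unit t w * k = 1"
proof (induction w arbitrary: t)
  case Nil
  then show ?case by (auto intro: exI[of _ 1])
next
  case (Cons z w)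
  have "\<exists>k. (if hd t then - 1 else - r) * k = 1"
    using qr by (auto intro: exI[of _ "- 1"] exI[of _ "- q"] simp: mult.commute)
  then obtain k where k: "(if hd t then - 1 else - r) * k = 1" by blast
  obtain l where l: "lead_unit (tl t) w * l = 1" using Cons.IH by blast
  have "((if hd t then - 1 else - r) * lead_unit (tl t) w) * (l * k) =
      (if hd t then - 1 else - r) * (lead_unit (tl t) w * l) * k"
    by (simp only: mult.assoc)
  also have "\<dots> = 1" unfolding l using k by simp
  finally show ?case using Cons.IH[of t] by auto
qed

text \<open>In the expanded product a term that takes a single letter at some \<open>Sig 2\<close>
  is too short for \<open>F\<close>. The remaining terms are lifts, of which \<open>F\<close> sees
  only the one given by \<open>t\<close>, with the product of the coefficients -1 and -r from
  \<open>split_b\<close>. The prefix \<open>p\<close> carries the part already expanded.\<close>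

lemma lin_split_b:
  assumes "\<forall>v. length v < length w + count_list w (Sig 2) \<longrightarrow> F (p @ v) = 0"
    and "\<forall>t'. lift_word t' w \<noteq> lift_word t w \<longrightarrow> F (p @ lift_word t' w) = 0"
  shows "lin F (mon p * subst split_b (mon w)) = lead_unit t w * F (p @ lift_word t w)"
  using assms
proof (induction w arbitrary: p t)
  case Nil
  then show ?case by (simp add: mon_append)
next
  case (Cons z w)
  note short = Cons.prems(1) and other = Cons.prems(2)
  let ?S = "subst split_b (mon w)"
  show ?case
  proof (cases "z = Sig 2")
    case False
    have "lin F (mon (p @ [shift z]) * ?S) = lead_unit t w * F ((p @ [shift z]) @ lift_word t w)"
    proof (rule Cons.IH)
      show "\<forall>v. length v < length w + count_list w (Sig 2) \<longrightarrow> F ((p @ [shift z]) @ v) = 0"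
        using short False by simp
      show "\<forall>t'. lift_word t' w \<noteq> lift_word t w \<longrightarrow> F ((p @ [shift z]) @ lift_word t' w) = 0"
        using other False by simp
    qed
    moreover have "split_b z = mon [shift z]" using False by (simp add: split_b_def)
    ultimately show ?thesis
      using False by (simp add: subst_mon_Cons mon_append[symmetric] mult.assoc)
  next
    case True
    let ?N = "length w + count_list w (Sig 2)"
    have 0: "F (p @ v) = 0" if "length v \<le> Suc ?N" for v
      using short that True by simp
    \<comment> \<open>A lift of \<open>w\<close> has length \<open>?N\<close>; with one letter in
      front it stays one short of \<open>?N + 2\<close>, the least length at which \<open>F\<close>
      may be nonzero.\<close>
    have 1: "lin F (mon (p @ [s]) * ?S) = 0" for s
      using Cons.IH[of "p @ [s]" t] 0 by (simp add: length_lift_word)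
    have lw: "lift_word (b # t') (z # w) = (if b then [Sig 2, Sig 3] else [Sig 3, Sig 2]) @ lift_word t' w" for b t'
      using True by simp
    have 2: "lin F (mon (p @ [Sig 2, Sig 3]) * ?S) =
        lead_unit (tl t) w * F ((p @ [Sig 2, Sig 3]) @ lift_word (tl t) w)"
    proof (rule Cons.IH)
      show "\<forall>v. length v < ?N \<longrightarrow> F ((p @ [Sig 2, Sig 3]) @ v) = 0" using 0 by simp
      show "\<forall>t'. lift_word t' w \<noteq> lift_word (tl t) w \<longrightarrow> F ((p @ [Sig 2, Sig 3]) @ lift_word t' w) = 0"
        using other[rule_format, of "True # _"] True by (cases "hd t") auto
    qed
    have 3: "lin F (mon (p @ [Sig 3, Sig 2]) * ?S) =
        lead_unit (tl t) w * F ((p @ [Sig 3, Sig 2]) @ lift_word (tl t) w)"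
    proof (rule Cons.IH)
      show "\<forall>v. length v < ?N \<longrightarrow> F ((p @ [Sig 3, Sig 2]) @ v) = 0" using 0 by simp
      show "\<forall>t'. lift_word t' w \<noteq> lift_word (tl t) w \<longrightarrow> F ((p @ [Sig 3, Sig 2]) @ lift_word t' w) = 0"
        using other[rule_format, of "False # _"] True by (cases "hd t") auto
    qed
    have wrong: "F (p @ lift_word ((\<not> hd t) # tl t) (z # w)) = 0"
      using other[rule_format, of "(\<not> hd t) # tl t"] True by (cases "hd t") auto
    have "split_b z = mon [Sig 2] + mon [Sig 3] - mon [Sig 2, Sig 3] - fconst r * mon [Sig 3, Sig 2]"
      using True by (simp add: split_b_def)
    then have "mon p * subst split_b (mon (z # w)) =
        mon (p @ [Sig 2]) * ?S + mon (p @ [Sig 3]) * ?S - mon (p @ [Sig 2, Sig 3]) * ?S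
        - fconst r * (mon (p @ [Sig 3, Sig 2]) * ?S)"
      by (simp add: subst_mon_Cons mon_append[symmetric] mult.assoc distrib_left distrib_right
          left_diff_distrib right_diff_distrib fconst_left_commute[of "mon p"])
    then have "lin F (mon p * subst split_b (mon (z # w))) =
        - (lead_unit (tl t) w * F (p @ [Sig 2, Sig 3] @ lift_word (tl t) w))
        - r * (lead_unit (tl t) w * F (p @ [Sig 3, Sig 2] @ lift_word (tl t) w))"
      using 1 2 3 by (simp add: lin_add lin_diff lin_fconst_mult)
    then show ?thesis
      using True wrong by (cases "hd t") (simp_all add: mult.assoc)
  qed
qed

end

lemma lin_subst: "lin F (subst \<phi> f) = lin (\<lambda>w. lin F (subst \<phi> (mon w))) f"
  by (induction f rule: falg_induct_UNIV) (simp_all add: lin_add lin_fconst_mult)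

section \<open>Injectivity of the subdivision map\<close>

context TLD_tower
begin

text \<open>Among the canonical reduced words of a kernel element, take one with the longest lifts
  and a reduced lift \<open>h\<close> of it. Shorter terms do not reach \<open>h\<close>, and a lift
  equivalent to \<open>h\<close> comes from the same word with the same orders. The coefficient of
  \<open>h\<close> in the image is thus the coefficient of that word times a unit.\<close>

lemma ev\<psi>_injective:
  assumes f: "f \<in> carrier (free_algebra (nodes m))" and 0: "ev\<psi> f = ev\<psi> 0"
  shows "cls f = cls 0"
proof -
  let ?F = "carrier (free_algebra (nodes m))"
  obtain g where g: "g \<in> ?F" "cls (to_T (to_b f)) = cls (to_T g)"
    "\<forall>w \<in> Poly_Mapping.keys g. D.FC m (letters w) \<and> D.canon m (letters w) = letters w"
    using FC_spanning[OF to_b_closed[OF f]] by blast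
  have z: "0 \<in> ?F" by (rule free_algebra_closed)
  have "up.cls (to_T (subst split_b g)) = up.cls (to_T (subst split_b 0))"
    using ev\<psi>_to_T[OF g(1)] ev\<psi>_to_T[OF z] ev\<psi>_cls[OF f to_T_closed[OF g(1)]] g(2) 0 by simp
  then have "to_T (subst split_b g) - to_T 0 \<in> up.I"
    using subst_closed[OF split_b_closed g(1)] free_algebra_closed(1)
    by (subst (asm) up.cls_eq_iff) (auto intro: to_T_closed)
  then have van: "lin (D.nf_coeff (Suc m) q h) (subst split_b g) = 0" for h
    using up.nf_coeff_vanishes[of "to_T (subst split_b g)" h] by simp
  have "Poly_Mapping.keys g = {}"
  proof (rule ccontr)
    \<comment> \<open>Words are compared by their length after subdivision, where every
      \<open>Sig 2\<close> counts twice.\<close>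
    define N where "N = (\<lambda>w :: node word. length (letters w) + count_list (letters w) (Sig 2))"
    assume "Poly_Mapping.keys g \<noteq> {}"
    then have "Max (N ` Poly_Mapping.keys g) \<in> N ` Poly_Mapping.keys g" by (intro Max_in) auto
    then obtain w where w: "w \<in> Poly_Mapping.keys g" "N w = Max (N ` Poly_Mapping.keys g)" by auto
    have le: "N v \<le> N w" if "v \<in> Poly_Mapping.keys g" for v
      unfolding w(2) using that by (intro Max_ge) auto
    have nodes: "set (letters v) \<subseteq> nodes m" if "v \<in> Poly_Mapping.keys g" for v
      using g(1) that by (simp add: carrier_free_algebra)
    obtain t where t: "D.FC (Suc m) (lift_word t (letters w))"
      using ex_FC_lift[OF m3 nodes[OF w(1)]] g(3) w(1) by blast
    define h where "h = lift_word t (letters w)"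
    define E where "E = (\<lambda>v. lin (D.nf_coeff (Suc m) q h) (subst split_b (mon v)))"
    have len: "length (lift_word t' (letters v)) = N v" for t' v
      by (simp add: length_lift_word N_def)
    have short: "D.nf_coeff (Suc m) q h v = 0" if "length v < N w" for v
      using that len[of t w] D.teq_length[of "Suc m" v h]
      by (intro D.nf_coeff_eq_0) (auto simp: h_def)
    have E: "E (letters v) = lead_unit t (letters v) * D.nf_coeff (Suc m) q h (lift_word t (letters v))"
      if v: "v \<in> Poly_Mapping.keys g"
        and o: "\<And>t'. lift_word t' (letters v) \<noteq> lift_word t (letters v) \<Longrightarrow>
          D.nf_coeff (Suc m) q h (lift_word t' (letters v)) = 0" for v
      using lin_split_b[of "letters v" "D.nf_coeff (Suc m) q h" "[]" t] short le[OF v] o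
      by (simp add: E_def mon_Nil N_def)
    have zero: "D.nf_coeff (Suc m) q h (lift_word t' (letters v)) = 0"
      if v: "v \<in> Poly_Mapping.keys g" "v \<noteq> w" for t' v
    proof (rule D.nf_coeff_eq_0)
      show "length (lift_word t' (letters v)) \<le> length h"
        using le[OF v(1)] len unfolding h_def by simp
      show "\<not> D.teq (Suc m) (lift_word t' (letters v)) h"
      proof
        assume "D.teq (Suc m) (lift_word t' (letters v)) h"
        then have "D.teq m (letters v) (letters w)"
          unfolding h_def by (rule lift_word_teq[OF m3 nodes[OF v(1)] nodes[OF w(1)]])
        then have "letters v = letters w"
          using D.canon_eq g(3) v(1) w(1) by metis
        then show False using v(2) by (simp add: word.expand)
      qed
    qed
    have Ew: "E (letters w) = lead_unit t (letters w)"
    proof -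
      have "D.nf_coeff (Suc m) q h (lift_word t' (letters w)) = 0"
        if "lift_word t' (letters w) \<noteq> lift_word t (letters w)" for t'
      proof (rule D.nf_coeff_eq_0)
        show "length (lift_word t' (letters w)) \<le> length h" using len unfolding h_def by simp
        show "\<not> D.teq (Suc m) (lift_word t' (letters w)) h"
          using lift_word_types[of m t' "letters w" t] that unfolding h_def by blast
      qed
      from E[OF w(1) this] show ?thesis
        using D.nf_coeff_self[OF t, of q] by (simp add: h_def)
    qed
    have "lin E g = 0"
      using van[of h] lin_subst[of "D.nf_coeff (Suc m) q h" split_b g] by (simp add: E_def)
    then have "0 = (\<Sum>v \<in> Poly_Mapping.keys g. Poly_Mapping.lookup g v * E (letters v))"
      by (simp add: lin_def)
    also have "\<dots> = (\<Sum>v \<in> {w}. Poly_Mapping.lookup g v * E (letters v))"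
      by (rule sum.mono_neutral_right) (use w(1) E zero in auto)
    finally have "Poly_Mapping.lookup g w * lead_unit t (letters w) = 0" using Ew by simp
    \<comment> \<open>Cancellation uses an explicit inverse because the coefficient ring may have
      zero divisors.\<close>
    moreover obtain k where "lead_unit t (letters w) * k = 1" using lead_unit_invertible by blast
    ultimately have "Poly_Mapping.lookup g w * 1 = 0" by (metis mult.assoc mult_zero_left)
    then show False using w(1) by (simp add: in_keys_iff)
  qed
  then have "g = 0" by simp
  then show ?thesis using g(2) by simp
qed

section \<open>From the subdivision map back to the maps of the tower\<close>

definition conjs :: "nat \<Rightarrow> (node, 'k) falg set \<Rightarrow> (node, 'k) falg set" where
  "conjs j = foldr (\<lambda>k f. f \<circ> conj_by up.A (up.T (Sig k))) [j..<Suc (Suc m)] id"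

text \<open>The generator of smallest index acts first, so \<open>conjs j\<close> is conjugation by
  T_(m+1) ... T_j.\<close>

lemma conjs_step: "j \<le> Suc m \<Longrightarrow> conjs j x = conjs (Suc j) (conj_by up.A (up.T (Sig j)) x)"
  by (simp add: conjs_def upt_conv_Cons del: upt_Suc)

lemma Sig_node: "1 \<le> j \<Longrightarrow> j \<le> Suc m \<Longrightarrow> Sig j \<in> nodes (Suc m)"
  by (simp add: nodes_def)

lemma conjs_hom_inj:
  assumes "j \<le> Suc (Suc m)" "1 \<le> j"
  shows "conjs j \<in> ring_hom up.A up.A \<and> inj_on (conjs j) (carrier up.A)"
  using assms
proof (induction j rule: inc_induct)
  case base
  then show ?case using id_ring_hom[of up.A] by (simp add: conjs_def id_def)
next
  case (step j)
  have u: "up.T (Sig j) \<in> Units up.A" using step by (intro up.T_unit Sig_node) auto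
  have e: "conjs j = conjs (Suc j) \<circ> conj_by up.A (up.T (Sig j))"
    using conjs_step[of j] step by auto
  have IH: "conjs (Suc j) \<in> ring_hom up.A up.A" "inj_on (conjs (Suc j)) (carrier up.A)"
    using step by auto
  have "conj_by up.A (up.T (Sig j)) ` carrier up.A \<subseteq> carrier up.A"
    using up.A.conj_by_closed[OF u] by blast
  then have "inj_on (conjs (Suc j) \<circ> conj_by up.A (up.T (Sig j))) (carrier up.A)"
    by (rule comp_inj_on[OF up.A.conj_by_inj[OF u] inj_on_subset[OF IH(2)]])
  then show ?case
    unfolding e using ring_hom_trans[OF up.A.conj_by_hom[OF u] IH(1)] by blast
qed

lemma conjs_fix:
  assumes "j \<le> Suc (Suc m)" "\<And>i. j \<le> i \<Longrightarrow> i \<le> Suc m \<Longrightarrow> conj_by up.A (up.T (Sig i)) x = x"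
  shows "conjs j x = x"
  using assms
proof (induction j rule: inc_induct)
  case base
  then show ?case by (simp add: conjs_def)
next
  case (step j)
  then show ?case using conjs_step[of j x] by simp
qed

lemma conjs_fix_T:
  assumes "j \<le> Suc (Suc m)" "1 \<le> j" "b \<in> nodes (Suc m)"
    "\<And>i. j \<le> i \<Longrightarrow> i \<le> Suc m \<Longrightarrow> Sig i \<noteq> b \<and> \<not> adjD (Suc m) (Sig i) b"
  shows "conjs j (up.T b) = up.T b"
  using assms by (intro conjs_fix conj_T_comm Sig_node) auto

text \<open>The generators of index below \<open>i\<close> commute with T_(i+1), conjugation by T_i
  and then by T_(i+1) turns it into T_i by the braid relation, and the later generators commute with
  T_i.\<close>

lemma conjs_shift:
  assumes "j \<le> i" "i \<le> m" "1 \<le> j"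
  shows "conjs j (up.T (Sig (Suc i))) = up.T (Sig i)"
  using assms
proof (induction j rule: inc_induct)
  case base
  have "conj_by up.A (up.T (Sig (Suc i))) (conj_by up.A (up.T (Sig i)) (up.T (Sig (Suc i)))) = up.T (Sig i)"
    using base by (intro conj_T_adj Sig_node) auto
  moreover have "conjs (Suc (Suc i)) (up.T (Sig i)) = up.T (Sig i)"
    using base by (intro conjs_fix_T Sig_node) auto
  ultimately show ?case using base conjs_step[of i] conjs_step[of "Suc i"] by simp
next
  case (step j)
  have "conj_by up.A (up.T (Sig j)) (up.T (Sig (Suc i))) = up.T (Sig (Suc i))"
    using step by (intro conj_T_comm Sig_node) auto
  then show ?case using step conjs_step[of j] by simp
qed

text \<open>\<open>Sigbar (Suc m)\<close> is adjacent to \<open>Sig m\<close> only, so the earlier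
  conjugations act trivially; the two that remain give the product in \<open>P_gen\<close>.\<close>

lemma conjs_bar:
  assumes "j \<le> m" "1 \<le> j"
  shows "conjs j (up.T (Sigbar (Suc m))) =
    conj_by up.A (up.T (Sig (Suc m))) (conj_by up.A (up.T (Sig m)) (up.T (Sigbar (Suc m))))"
  using assms
proof (induction j rule: inc_induct)
  case base
  then show ?case using conjs_step[of m] conjs_step[of "Suc m"] by (simp add: conjs_def)
next
  case (step j)
  have "conj_by up.A (up.T (Sig j)) (up.T (Sigbar (Suc m))) = up.T (Sigbar (Suc m))"
    using step m3 by (intro conj_T_comm Sig_node) (auto simp: nodes_def)
  then show ?case using step conjs_step[of j] by simp
qed

lemma TLD_up: "TLD (Suc (Suc m)) q = up.A" "TLD_T (Suc (Suc m)) q = up.T" "TLD_unit (Suc (Suc m)) q = up.const"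
  by (simp_all add: TLD_def TLD_T_def TLD_unit_def TLD_class_def up.T_def fun_eq_iff)

lemma TLD_down: "TLD (Suc m) q = A"
  by (simp add: TLD_def)

text \<open>Lowering the indices by one undoes \<open>shift\<close> on the path. At
  \<open>Sig 2\<close> the first conjugation, by T_3, cancels the one in \<open>\<psi>\<close>, and
  the others commute with T_2.\<close>

lemma P_gen_conjs:
  assumes "a \<in> nodes m"
  shows "P_gen (Suc m) q a = conjs 3 (\<psi> a)"
  using assms
proof (cases rule: nodes_cases)
  case (1 i)
  then have g: "P_gen (Suc m) q a = up.T (Sig i)" by (simp add: P_gen_def TLD_up Let_def)
  consider "i = 1" | "i = 2" | "3 \<le> i" using 1 by linarith
  then show ?thesis
  proof cases
    case 1
    then have "conjs 3 (up.T (Sig 1)) = up.T (Sig 1)"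
      using m3 by (intro conjs_fix_T Sig_node) auto
    then show ?thesis using g 1 \<open>a = Sig i\<close> by (simp add: \<psi>_def)
  next
    case 2
    have n: "Sig 2 \<in> nodes (Suc m)" "Sig 3 \<in> nodes (Suc m)" using m3 by (auto simp: nodes_def)
    note u = up.T_unit(1)[OF n(2)]
    have "conj_by up.A (up.T (Sig 3)) (\<psi> (Sig 2)) = up.T (Sig 2)"
      using up.A.conj_by_cancel[of "inv\<^bsub>up.A\<^esub> up.T (Sig 3)" "up.T (Sig 2)"] u up.T_closed[OF n(1)]
      by (simp add: \<psi>_def conj_by_def)
    moreover have "conjs 4 (up.T (Sig 2)) = up.T (Sig 2)"
      using m3 n by (intro conjs_fix_T) auto
    ultimately show ?thesis using g 2 \<open>a = Sig i\<close> m3 conjs_step[of 3] by simp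
  next
    case 3
    then show ?thesis using g 1 conjs_shift[of 3 i] by (simp add: \<psi>_def)
  qed
next
  case 2
  then have "P_gen (Suc m) q a = up.T (Sigbar 1)" using m3 by (simp add: P_gen_def TLD_up Let_def)
  moreover have "conjs 3 (up.T (Sigbar 1)) = up.T (Sigbar 1)"
    using m3 by (intro conjs_fix_T) (auto simp: nodes_def)
  ultimately show ?thesis using 2 by (simp add: \<psi>_def)
next
  case 3
  have n: "Sig (Suc m) \<in> nodes (Suc m)" "Sig m \<in> nodes (Suc m)" "Sigbar (Suc m) \<in> nodes (Suc m)"
    using m3 by (auto simp: nodes_def)
  have c: "up.T (Sig (Suc m)) \<in> carrier up.A" "up.T (Sig m) \<in> carrier up.A" "up.T (Sigbar (Suc m)) \<in> carrier up.A"
    "inv\<^bsub>up.A\<^esub> up.T (Sig (Suc m)) \<in> carrier up.A" "inv\<^bsub>up.A\<^esub> up.T (Sig m) \<in> carrier up.A"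
    using n up.T_closed up.T_unit(1) by auto
  have "P_gen (Suc m) q a = up.T (Sig (Suc m)) \<otimes>\<^bsub>up.A\<^esub> up.T (Sig m) \<otimes>\<^bsub>up.A\<^esub> up.T (Sigbar (Suc m))
      \<otimes>\<^bsub>up.A\<^esub> inv\<^bsub>up.A\<^esub> up.T (Sig m) \<otimes>\<^bsub>up.A\<^esub> inv\<^bsub>up.A\<^esub> up.T (Sig (Suc m))"
    using 3 by (simp add: P_gen_def TLD_up Let_def)
  also have "\<dots> = conj_by up.A (up.T (Sig (Suc m))) (conj_by up.A (up.T (Sig m)) (up.T (Sigbar (Suc m))))"
    using c by (simp only: conj_by_def up.A.m_assoc up.A.m_closed)
  also have "\<dots> = conjs 3 (up.T (Sigbar (Suc m)))" using m3 by (intro conjs_bar[symmetric]) auto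
  finally show ?thesis using 3 m3 by (simp add: \<psi>_def)
qed

lemma falg_eval_P_gen:
  assumes "f \<in> carrier (free_algebra (nodes m))"
  shows "falg_eval up.A up.const (P_gen (Suc m) q) f = conjs 3 (ev\<psi> f)"
proof -
  have h: "conjs 3 \<in> ring_hom up.A up.A" using conjs_hom_inj[of 3] m3 by simp
  interpret p: falg_target up.A up.const "P_gen (Suc m) q" "nodes m"
    by (rule up.falg_target_A) (simp add: P_gen_conjs ring_hom_closed[OF h] \<psi>_closed)
  have "conjs 3 (up.const c) = up.const c" for c
    using m3 by (intro conjs_fix conj_const up.T_unit Sig_node) auto
  then show ?thesis
    using falg_hom_eq[OF p.eval_hom ring_hom_trans[OF \<psi>.eval_hom h] _ _ assms]
    by (simp add: p.eval_gen p.eval_const \<psi>.eval_gen \<psi>.eval_const P_gen_conjs)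
qed

text \<open>Evaluation is constant on the coset because \<open>ev\<psi>\<close> respects the
  relations, so \<open>the_elem\<close> picks a genuine single value.\<close>

lemma P_cls:
  assumes f: "f \<in> carrier (free_algebra (nodes m))"
  shows "P (Suc m) q (cls f) = conjs 3 (ev\<psi> f)"
proof -
  have "falg_eval up.A up.const (P_gen (Suc m) q) g = conjs 3 (ev\<psi> f)" if "g \<in> cls f" for g
  proof -
    have g: "g \<in> carrier (free_algebra (nodes m))" "cls f = cls g"
      using that F.a_repr_independence[OF that f I.a_subgroup]
        F.a_r_coset_subset_G[OF I.a_subset f] by auto
    then show ?thesis using falg_eval_P_gen[OF g(1)] ev\<psi>_cls[OF f g(1)] by simp
  qed
  moreover have "f \<in> cls f" by (rule I.a_rcos_self[OF f])
  ultimately have "falg_eval up.A up.const (P_gen (Suc m) q) ` cls f = {conjs 3 (ev\<psi> f)}" by blast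
  then show ?thesis by (simp add: P_def TLD_up)
qed

theorem P_injective: "inj_on (P (Suc m) q) (carrier (TLD (Suc m) q))"
  unfolding TLD_down carrier_A
proof (rule inj_onI, elim imageE)
  fix x y f g assume xy: "x = cls f" "y = cls g" "P (Suc m) q x = P (Suc m) q y"
    and fg: "f \<in> carrier (free_algebra (nodes m))" "g \<in> carrier (free_algebra (nodes m))"
  have "conjs 3 (ev\<psi> f) = conjs 3 (ev\<psi> g)" using xy P_cls fg by simp
  then have e: "ev\<psi> f = ev\<psi> g"
    using conjs_hom_inj[of 3] m3 \<psi>.eval_closed fg by (auto dest: inj_onD)
  have d: "f - g \<in> carrier (free_algebra (nodes m))" by (rule free_algebra_closed(6)[OF fg])
  have z: "0 \<in> carrier (free_algebra (nodes m))" by (rule free_algebra_closed)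
  have "ev\<psi> (f - g) \<oplus>\<^bsub>up.A\<^esub> ev\<psi> g = ev\<psi> 0 \<oplus>\<^bsub>up.A\<^esub> ev\<psi> g"
    using \<psi>.eval_add[OF d fg(2)] \<psi>.eval_add[OF z fg(2)] e by simp
  then have "ev\<psi> (f - g) = ev\<psi> 0"
    using up.A.add.right_cancel \<psi>.eval_closed[OF d] \<psi>.eval_closed[OF z] \<psi>.eval_closed[OF fg(2)] by blast
  then have "f - g \<in> I" using ev\<psi>_injective[OF d] cls_eq_iff[OF d z] by simp
  then show "x = y" using xy cls_eq_iff[OF fg] by simp
qed

end

text \<open>The empty word is reduced, and its coefficient functional sends the class of a constant
  to that constant.\<close>

lemma (in TLD_alg) unit_injective: "inj (TLD_unit (Suc m) q)"
proof (rule injI)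
  fix c d assume "TLD_unit (Suc m) q c = TLD_unit (Suc m) q d"
  then have "fconst c - fconst d \<in> I"
    using cls_eq_iff[of "fconst c" "fconst d"]
    by (simp add: TLD_unit_def TLD_class_def free_algebra_closed)
  then have "fconst (c - d) * mon [] \<in> I" by (simp add: fconst_diff mon_Nil)
  then have "lin (D.nf_coeff m q []) (to_b (fconst (c - d) * mon [])) = 0"
    by (rule nf_coeff_vanishes)
  moreover have "D.nf_coeff m q [] [] = 1"
    by (intro D.nf_coeff_self) (simp add: D.FC_iff)
  ultimately show "c = d" by (simp add: to_b_def lin_single)
qed

theorem theorem6p8:
  fixes q :: "'k::{comm_ring, monoid_mult}"
  assumes "\<exists>r. q * r = 1"
  shows "inj (P3 q) \<and> (\<forall>n\<ge>4. inj_on (P n q) (carrier (TLD n q)))"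
proof -
  obtain r where r: "q * r = 1" using assms by blast
  interpret base: TLD_alg 3 q r by unfold_locales (use r in auto)
  have "inj_on (P n q) (carrier (TLD n q))" if "4 \<le> n" for n
  proof -
    \<comment> \<open>\<open>TLD n q\<close> is presented on \<open>nodes (n - 1)\<close>, hence the
      shift of the index.\<close>
    interpret TLD_tower "n - 1" q r by unfold_locales (use r that in auto)
    show ?thesis using P_injective that by simp
  qed
  moreover have "inj (P3 q)" using base.unit_injective by (simp add: P3_def eval_nat_numeral)
  ultimately show ?thesis by blast
qed

end
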